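(* Let $(E,\mathbf T)\in\mathcal L(\mathcal X,\mathcal Y)\times\mathcal L(\mathcal X)^d$ be an output stable pair with $\mathbf T$ a commutative tuple, $\mathbf x\in\mathcal X$ a vector and $S_0(\lambda)=\sum_{\mathbf n}S_{0,\mathbf n}\lambda^{\mathbf n}\in\mathcal S_d(\mathcal U,\mathcal Y)$ a Schur-class multiplier. Let $N=\sum_{\mathbf n\in\mathbb Z_+^d}S_{0,\mathbf n}^*E\mathbf T^{\mathbf n}\in\mathcal L(\mathcal X,\mathcal U)$ and assume that $P:=\mathcal O_{E,\mathbf T}^*\mathcal O_{E,\mathbf T}-\mathcal O_{N,\mathbf T}^*\mathcal O_{N,\mathbf T}$ is strictly positive definite. Let $\mathcal F$ be a Hilbert space and let $\mathfrak A=\begin{bmatrix}\mathfrak A_{11}&\mathfrak A_{12}\\ \mathfrak A_{21}&\mathfrak A_{22}\end{bmatrix}$ be an $\mathcal L(\mathcal F\oplus\mathcal U,\mathcal Y\oplus\mathcal U)$-valued function on $\mathbb B^d$ such that $$\frac{J_{\mathcal Y,\mathcal U}-\mathfrak A(\lambda)J_{\mathcal F,\mathcal U}\mathfrak A(\eta)^*}{1-\langle\lambda,\eta\rangle}=\begin{bmatrix}E\\ N\end{bmatrix}(I-Z(\lambda)T)^{-1}P^{-1}(I-T^*Z(\eta)^* )^{-1}\begin{bmatrix}E^*&N^*\end{bmatrix}\qquad(\lambda,\eta\in\mathbb B^d),$$ let $\mathcal E_0\in\mathcal S_d(\mathcal U,\mathcal F)$ be such that $S_0=(\mathfrak A_{11}\mathcal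 E_0+\mathfrak A_{12})(\mathfrak A_{21}\mathcal E_0+\mathfrak A_{22})^{-1}$, and let $$u(\lambda)=\mathfrak A_{11}(\lambda)-S_0(\lambda)\mathfrak A_{21}(\lambda),\qquad\mathcal M=\mathcal H(\mathcal E_0)\ominus\operatorname{Ker}M_u,$$ where $M_u:\mathcal H(\mathcal E_0)\to\mathcal H(S_0)$, $h\mapsto uh$. Then a $\mathcal Y$-valued function $f$ on $\mathbb B^d$ satisfies $f\in\mathcal H(S_0)$ and $\mathcal O_{E,\mathbf T}^*f=\mathbf x$ if and only if it is of the form $$f(\lambda)=f_0(\lambda)+u(\lambda)h(\lambda),\qquad h\in\mathcal M,$$ where $f_0(\lambda)=(E-S_0(\lambda)N)(I_{\mathcal X}-Z(\lambda)T)^{-1}P^{-1}\mathbf x$ and $h$ is a free parameter from $\mathcal M$. Furthermore, for $f$ of this form, $$\|f\|^2_{\mathcal H(S_0)}=\|f_0\|^2_{\mathcal H(S_0)}+\|uh\|^2_{\mathcal H(S_0)}=\|P^{-1/2}\mathbf x\|^2_{\mathcal X}+\|h\|^2_{\mathcal H(\mathcal E_0)}.$$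
   Context: All Hilbert spaces are complex and separable; $\mathcal L(\mathcal U,\mathcal Y)$ denotes bounded operators. $\mathcal X,\mathcal Y,\mathcal U$ are Hilbert spaces, $d\ge1$. For $\mathbf n\in\mathbb Z_+^d$: $|\mathbf n|=n_1+\cdots+n_d$, $\mathbf n!=n_1!\cdots n_d!$, $\lambda^{\mathbf n}=\lambda_1^{n_1}\cdots\lambda_d^{n_d}$, and $\mathbf T^{\mathbf n}=T_1^{n_1}\cdots T_d^{n_d}$ for a commuting tuple. $\mathbb B^d$ is the open unit ball of $\mathbb C^d$, $\langle\lambda,\eta\rangle=\sum_j\lambda_j\overline{\eta}_j$, $k_d(\lambda,\eta)=(1-\langle\lambda,\eta\rangle)^{-1}$. The Drury–Arveson space $\mathcal H_{\mathcal Y}(k_d)$ is the reproducing kernel Hilbert space with kernel $k_dI_{\mathcal Y}$, i.e. functions $f=\sum f_{\mathbf n}\lambda^{\mathbf n}$ with $\|f\|^2=\sum\frac{\mathbf n!}{|\mathbf n|!}\|f_{\mathbf n}\|^2<\infty$. $\mathcal S_d(\mathcal U,\mathcal Y)$ is the set of analytic $\mathcal L(\mathcal U,\mathcal Y)$-valued functions $S$ on $\mathbb B^d$ such that $M_S:f\mapsto Sf$ is a contraction $\mathcal H_{\mathcal U}(k_d)\to\mathcal H_{\mathcal Y}(k_d)$; $\mathcal H(S)$ is the reproducing kernel Hilbert space with kernel $(I-S(\lambda)S(\eta)^* )/(1-\langle\lambda,\eta\rangle)$. $Z(\lambda)=[\lambda_1\ \cdots\ \lambda_d]\otimes I_{\mathcal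 X}$, $T=\begin{bmatrix}T_1\\ \vdots\\ T_d\end{bmatrix}$. $\mathcal O_{E,\mathbf T}x=E(I-Z(\lambda)T)^{-1}x=\sum_{\mathbf n}\frac{|\mathbf n|!}{\mathbf n!}E\mathbf T^{\mathbf n}x\,\lambda^{\mathbf n}$; the pair is output stable if this is a bounded operator $\mathcal X\to\mathcal H_{\mathcal Y}(k_d)$. Adjoints $\mathcal O^*$ are with respect to the $\mathcal H_{\mathcal Y}(k_d)$ (resp. $\mathcal H_{\mathcal U}(k_d)$) inner product. The series for $N$ converges weakly, equivalently $N^*=\mathcal O_{E,\mathbf T}^*M_{S_0}|_{\mathcal U}$ with $\mathcal U$ the constant functions, and $(N,\mathbf T)$ is output stable. $J_{\mathcal Y,\mathcal U}=\begin{bmatrix}I_{\mathcal Y}&0\\ 0&-I_{\mathcal U}\end{bmatrix}$ and similarly $J_{\mathcal F,\mathcal U}$. Strictly positive definite means positive semidefinite and boundedly invertible. *)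

theory Defs
  imports "HOL-Analysis.Analysis"
begin

section \<open>Complex Hilbert spaces\<close>

class complex_normed_vector = real_normed_vector +
  fixes scaleC :: "complex \<Rightarrow> 'a \<Rightarrow> 'a"  (infixr "*\<^sub>C" 75)
  assumes scaleC_add_right: "c *\<^sub>C (x + y) = c *\<^sub>C x + c *\<^sub>C y"
    and scaleC_add_left: "(b + c) *\<^sub>C x = b *\<^sub>C x + c *\<^sub>C x"
    and scaleC_scaleC: "b *\<^sub>C (c *\<^sub>C x) = (b * c) *\<^sub>C x"
    and scaleR_scaleC: "r *\<^sub>R x = complex_of_real r *\<^sub>C x"
    and norm_scaleC: "norm (c *\<^sub>C x) = cmod c * norm x"

text \<open>Separable complex Hilbert spaces. The complex inner product is linear in its first argument;
  its real part is the inner product of the underlying real Hilbert space, which induces the norm.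
  Second countability of the norm topology is separability.\<close>

class complex_hilbert =
    real_inner + complete_space + second_countable_topology + complex_normed_vector +
  fixes cinner :: "'a \<Rightarrow> 'a \<Rightarrow> complex"
  assumes cinner_commute: "cinner x y = cnj (cinner y x)"
    and cinner_add_left: "cinner (x + y) z = cinner x z + cinner y z"
    and cinner_scaleC_left: "cinner (c *\<^sub>C x) y = c * cinner x y"
    and inner_eq_Re_cinner: "inner x y = Re (cinner x y)"

lemma bounded_linear_scaleC_right:
  "bounded_linear (\<lambda>x::'a::complex_normed_vector. c *\<^sub>C x)"
proof
  fix x y :: 'a and r :: real
  show "c *\<^sub>C (x + y) = c *\<^sub>C x + c *\<^sub>C y" by (rule scaleC_add_right)
  show "c *\<^sub>C (r *\<^sub>R x) = r *\<^sub>R (c *\<^sub>C x)"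
    by (simp add: scaleR_scaleC scaleC_scaleC mult.commute)
  show "\<exists>K. \<forall>x::'a. norm (c *\<^sub>C x) \<le> norm x * K"
    by (rule exI[of _ "cmod c"]) (simp add: norm_scaleC mult.commute)
qed

lemma scaleC_zero_left: "0 *\<^sub>C x = (0::'a::complex_normed_vector)"
  using scaleC_add_left[of 0 0 x] by simp

lemma scaleC_one: "1 *\<^sub>C x = (x::'a::complex_normed_vector)"
  using scaleR_scaleC[of 1 x] by simp

instantiation blinfun :: (real_normed_vector, complex_normed_vector) complex_normed_vector
begin

lift_definition scaleC_blinfun :: "complex \<Rightarrow> ('a, 'b) blinfun \<Rightarrow> ('a, 'b) blinfun"
  is "\<lambda>c f x. c *\<^sub>C f x"
  by (rule bounded_linear_compose[OF bounded_linear_scaleC_right])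

instance
proof
  fix b c :: complex and r :: real and A B :: "('a, 'b) blinfun"
  show "c *\<^sub>C (A + B) = c *\<^sub>C A + c *\<^sub>C B"
    by transfer (simp add: scaleC_add_right)
  show "(b + c) *\<^sub>C A = b *\<^sub>C A + c *\<^sub>C A"
    by transfer (simp add: scaleC_add_left)
  show assoc: "b *\<^sub>C (c *\<^sub>C A) = (b * c) *\<^sub>C A" for b c and A :: "('a, 'b) blinfun"
    by transfer (simp add: scaleC_scaleC)
  show "r *\<^sub>R A = complex_of_real r *\<^sub>C A"
    by transfer (simp add: scaleR_scaleC)
  have le: "norm (c *\<^sub>C A) \<le> cmod c * norm A" for c and A :: "('a, 'b) blinfun"
  proof (rule norm_blinfun_bound)
    fix x
    have "norm (blinfun_apply (c *\<^sub>C A) x) = cmod c * norm (blinfun_apply A x)"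
      by (simp add: scaleC_blinfun.rep_eq norm_scaleC)
    also have "\<dots> \<le> cmod c * (norm A * norm x)"
      by (intro mult_left_mono norm_blinfun) simp
    finally show "norm (blinfun_apply (c *\<^sub>C A) x) \<le> cmod c * norm A * norm x"
      by (simp add: mult.assoc)
  qed simp
  show "norm (c *\<^sub>C A) = cmod c * norm A"
  proof (cases "c = 0")
    case True
    have "c *\<^sub>C A = 0" unfolding True by transfer (simp add: scaleC_zero_left)
    then show ?thesis using True by simp
  next
    case False
    have "inverse c *\<^sub>C (c *\<^sub>C A) = A"
      using False by (simp add: assoc) (transfer, simp add: scaleC_one)
    then have "norm A \<le> cmod (inverse c) * norm (c *\<^sub>C A)"
      using le[of "inverse c" "c *\<^sub>C A"] by simp
    then have "cmod c * norm A \<le> norm (c *\<^sub>C A)"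
      using False by (simp add: norm_inverse norm_divide field_simps)
    then show ?thesis using le[of c A] by simp
  qed
qed

end

text \<open>The Hilbert space direct sum of two spaces is their product type.\<close>

instantiation prod :: (complex_normed_vector, complex_normed_vector) complex_normed_vector
begin

definition scaleC_prod :: "complex \<Rightarrow> 'a \<times> 'b \<Rightarrow> 'a \<times> 'b"
  where "scaleC_prod c p = (c *\<^sub>C fst p, c *\<^sub>C snd p)"

instance
proof
  fix b c :: complex and r :: real and p q :: "'a \<times> 'b"
  show "c *\<^sub>C (p + q) = c *\<^sub>C p + c *\<^sub>C q"
    by (simp add: scaleC_prod_def scaleC_add_right)
  show "(b + c) *\<^sub>C p = b *\<^sub>C p + c *\<^sub>C p"
    by (simp add: scaleC_prod_def scaleC_add_left)
  show "b *\<^sub>C (c *\<^sub>C p) = (b * c) *\<^sub>C p"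
    by (simp add: scaleC_prod_def scaleC_scaleC)
  show "r *\<^sub>R p = complex_of_real r *\<^sub>C p"
    by (simp add: scaleC_prod_def scaleR_prod_def scaleR_scaleC)
  have "(cmod c * norm (fst p))\<^sup>2 + (cmod c * norm (snd p))\<^sup>2
      = (cmod c)\<^sup>2 * ((norm (fst p))\<^sup>2 + (norm (snd p))\<^sup>2)"
    by (simp add: power_mult_distrib algebra_simps)
  then show "norm (c *\<^sub>C p) = cmod c * norm p"
    by (simp add: scaleC_prod_def norm_prod_def norm_scaleC real_sqrt_mult)
qed

end

instantiation prod :: (complex_hilbert, complex_hilbert) complex_hilbert
begin

definition cinner_prod :: "'a \<times> 'b \<Rightarrow> 'a \<times> 'b \<Rightarrow> complex"
  where "cinner_prod p q = cinner (fst p) (fst q) + cinner (snd p) (snd q)"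

instance
proof
  fix c :: complex and p q s :: "'a \<times> 'b"
  show "cinner p q = cnj (cinner q p)"
    using cinner_commute[of "fst p" "fst q"] cinner_commute[of "snd p" "snd q"]
    by (simp add: cinner_prod_def)
  show "cinner (p + q) s = cinner p s + cinner q s"
    by (simp add: cinner_prod_def cinner_add_left)
  show "cinner (c *\<^sub>C p) q = c * cinner p q"
    by (simp add: cinner_prod_def scaleC_prod_def cinner_scaleC_left distrib_left)
  show "inner p q = Re (cinner p q)"
    by (simp add: cinner_prod_def inner_prod_def inner_eq_Re_cinner)
qed

end

section \<open>Bounded operators\<close>

text \<open>The type of bounded linear functions consists of the real-linear ones, so the elements of
  \<open>L(X,Y)\<close> are those which in addition satisfy the following predicate.\<close>

definition complex_linear ::
    "('a::complex_normed_vector \<Rightarrow>\<^sub>L 'b::complex_normed_vector) \<Rightarrow> bool"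
  where "complex_linear A \<longleftrightarrow> (\<forall>c x. A (c *\<^sub>C x) = c *\<^sub>C A x)"

definition adj :: "('a::complex_hilbert \<Rightarrow>\<^sub>L 'b::complex_hilbert) \<Rightarrow> ('b \<Rightarrow>\<^sub>L 'a)"
  where "adj A = (THE B :: 'b \<Rightarrow>\<^sub>L 'a. \<forall>x y. cinner (A x) y = cinner x (B y))"

definition op_invertible :: "('a::real_normed_vector \<Rightarrow>\<^sub>L 'b::real_normed_vector) \<Rightarrow> bool"
  where "op_invertible A \<longleftrightarrow> (\<exists>B. A o\<^sub>L B = id_blinfun \<and> B o\<^sub>L A = id_blinfun)"

definition op_inv ::
    "('a::real_normed_vector \<Rightarrow>\<^sub>L 'b::real_normed_vector) \<Rightarrow> ('b \<Rightarrow>\<^sub>L 'a)"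
  where "op_inv A = (THE B. A o\<^sub>L B = id_blinfun \<and> B o\<^sub>L A = id_blinfun)"

definition pos_semidef :: "('a::complex_hilbert \<Rightarrow>\<^sub>L 'a) \<Rightarrow> bool"
  where "pos_semidef A \<longleftrightarrow>
    complex_linear A \<and> (\<forall>x. cinner (A x) x \<in> \<real> \<and> 0 \<le> Re (cinner (A x) x))"

definition strictly_pos_def :: "('a::complex_hilbert \<Rightarrow>\<^sub>L 'a) \<Rightarrow> bool"
  where "strictly_pos_def A \<longleftrightarrow> pos_semidef A \<and> op_invertible A"

definition op_sqrt :: "('a::complex_hilbert \<Rightarrow>\<^sub>L 'a) \<Rightarrow> ('a \<Rightarrow>\<^sub>L 'a)"
  where "op_sqrt A = (THE B. pos_semidef B \<and> B o\<^sub>L B = A)"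

definition has_weak_sum ::
    "('i \<Rightarrow> 'a::complex_hilbert \<Rightarrow>\<^sub>L 'b::complex_hilbert) \<Rightarrow> ('a \<Rightarrow>\<^sub>L 'b) \<Rightarrow> bool"
  where "has_weak_sum F A \<longleftrightarrow>
    (\<forall>x y. ((\<lambda>i. cinner (F i x) y) has_sum cinner (A x) y) UNIV)"

definition block_col ::
    "('a::real_normed_vector \<Rightarrow>\<^sub>L 'b::real_normed_vector) \<Rightarrow>
     ('a \<Rightarrow>\<^sub>L 'c::real_normed_vector) \<Rightarrow> ('a \<Rightarrow>\<^sub>L ('b \<times> 'c))"
  where "block_col A B = Blinfun (\<lambda>x. (A x, B x))"

definition block_row ::
    "('a::real_normed_vector \<Rightarrow>\<^sub>L 'c::real_normed_vector) \<Rightarrow>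
     ('b::real_normed_vector \<Rightarrow>\<^sub>L 'c) \<Rightarrow> (('a \<times> 'b) \<Rightarrow>\<^sub>L 'c)"
  where "block_row A B = Blinfun (\<lambda>(x, y). A x + B y)"

definition block_op ::
    "('a::real_normed_vector \<Rightarrow>\<^sub>L 'c::real_normed_vector) \<Rightarrow>
     ('b::real_normed_vector \<Rightarrow>\<^sub>L 'c) \<Rightarrow>
     ('a \<Rightarrow>\<^sub>L 'd::real_normed_vector) \<Rightarrow>
     ('b \<Rightarrow>\<^sub>L 'd) \<Rightarrow> (('a \<times> 'b) \<Rightarrow>\<^sub>L ('c \<times> 'd))"
  where "block_op A B C D = Blinfun (\<lambda>(x, y). (A x + B y, C x + D y))"

definition J_op :: "('a::real_normed_vector \<times> 'b::real_normed_vector) \<Rightarrow>\<^sub>L ('a \<times> 'b)"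
  where "J_op = block_op id_blinfun 0 0 (- id_blinfun)"

section \<open>The unit ball and power series\<close>

text \<open>The ball is a type of its own, so that functions on it are total functions. The dimension is
  the cardinality of the finite (and nonempty) index type.\<close>

typedef (overloaded) 'd unit_ball = "ball (0 :: complex ^ 'd::finite) 1"
  by (rule exI[of _ 0]) simp

definition coord :: "'d::finite unit_ball \<Rightarrow> 'd \<Rightarrow> complex"
  where "coord z j = Rep_unit_ball z $ j"

definition ball_inner :: "'d::finite unit_ball \<Rightarrow> 'd unit_ball \<Rightarrow> complex"
  where "ball_inner z w = (\<Sum>j\<in>UNIV. coord z j * cnj (coord w j))"

text \<open>Multi-indices are functions from the index type to the natural numbers.\<close>

definition mi_abs :: "('d::finite \<Rightarrow> nat) \<Rightarrow> nat"
  where "mi_abs n = (\<Sum>j\<in>UNIV. n j)"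

definition mi_fact :: "('d::finite \<Rightarrow> nat) \<Rightarrow> nat"
  where "mi_fact n = (\<Prod>j\<in>UNIV. fact (n j))"

definition monomial :: "'d::finite unit_ball \<Rightarrow> ('d \<Rightarrow> nat) \<Rightarrow> complex"
  where "monomial z n = (\<Prod>j\<in>UNIV. coord z j ^ n j)"

text \<open>Convergence is in norm, in particular in operator norm for operator-valued functions.\<close>

definition has_power_series ::
    "(('d::finite \<Rightarrow> nat) \<Rightarrow> 'a::complex_normed_vector) \<Rightarrow> ('d unit_ball \<Rightarrow> 'a) \<Rightarrow> bool"
  where "has_power_series c f \<longleftrightarrow>
    (\<forall>z. ((\<lambda>n. monomial z n *\<^sub>C c n) has_sum f z) UNIV)"

definition power_coeff ::
    "('d::finite unit_ball \<Rightarrow> 'a::complex_normed_vector) \<Rightarrow> ('d \<Rightarrow> nat) \<Rightarrow> 'a"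
  where "power_coeff f = (THE c. has_power_series c f)"

section \<open>The Drury--Arveson space and the Schur class\<close>

definition da_weight :: "('d::finite \<Rightarrow> nat) \<Rightarrow> real"
  where "da_weight n = real (mi_fact n) / fact (mi_abs n)"

definition drury_arveson :: "('d::finite unit_ball \<Rightarrow> 'y::complex_hilbert) set"
  where "drury_arveson = {f. \<exists>c. has_power_series c f \<and>
    (\<lambda>n. da_weight n * (norm (c n))\<^sup>2) summable_on UNIV}"

definition da_norm :: "('d::finite unit_ball \<Rightarrow> 'y::complex_hilbert) \<Rightarrow> real"
  where "da_norm f = sqrt (\<Sum>\<^sub>\<infinity>n. da_weight n * (norm (power_coeff f n))\<^sup>2)"

definition da_inner ::
    "('d::finite unit_ball \<Rightarrow> 'y::complex_hilbert) \<Rightarrow> ('d unit_ball \<Rightarrow> 'y) \<Rightarrow> complex"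
  where "da_inner f g =
    (\<Sum>\<^sub>\<infinity>n. complex_of_real (da_weight n) * cinner (power_coeff f n) (power_coeff g n))"

definition schur_class ::
    "('d::finite unit_ball \<Rightarrow> 'u::complex_hilbert \<Rightarrow>\<^sub>L 'y::complex_hilbert) set"
  where "schur_class = {S.
    (\<forall>z. complex_linear (S z)) \<and>
    (\<exists>c. (\<forall>n. complex_linear (c n)) \<and> has_power_series c S) \<and>
    (\<forall>f \<in> drury_arveson. (\<lambda>z. S z (f z)) \<in> drury_arveson \<and>
       da_norm (\<lambda>z. S z (f z)) \<le> da_norm f)}"

section \<open>Reproducing kernel Hilbert spaces\<close>

definition ip_norm :: "('f \<Rightarrow> 'f \<Rightarrow> complex) \<Rightarrow> 'f \<Rightarrow> real"
  where "ip_norm ip f = sqrt (Re (ip f f))"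

text \<open>A Hilbert space of functions is given by its carrier and its inner product (which is
  unspecified outside the carrier).\<close>

locale function_hilbert_space =
  fixes H :: "('p \<Rightarrow> 'y::complex_hilbert) set"
    and ip :: "('p \<Rightarrow> 'y) \<Rightarrow> ('p \<Rightarrow> 'y) \<Rightarrow> complex"
  assumes zero_mem: "(\<lambda>_. 0) \<in> H"
    and add_mem: "\<lbrakk>f \<in> H; g \<in> H\<rbrakk> \<Longrightarrow> (\<lambda>p. f p + g p) \<in> H"
    and scale_mem: "f \<in> H \<Longrightarrow> (\<lambda>p. c *\<^sub>C f p) \<in> H"
    and ip_commute: "\<lbrakk>f \<in> H; g \<in> H\<rbrakk> \<Longrightarrow> ip f g = cnj (ip g f)"
    and ip_add_left:
      "\<lbrakk>f \<in> H; g \<in> H; k \<in> H\<rbrakk> \<Longrightarrow> ip (\<lambda>p. f p + g p) k = ip f k + ip g k"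
    and ip_scale_left: "\<lbrakk>f \<in> H; g \<in> H\<rbrakk> \<Longrightarrow> ip (\<lambda>p. c *\<^sub>C f p) g = c * ip f g"
    and ip_nonneg: "f \<in> H \<Longrightarrow> 0 \<le> Re (ip f f)"
    and ip_definite: "\<lbrakk>f \<in> H; ip f f = 0\<rbrakk> \<Longrightarrow> f = (\<lambda>_. 0)"
    and ip_complete:
      "\<lbrakk>\<And>i. s i \<in> H;
        \<And>e. e > 0 \<Longrightarrow> \<exists>n. \<forall>i\<ge>n. \<forall>j\<ge>n. ip_norm ip (\<lambda>p. s i p - s j p) < e\<rbrakk>
       \<Longrightarrow> \<exists>f\<in>H. (\<lambda>i. ip_norm ip (\<lambda>p. s i p - f p)) \<longlonglongrightarrow> 0"

locale rkhs = function_hilbert_space H ip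
  for K :: "'p \<Rightarrow> 'p \<Rightarrow> ('y::complex_hilbert \<Rightarrow>\<^sub>L 'y)"
    and H :: "('p \<Rightarrow> 'y) set" and ip :: "('p \<Rightarrow> 'y) \<Rightarrow> ('p \<Rightarrow> 'y) \<Rightarrow> complex" +
  assumes kernel_mem: "(\<lambda>p. K p q y) \<in> H"
    and reproducing: "f \<in> H \<Longrightarrow> ip f (\<lambda>p. K p q y) = cinner (f q) y"

definition ortho_minus ::
    "'f set \<Rightarrow> ('f \<Rightarrow> 'f \<Rightarrow> complex) \<Rightarrow> 'f set \<Rightarrow> 'f set"
  where "ortho_minus H ip W = {h \<in> H. \<forall>k\<in>W. ip h k = 0}"

definition mult_kernel ::
    "('p \<Rightarrow> 'a::real_normed_vector \<Rightarrow>\<^sub>L 'b::real_normed_vector) \<Rightarrow> ('p \<Rightarrow> 'a) set \<Rightarrow> ('p \<Rightarrow> 'a) set"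
  where "mult_kernel u H = {h \<in> H. (\<lambda>p. u p (h p)) = (\<lambda>_. 0)}"

definition deBranges_Rovnyak_kernel ::
    "('d::finite unit_ball \<Rightarrow> 'u::complex_hilbert \<Rightarrow>\<^sub>L 'y::complex_hilbert) \<Rightarrow>
     'd unit_ball \<Rightarrow> 'd unit_ball \<Rightarrow> ('y \<Rightarrow>\<^sub>L 'y)"
  where "deBranges_Rovnyak_kernel S z w =
    (1 / (1 - ball_inner z w)) *\<^sub>C (id_blinfun - (S z o\<^sub>L adj (S w)))"

section \<open>Operator tuples and output pairs\<close>

definition commuting_tuple :: "('d \<Rightarrow> 'x::real_normed_vector \<Rightarrow>\<^sub>L 'x) \<Rightarrow> bool"
  where "commuting_tuple T \<longleftrightarrow> (\<forall>i j. T i o\<^sub>L T j = T j o\<^sub>L T i)"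

text \<open>For a commuting tuple the order in which the fold composes the factors is immaterial.\<close>

definition tuple_power ::
    "('d::finite \<Rightarrow> 'x::real_normed_vector \<Rightarrow>\<^sub>L 'x) \<Rightarrow> ('d \<Rightarrow> nat) \<Rightarrow> ('x \<Rightarrow>\<^sub>L 'x)"
  where "tuple_power T n = Finite_Set.fold (\<lambda>j. (\<lambda>A. T j o\<^sub>L A) ^^ n j) id_blinfun UNIV"

text \<open>The operator \<open>Z(z)T\<close>, the row \<open>Z(z)\<close> times the column \<open>T\<close>.\<close>

definition ZT ::
    "('d::finite \<Rightarrow> 'x::complex_hilbert \<Rightarrow>\<^sub>L 'x) \<Rightarrow> 'd unit_ball \<Rightarrow> ('x \<Rightarrow>\<^sub>L 'x)"
  where "ZT T z = (\<Sum>j\<in>UNIV. coord z j *\<^sub>C T j)"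

definition obs_coeff ::
    "('x::complex_hilbert \<Rightarrow>\<^sub>L 'y::complex_hilbert) \<Rightarrow> ('d::finite \<Rightarrow> 'x \<Rightarrow>\<^sub>L 'x) \<Rightarrow>
     'x \<Rightarrow> ('d \<Rightarrow> nat) \<Rightarrow> 'y"
  where "obs_coeff E T x n = (fact (mi_abs n) / real (mi_fact n)) *\<^sub>R E (tuple_power T n x)"

text \<open>The observability operator is taken in its power series form, which makes sense for every
  output stable pair, whether or not \<open>I - Z(z)T\<close> is invertible.\<close>

definition obs ::
    "('x::complex_hilbert \<Rightarrow>\<^sub>L 'y::complex_hilbert) \<Rightarrow> ('d::finite \<Rightarrow> 'x \<Rightarrow>\<^sub>L 'x) \<Rightarrow>
     'x \<Rightarrow> ('d unit_ball \<Rightarrow> 'y)"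
  where "obs E T x = (\<lambda>z. \<Sum>\<^sub>\<infinity>n. monomial z n *\<^sub>C obs_coeff E T x n)"

definition output_stable ::
    "('x::complex_hilbert \<Rightarrow>\<^sub>L 'y::complex_hilbert) \<Rightarrow> ('d::finite \<Rightarrow> 'x \<Rightarrow>\<^sub>L 'x) \<Rightarrow> bool"
  where "output_stable E T \<longleftrightarrow>
    (\<forall>x. has_power_series (obs_coeff E T x) (obs E T x) \<and> obs E T x \<in> drury_arveson) \<and>
    (\<exists>C. \<forall>x. da_norm (obs E T x) \<le> C * norm x)"

definition obs_adj ::
    "('x::complex_hilbert \<Rightarrow>\<^sub>L 'y::complex_hilbert) \<Rightarrow> ('d::finite \<Rightarrow> 'x \<Rightarrow>\<^sub>L 'x) \<Rightarrow>
     ('d unit_ball \<Rightarrow> 'y) \<Rightarrow> 'x"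
  where "obs_adj E T f = (THE v. \<forall>x. da_inner (obs E T x) f = cinner x v)"

definition obs_gramian ::
    "('x::complex_hilbert \<Rightarrow>\<^sub>L 'y::complex_hilbert) \<Rightarrow> ('d::finite \<Rightarrow> 'x \<Rightarrow>\<^sub>L 'x) \<Rightarrow>
     ('x \<Rightarrow>\<^sub>L 'x)"
  where "obs_gramian E T = Blinfun (\<lambda>x. obs_adj E T (obs E T x))"

end

theory Submission
  imports Defs "HOL-Library.Function_Algebras"
begin

text \<open>Write \<open>F(z) = (E - S\<^sub>0(z) N)(I - Z(z)T)\<^sup>-\<^sup>1\<close>. Multiplying the identity for the kernel of \<open>\<AA>\<close> by
  \<open>[I, -S\<^sub>0(z)]\<close> from the left and by the adjoint of \<open>[I, -S\<^sub>0(w)]\<close> from the right, and using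
  \<open>[I, -S\<^sub>0] \<AA> = [u, -u \<E>\<^sub>0]\<close>, which is the linear fractional relation between \<open>S\<^sub>0\<close> and \<open>\<E>\<^sub>0\<close>,
  one obtains a decomposition of the kernel of \<open>H(S\<^sub>0)\<close>,
  \<open>K\<^bsub>S\<^esub>(z,w) = u(z) K\<^bsub>\<E>\<^esub>(z,w) u(w)\<^sup>* + F(z) P\<^sup>-\<^sup>1 F(w)\<^sup>*\<close>
  (lemma \<open>deBranges_Rovnyak_kernel_decomposition\<close>).

  A sum of kernels corresponds to a coisometry. With \<open>R = P\<^sup>-\<^sup>1\<^sup>/\<^sup>2\<close>, the map
  \<open>\<Gamma>(h, v) = u h + F R v\<close> sends \<open>H(\<E>\<^sub>0) \<oplus> \<X>\<close> onto \<open>H(S\<^sub>0)\<close>, and it is isometric exactly on the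
  orthogonal complement of its kernel (locale \<open>feature_map\<close>).

  On the other hand \<open>v \<mapsto> F v\<close> is the adjoint of \<open>\<O>\<^sup>*\<close> restricted to \<open>H(S\<^sub>0)\<close>, because
  \<open>\<O>\<^bsub>N,T\<^esub> = M\<^bsub>S\<^esub>\<^sup>* \<O>\<^bsub>E,T\<^esub>\<close> gives \<open>F v = (I - M\<^bsub>S\<^esub> M\<^bsub>S\<^esub>\<^sup>*) \<O>\<^bsub>E,T\<^esub> v\<close>; moreover
  \<open>\<langle>F v, F w\<rangle> = \<langle>v, P w\<rangle>\<close> (lemmas \<open>obs_N_adjoint\<close>, \<open>ip_F_op_obs_adj\<close>, \<open>ip_F_op_F_op\<close>).
  Hence \<open>\<parallel>F R v\<parallel> = \<parallel>v\<parallel>\<close>, so \<open>\<Gamma>\<close> is isometric on \<open>0 \<oplus> \<X>\<close>, and its kernel is therefore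
  \<open>Ker M\<^sub>u \<oplus> 0\<close>. Consequently every \<open>f\<close> in \<open>H(S\<^sub>0)\<close> is \<open>u h + F R v\<close> with \<open>h\<close> in \<open>\<M>\<close>, the two
  summands are orthogonal, and \<open>\<parallel>f\<parallel>\<^sup>2 = \<parallel>h\<parallel>\<^sup>2 + \<parallel>v\<parallel>\<^sup>2\<close>. Since \<open>\<O>\<^sup>*\<close> annihilates \<open>u h\<close> and
  maps \<open>F R v\<close> to \<open>P R v\<close>, the condition \<open>\<O>\<^sup>* f = x\<close> says \<open>R v = P\<^sup>-\<^sup>1 x\<close>, that is,
  \<open>F R v = f\<^sub>0\<close>.

  All of this needs \<open>I - Z(z)T\<close> to be invertible. As \<open>P\<close> is bounded below, so is the observability
  Gramian of \<open>(E, T)\<close>, and in the norm \<open>\<parallel>\<O> x\<parallel>\<close> the operator \<open>Z(z)T\<close> is a strict contraction by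
  the Stein inequality (lemmas \<open>exactly_observable\<close>, \<open>op_invertible_resolvent\<close>).\<close>

subclass (in complex_hilbert) banach ..

section \<open>The complex inner product\<close>

lemma cinner_add_right: "cinner x (y + z) = cinner x y + cinner x (z::'a::complex_hilbert)"
  by (metis cinner_add_left cinner_commute complex_cnj_add)

lemma cinner_scaleC_right: "cinner x (c *\<^sub>C y) = cnj c * cinner x (y::'a::complex_hilbert)"
  by (metis cinner_commute cinner_scaleC_left complex_cnj_mult)

lemma cinner_zero_left [simp]: "cinner 0 (x::'a::complex_hilbert) = 0"
  using cinner_add_left[of 0 0 x] by simp

lemma cinner_zero_right [simp]: "cinner (x::'a::complex_hilbert) 0 = 0"
  using cinner_add_right[of x 0 0] by simp

lemma cinner_minus_left: "cinner (- x) y = - cinner x (y::'a::complex_hilbert)"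
  using cinner_add_left[of x "- x" y] by (simp add: minus_unique)

lemma cinner_minus_right: "cinner x (- y) = - cinner x (y::'a::complex_hilbert)"
  using cinner_add_right[of x y "- y"] by (simp add: minus_unique)

lemma cinner_diff_left: "cinner (x - y) z = cinner x z - cinner y (z::'a::complex_hilbert)"
  using cinner_add_left[of x "- y" z] by (simp add: cinner_minus_left)

lemma cinner_diff_right: "cinner x (y - z) = cinner x y - cinner x (z::'a::complex_hilbert)"
  using cinner_add_right[of x y "- z"] by (simp add: cinner_minus_right)

lemma cinner_scaleR_left: "cinner (r *\<^sub>R x) y = of_real r * cinner x (y::'a::complex_hilbert)"
  by (simp add: scaleR_scaleC cinner_scaleC_left)

lemma cinner_scaleR_right: "cinner x (r *\<^sub>R y) = of_real r * cinner x (y::'a::complex_hilbert)"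
  by (simp add: scaleR_scaleC cinner_scaleC_right)

lemmas cinner_simps = cinner_add_left cinner_add_right cinner_diff_left cinner_diff_right
  cinner_scaleC_left cinner_scaleC_right cinner_minus_left cinner_minus_right

lemma cinner_self: "cinner x x = of_real ((norm (x::'a::complex_hilbert))\<^sup>2)"
proof -
  have "Im (cinner x x) = 0"
    using arg_cong[OF cinner_commute[of x x], of Im] by simp
  moreover have "Re (cinner x x) = (norm x)\<^sup>2"
    by (simp add: inner_eq_Re_cinner[symmetric] power2_norm_eq_inner)
  ultimately show ?thesis by (simp add: complex_eq_iff)
qed

lemma cinner_eqI: "(\<And>y. cinner x y = cinner x' y) \<Longrightarrow> x = (x'::'a::complex_hilbert)"
  using cinner_self[of "x - x'"] by (simp add: cinner_diff_left)

lemma cinner_eqI_right: "(\<And>y. cinner y x = cinner y x') \<Longrightarrow> x = (x'::'a::complex_hilbert)"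
  using cinner_self[of "x - x'"] by (simp add: cinner_diff_right)

text \<open>The real part of the inner product is the real inner product; multiplying by a
  unimodular number makes the complex Cauchy--Schwarz inequality a case of the real one.\<close>

lemma cinner_Cauchy_Schwarz: "cmod (cinner x y) \<le> norm x * norm (y::'a::complex_hilbert)"
proof (cases "cinner x y = 0")
  case False
  define c where "c = cnj (sgn (cinner x y))"
  have "cinner (c *\<^sub>C x) y = of_real (cmod (cinner x y))"
    using complex_norm_square[of "cinner x y"] False
    by (simp add: c_def cinner_scaleC_left sgn_eq field_simps power2_eq_square)
  then have "cmod (cinner x y) = inner (c *\<^sub>C x) y"
    by (simp add: inner_eq_Re_cinner)
  also have "\<dots> \<le> norm (c *\<^sub>C x) * norm y" by (rule norm_cauchy_schwarz)
  also have "norm (c *\<^sub>C x) = norm x" using False by (simp add: c_def norm_scaleC norm_sgn)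
  finally show ?thesis .
qed simp

lemma bounded_linear_cinner_left: "bounded_linear (\<lambda>x. cinner x (y::'a::complex_hilbert))"
  by (rule bounded_linear_intro[of _ "norm y"])
     (simp_all add: cinner_add_left cinner_scaleR_left scaleR_conv_of_real cinner_Cauchy_Schwarz)

lemma bounded_linear_cinner_right: "bounded_linear (\<lambda>x. cinner (y::'a::complex_hilbert) x)"
  by (rule bounded_linear_intro[of _ "norm y"])
     (simp_all add: cinner_add_right cinner_scaleR_right scaleR_conv_of_real,
      metis cinner_Cauchy_Schwarz mult.commute)

lemma scaleC_zero_right [simp]: "c *\<^sub>C (0::'a::complex_normed_vector) = 0"
  using scaleC_add_right[of c 0 0] by simp

lemma scaleC_minus_one: "(- 1) *\<^sub>C x = - (x::'a::complex_normed_vector)"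
  using scaleR_scaleC[of "-1" x] by simp

lemma scaleC_minus_right: "c *\<^sub>C (- x) = - (c *\<^sub>C (x::'a::complex_normed_vector))"
  using scaleC_add_right[of c x "- x"] by (simp add: minus_unique)

lemma scaleC_diff_right: "c *\<^sub>C (x - y) = c *\<^sub>C x - c *\<^sub>C (y::'a::complex_normed_vector)"
  using scaleC_add_right[of c x "- y"] by (simp add: scaleC_minus_right)

lemma scaleC_sum_right: "c *\<^sub>C (\<Sum>i\<in>I. f i) = (\<Sum>i\<in>I. c *\<^sub>C (f i::'a::complex_normed_vector))"
  by (induction I rule: infinite_finite_induct) (auto simp: scaleC_add_right)

section \<open>Geometry of Hilbert spaces of functions\<close>

definition fscale :: "complex \<Rightarrow> ('p \<Rightarrow> 'y::complex_normed_vector) \<Rightarrow> 'p \<Rightarrow> 'y"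
  where "fscale c f = (\<lambda>p. c *\<^sub>C f p)"

definition closed_subspace ::
    "('p \<Rightarrow> 'y::complex_hilbert) set \<Rightarrow> (('p \<Rightarrow> 'y) \<Rightarrow> ('p \<Rightarrow> 'y) \<Rightarrow> complex) \<Rightarrow> ('p \<Rightarrow> 'y) set \<Rightarrow> bool"
  where "closed_subspace H ip W \<longleftrightarrow> W \<subseteq> H \<and> 0 \<in> W \<and> (\<forall>f\<in>W. \<forall>g\<in>W. f + g \<in> W) \<and>
    (\<forall>c. \<forall>f\<in>W. fscale c f \<in> W) \<and>
    (\<forall>s f. (\<forall>i. s i \<in> W) \<longrightarrow> f \<in> H \<longrightarrow> (\<lambda>i. ip_norm ip (s i - f)) \<longlonglongrightarrow> 0 \<longrightarrow> f \<in> W)"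

context function_hilbert_space
begin

lemma zero_in [simp]: "0 \<in> H"
  using zero_mem by (simp add: zero_fun_def)

lemma add_in [simp]: "f \<in> H \<Longrightarrow> g \<in> H \<Longrightarrow> f + g \<in> H"
  using add_mem by (simp add: plus_fun_def)

lemma scale_in [simp]: "f \<in> H \<Longrightarrow> fscale c f \<in> H"
  using scale_mem by (simp add: fscale_def)

lemma fscale_minus_one: "fscale (- 1) f = - (f :: 'p \<Rightarrow> 'y)"
  by (simp add: fscale_def fun_eq_iff scaleC_minus_one)

lemma minus_in [simp]: "f \<in> H \<Longrightarrow> - f \<in> H"
  using scale_in[of f "- 1"] by (simp add: fscale_minus_one)

lemma diff_in [simp]: "f \<in> H \<Longrightarrow> g \<in> H \<Longrightarrow> f - g \<in> H"
  using add_in[of f "- g"] by simp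

lemma ip_add_l: "f \<in> H \<Longrightarrow> g \<in> H \<Longrightarrow> k \<in> H \<Longrightarrow> ip (f + g) k = ip f k + ip g k"
  using ip_add_left by (simp add: plus_fun_def)

lemma ip_scale_l: "f \<in> H \<Longrightarrow> g \<in> H \<Longrightarrow> ip (fscale c f) g = c * ip f g"
  using ip_scale_left by (simp add: fscale_def)

lemma ip_minus_l: "f \<in> H \<Longrightarrow> g \<in> H \<Longrightarrow> ip (- f) g = - ip f g"
  using ip_scale_l[of f g "- 1"] by (simp add: fscale_minus_one)

lemma ip_diff_l: "f \<in> H \<Longrightarrow> g \<in> H \<Longrightarrow> k \<in> H \<Longrightarrow> ip (f - g) k = ip f k - ip g k"
  using ip_add_l[of f "- g" k] by (simp add: ip_minus_l)

lemma ip_add_r: "f \<in> H \<Longrightarrow> g \<in> H \<Longrightarrow> k \<in> H \<Longrightarrow> ip k (f + g) = ip k f + ip k g"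
  by (metis add_in complex_cnj_add ip_add_l ip_commute)

lemma ip_scale_r: "f \<in> H \<Longrightarrow> g \<in> H \<Longrightarrow> ip g (fscale c f) = cnj c * ip g f"
  by (metis complex_cnj_mult ip_scale_l ip_commute scale_in)

lemma ip_minus_r: "f \<in> H \<Longrightarrow> g \<in> H \<Longrightarrow> ip g (- f) = - ip g f"
  by (metis complex_cnj_minus ip_minus_l ip_commute minus_in)

lemma ip_diff_r: "f \<in> H \<Longrightarrow> g \<in> H \<Longrightarrow> k \<in> H \<Longrightarrow> ip k (f - g) = ip k f - ip k g"
  using ip_add_r[of f "- g" k] by (simp add: ip_minus_r)

lemma ip_zero_l [simp]: "f \<in> H \<Longrightarrow> ip 0 f = 0"
  using ip_add_l[of 0 0 f] by simp

lemma ip_zero_r [simp]: "f \<in> H \<Longrightarrow> ip f 0 = 0"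
  using ip_add_r[of 0 0 f] by simp

lemmas ip_simps = ip_add_l ip_add_r ip_diff_l ip_diff_r ip_scale_l ip_scale_r ip_minus_l ip_minus_r

abbreviation nrm where "nrm \<equiv> ip_norm ip"

lemma nrm_nonneg [simp]: "f \<in> H \<Longrightarrow> 0 \<le> nrm f"
  by (simp add: ip_norm_def ip_nonneg)

lemma nrm_sq: "f \<in> H \<Longrightarrow> (nrm f)\<^sup>2 = Re (ip f f)"
  by (simp add: ip_norm_def ip_nonneg)

lemma ip_self: "f \<in> H \<Longrightarrow> ip f f = of_real ((nrm f)\<^sup>2)"
  using arg_cong[OF ip_commute[of f f], of Im] by (simp add: nrm_sq complex_eq_iff)

lemma nrm_eq_0: "f \<in> H \<Longrightarrow> nrm f = 0 \<Longrightarrow> f = 0"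
  using ip_definite[of f] by (simp add: ip_self zero_fun_def)

lemma nrm_zero [simp]: "nrm 0 = 0"
  by (simp add: ip_norm_def)

lemma nrm_sq_add:
  "f \<in> H \<Longrightarrow> g \<in> H \<Longrightarrow> (nrm (f + g))\<^sup>2 = (nrm f)\<^sup>2 + (nrm g)\<^sup>2 + 2 * Re (ip f g)"
  using arg_cong[OF ip_commute[of f g], of Re] by (simp add: nrm_sq ip_simps)

lemma nrm_sq_diff:
  "f \<in> H \<Longrightarrow> g \<in> H \<Longrightarrow> (nrm (f - g))\<^sup>2 = (nrm f)\<^sup>2 + (nrm g)\<^sup>2 - 2 * Re (ip f g)"
  using arg_cong[OF ip_commute[of f g], of Re] by (simp add: nrm_sq ip_simps)

lemma nrm_scale: "f \<in> H \<Longrightarrow> nrm (fscale c f) = cmod c * nrm f"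
proof -
  assume f: "f \<in> H"
  have "ip (fscale c f) (fscale c f) = of_real ((cmod c * nrm f)\<^sup>2)"
    using f complex_norm_square[of c]
    by (simp add: ip_scale_l ip_scale_r ip_self[of f] power_mult_distrib del: ip_self)
  then show ?thesis using f unfolding ip_norm_def[of ip "fscale c f"] by simp
qed

lemma ip_Cauchy_Schwarz:
  assumes f: "f \<in> H" and g: "g \<in> H"
  shows "cmod (ip f g) \<le> nrm f * nrm g"
proof (cases "nrm g = 0")
  case True
  then show ?thesis using nrm_eq_0[OF g] f by simp
next
  case False
  then have pos: "0 < (nrm g)\<^sup>2" using g by simp
  define c where "c = ip f g / of_real ((nrm g)\<^sup>2)"
  have "0 \<le> (nrm (f - fscale c g))\<^sup>2" by simp
  also have "\<dots> = (nrm f)\<^sup>2 + (cmod c * nrm g)\<^sup>2 - 2 * Re (cnj c * ip f g)"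
    using f g by (simp add: nrm_sq_diff nrm_scale ip_scale_r)
  also have "cnj c * ip f g = of_real ((cmod (ip f g))\<^sup>2 / (nrm g)\<^sup>2)"
    using complex_norm_square[of "ip f g"] by (simp add: c_def mult_ac)
  also have "(cmod c * nrm g)\<^sup>2 = (cmod (ip f g))\<^sup>2 / (nrm g)\<^sup>2"
    using pos by (simp add: c_def norm_divide norm_mult power_mult_distrib power_divide power2_eq_square)
  finally have "(cmod (ip f g))\<^sup>2 / (nrm g)\<^sup>2 \<le> (nrm f)\<^sup>2" by simp
  then have "(cmod (ip f g))\<^sup>2 \<le> (nrm f * nrm g)\<^sup>2"
    using pos by (simp add: divide_le_eq power_mult_distrib)
  then show ?thesis by (rule power2_le_imp_le) (use f g in simp)
qed

lemma nrm_triangle: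
  assumes f: "f \<in> H" and g: "g \<in> H"
  shows "nrm (f + g) \<le> nrm f + nrm g"
proof (rule power2_le_imp_le)
  have "Re (ip f g) \<le> nrm f * nrm g"
    using ip_Cauchy_Schwarz[OF f g] complex_Re_le_cmod order_trans by blast
  then show "(nrm (f + g))\<^sup>2 \<le> (nrm f + nrm g)\<^sup>2"
    using f g by (simp add: nrm_sq_add power2_sum)
qed (use f g in simp)

lemma nrm_minus: "f \<in> H \<Longrightarrow> nrm (- f) = nrm f"
  using nrm_scale[of f "- 1"] by (simp add: fscale_minus_one)

lemma nrm_diff_commute: "f \<in> H \<Longrightarrow> g \<in> H \<Longrightarrow> nrm (f - g) = nrm (g - f)"
  using nrm_minus[of "f - g"] by simp

lemma nrm_triangle_diff:
  "f \<in> H \<Longrightarrow> g \<in> H \<Longrightarrow> k \<in> H \<Longrightarrow> nrm (f - g) \<le> nrm (f - k) + nrm (k - g)"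
  using nrm_triangle[of "f - k" "k - g"] by simp

lemma completeD:
  assumes "\<And>i. s i \<in> H" and "\<And>e. e > 0 \<Longrightarrow> \<exists>n. \<forall>i\<ge>n. \<forall>j\<ge>n. nrm (s i - s j) < e"
  shows "\<exists>f\<in>H. (\<lambda>i. nrm (s i - f)) \<longlonglongrightarrow> 0"
  using ip_complete[of s] assms by (simp add: fun_diff_def)

lemma ip_tendsto:
  assumes s: "\<And>i. s i \<in> H" and f: "f \<in> H" and lim: "(\<lambda>i. nrm (s i - f)) \<longlonglongrightarrow> 0" and g: "g \<in> H"
  shows "(\<lambda>i. ip (s i) g) \<longlonglongrightarrow> ip f g"
proof (rule LIM_zero_cancel, rule Lim_null_comparison)
  show "\<forall>\<^sub>F i in sequentially. norm (ip (s i) g - ip f g) \<le> nrm (s i - f) * nrm g"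
    using ip_Cauchy_Schwarz[of "s _ - f" g] s f g by (simp add: ip_diff_l)
  show "(\<lambda>i. nrm (s i - f) * nrm g) \<longlonglongrightarrow> 0"
    using tendsto_mult_right[OF lim, of "nrm g"] by simp
qed

lemma convergent_imp_Cauchy:
  assumes s: "\<And>i. s i \<in> H" and f: "f \<in> H" and lim: "(\<lambda>i. nrm (s i - f)) \<longlonglongrightarrow> 0" and e: "e > 0"
  shows "\<exists>n. \<forall>i\<ge>n. \<forall>j\<ge>n. nrm (s i - s j) < e"
proof -
  have "\<forall>\<^sub>F i in sequentially. nrm (s i - f) < e / 2"
    using order_tendstoD(2)[OF lim, of "e/2"] e by simp
  then obtain n where n: "\<And>i. i \<ge> n \<Longrightarrow> nrm (s i - f) < e / 2"
    by (auto simp: eventually_sequentially)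
  have "nrm (s i - s j) < e" if "i \<ge> n" "j \<ge> n" for i j
    using nrm_triangle_diff[of "s i" "s j" f] n[OF that(1)] n[OF that(2)]
      nrm_diff_commute[of f "s j"] s f by simp
  then show ?thesis by blast
qed

lemma closed_subspaceI:
  assumes "W \<subseteq> H" "0 \<in> W" "\<And>f g. f \<in> W \<Longrightarrow> g \<in> W \<Longrightarrow> f + g \<in> W"
    "\<And>c f. f \<in> W \<Longrightarrow> fscale c f \<in> W"
    "\<And>s f. (\<And>i. s i \<in> W) \<Longrightarrow> f \<in> H \<Longrightarrow> (\<lambda>i. nrm (s i - f)) \<longlonglongrightarrow> 0 \<Longrightarrow> f \<in> W"
  shows "closed_subspace H ip W"
  unfolding closed_subspace_def
proof (intro conjI allI impI ballI)
  fix s f assume "\<forall>i. s i \<in> W" "f \<in> H" "(\<lambda>i. nrm (s i - f)) \<longlonglongrightarrow> 0"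
  then show "f \<in> W" by (intro assms(5)[of s f]) auto
qed (use assms(1-4) in blast)+

text \<open>A minimising sequence for the distance is Cauchy by the parallelogram law, and the error of
  the best approximation is orthogonal to the subspace.\<close>

theorem orthogonal_projection:
  assumes W: "closed_subspace H ip W" and f: "f \<in> H"
  obtains w where "w \<in> W" "\<And>v. v \<in> W \<Longrightarrow> ip (f - w) v = 0"
proof -
  have WH: "v \<in> H" if "v \<in> W" for v using W that by (auto simp: closed_subspace_def)
  have W0: "0 \<in> W" and Wadd: "\<And>v w. v \<in> W \<Longrightarrow> w \<in> W \<Longrightarrow> v + w \<in> W"
    and Wscale: "\<And>c v. v \<in> W \<Longrightarrow> fscale c v \<in> W"
    and Wclosed: "\<And>s g. (\<And>i. s i \<in> W) \<Longrightarrow> g \<in> H \<Longrightarrow> (\<lambda>i. nrm (s i - g)) \<longlonglongrightarrow> 0 \<Longrightarrow> g \<in> W"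
    using W unfolding closed_subspace_def by blast+
  define D where "D = (\<lambda>w. (nrm (f - w))\<^sup>2) ` W"
  define d where "d = Inf D"
  have D: "D \<noteq> {}" "bdd_below D" using W0 by (auto simp: D_def intro!: bdd_belowI[of _ 0])
  have d0: "0 \<le> d" unfolding d_def using D(1) by (auto simp: D_def intro!: cInf_greatest)
  have d_le: "d \<le> (nrm (f - w))\<^sup>2" if "w \<in> W" for w
    unfolding d_def using D that by (auto simp: D_def intro!: cInf_lower)
  have "\<exists>w\<in>W. (nrm (f - w))\<^sup>2 < d + 1 / real (Suc n)" for n
    using cInf_lessD[OF D(1), of "d + 1 / real (Suc n)"] by (auto simp: d_def D_def)
  then obtain s where sW: "\<And>n. s n \<in> W" and s: "\<And>n. (nrm (f - s n))\<^sup>2 < d + 1 / real (Suc n)"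
    by metis
  have sH: "s n \<in> H" for n using WH sW by blast
  have half: "fscale (1/2) (s i + s j) \<in> W" for i j using Wscale Wadd sW by blast
  have par: "(nrm (s i - s j))\<^sup>2 \<le> 2 / real (Suc i) + 2 / real (Suc j)" for i j
  proof -
    have e1: "(f - s i) + (f - s j) = fscale 2 (f - fscale (1/2) (s i + s j))"
      by (simp add: fscale_def fun_eq_iff scaleC_diff_right scaleC_scaleC scaleC_one scaleC_add_right)
         (metis add.commute diff_add_eq diff_diff_eq2 one_add_one scaleC_add_left scaleC_one)
    have "(nrm (s i - s j))\<^sup>2 + (nrm ((f - s i) + (f - s j)))\<^sup>2
        = 2 * (nrm (f - s i))\<^sup>2 + 2 * (nrm (f - s j))\<^sup>2"
      using nrm_sq_diff[of "f - s j" "f - s i"] nrm_sq_add[of "f - s j" "f - s i"] f sH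
      by (simp add: add.commute)
    moreover have "(nrm ((f - s i) + (f - s j)))\<^sup>2 \<ge> 4 * d"
      unfolding e1 using d_le[OF half, of i j] f sH by (simp add: nrm_scale power_mult_distrib)
    ultimately show ?thesis using s[of i] s[of j] by simp
  qed
  have "\<exists>n. \<forall>i\<ge>n. \<forall>j\<ge>n. nrm (s i - s j) < e" if e: "e > 0" for e
  proof -
    obtain n where n: "4 / e\<^sup>2 < real n" using reals_Archimedean2 by blast
    have "nrm (s i - s j) < e" if ij: "i \<ge> n" "j \<ge> n" for i j
    proof (rule power2_less_imp_less)
      have n0: "0 < real n" using n e by (meson divide_pos_pos less_trans zero_less_numeral zero_less_power)
      have "2 / real (Suc i) \<le> 2 / real n" "2 / real (Suc j) \<le> 2 / real n"
        using ij n0 by (auto intro!: divide_left_mono)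
      then have "(nrm (s i - s j))\<^sup>2 \<le> 4 / real n" using par[of i j] by simp
      also have "\<dots> < e\<^sup>2" using n n0 e by (simp add: field_simps)
      finally show "(nrm (s i - s j))\<^sup>2 < e\<^sup>2" .
    qed (use e in simp)
    then show ?thesis by blast
  qed
  then obtain w where wH: "w \<in> H" and lim: "(\<lambda>i. nrm (s i - w)) \<longlonglongrightarrow> 0"
    using completeD[of s] sH by blast
  have w: "w \<in> W" using Wclosed sW wH lim by blast
  have min: "(nrm (f - w))\<^sup>2 \<le> d"
  proof (rule LIMSEQ_le_const)
    have "(\<lambda>n. sqrt (d + 1 / real (Suc n)) + nrm (s n - w)) \<longlonglongrightarrow> sqrt (d + 0) + 0"
      by (intro tendsto_intros lim LIMSEQ_Suc[OF lim_1_over_n])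
    then have "(\<lambda>n. (sqrt (d + 1 / real (Suc n)) + nrm (s n - w))\<^sup>2) \<longlonglongrightarrow> (sqrt (d + 0) + 0)\<^sup>2"
      by (rule tendsto_power)
    then show "(\<lambda>n. (sqrt (d + 1 / real (Suc n)) + nrm (s n - w))\<^sup>2) \<longlonglongrightarrow> d"
      using d0 by simp
  next
    have "nrm (f - w) \<le> sqrt (d + 1 / real (Suc n)) + nrm (s n - w)" for n
    proof -
      have "nrm (f - s n) \<le> sqrt (d + 1 / real (Suc n))"
        using s[of n] by (intro real_le_rsqrt) simp
      then show ?thesis using nrm_triangle_diff[of f w "s n"] f wH sH by fastforce
    qed
    then show "\<exists>N. \<forall>n\<ge>N. (nrm (f - w))\<^sup>2 \<le> (sqrt (d + 1 / real (Suc n)) + nrm (s n - w))\<^sup>2"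
      using f wH by (auto intro!: power_mono)
  qed
  have "ip (f - w) v = 0" if v: "v \<in> W" for v
  proof (cases "nrm v = 0")
    case True
    then show ?thesis using nrm_eq_0[OF WH[OF v]] f wH by simp
  next
    case False
    then have pos: "0 < (nrm v)\<^sup>2" using WH[OF v] by simp
    define e where "e = f - w"
    have eH: "e \<in> H" using f wH by (simp add: e_def)
    \<comment> \<open>the component of \<open>e\<close> along \<open>v\<close>; removing it would shorten \<open>e\<close>\<close>
    define c where "c = ip e v / of_real ((nrm v)\<^sup>2)"
    have vH: "v \<in> H" by (rule WH[OF v])
    have "w + fscale c v \<in> W" using w v Wadd Wscale by blast
    from order_trans[OF min d_le[OF this]]
    have "(nrm e)\<^sup>2 \<le> (nrm (e - fscale c v))\<^sup>2" by (simp add: e_def diff_diff_eq)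
    also have "\<dots> = (nrm e)\<^sup>2 + (cmod c * nrm v)\<^sup>2 - 2 * Re (cnj c * ip e v)"
      using eH vH by (subst nrm_sq_diff) (simp_all add: nrm_scale ip_scale_r)
    also have "cnj c * ip e v = of_real ((cmod (ip e v))\<^sup>2 / (nrm v)\<^sup>2)"
      using complex_norm_square[of "ip e v"] by (simp add: c_def mult_ac)
    also have "(cmod c * nrm v)\<^sup>2 = (cmod (ip e v))\<^sup>2 / (nrm v)\<^sup>2"
      using pos by (simp add: c_def norm_divide norm_mult power_mult_distrib power_divide power2_eq_square)
    finally have "(cmod (ip e v))\<^sup>2 / (nrm v)\<^sup>2 \<le> 0" by simp
    then show ?thesis using pos by (simp add: divide_le_0_iff e_def)
  qed
  then show ?thesis using that w by blast
qed

text \<open>The functional is a multiple of the inner product with a vector orthogonal to its kernel.\<close>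

theorem Riesz_representation:
  assumes add: "\<And>f g. f \<in> H \<Longrightarrow> g \<in> H \<Longrightarrow> l (f + g) = l f + l g"
    and scale: "\<And>c f. f \<in> H \<Longrightarrow> l (fscale c f) = c * l f"
    and bound: "\<And>f. f \<in> H \<Longrightarrow> cmod (l f) \<le> C * nrm f"
  obtains g where "g \<in> H" "\<And>f. f \<in> H \<Longrightarrow> l f = ip f g"
proof (cases "\<forall>f\<in>H. l f = 0")
  case True
  then show ?thesis using that[of 0] by simp
next
  case False
  then obtain k where k: "k \<in> H" "l k \<noteq> 0" by blast
  define W where "W = {f \<in> H. l f = 0}"
  have l0: "l 0 = 0" using bound[of 0] by simp
  have "closed_subspace H ip W"
  proof (rule closed_subspaceI)
    fix s f assume s: "\<And>i. s i \<in> W" and f: "f \<in> H" and lim: "(\<lambda>i. nrm (s i - f)) \<longlonglongrightarrow> 0"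
    have "cmod (l f) \<le> C * nrm (s i - f)" for i
    proof -
      have "l (s i) = l (s i - f) + l f" using add[of "s i - f" f] s[of i] f by (simp add: W_def)
      then have "cmod (l f) = cmod (l (s i - f))"
        using s[of i] by (simp add: W_def add_eq_0_iff)
      then show ?thesis using bound[of "s i - f"] s[of i] f by (simp add: W_def)
    qed
    moreover have "(\<lambda>i. C * nrm (s i - f)) \<longlonglongrightarrow> 0" using tendsto_mult_left[OF lim, of C] by simp
    ultimately have "cmod (l f) \<le> 0" by (meson LIMSEQ_le_const)
    then show "f \<in> W" using f by (simp add: W_def)
  qed (auto simp: W_def l0 add scale)
  then obtain w where w: "w \<in> W" "\<And>v. v \<in> W \<Longrightarrow> ip (k - w) v = 0"
    using orthogonal_projection k(1) by blast
  define n where "n = k - w"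
  have wH: "w \<in> H" "l w = 0" using w(1) by (auto simp: W_def)
  have n: "n \<in> H" using k wH by (simp add: n_def)
  have "l k = l n + l w" using add[of n w] n wH by (simp add: n_def)
  then have ln: "l n \<noteq> 0" using k wH by simp
  then have n0: "nrm n \<noteq> 0" using nrm_eq_0[OF n] l0 by auto
  define g where "g = fscale (cnj (l n) / of_real ((nrm n)\<^sup>2)) n"
  have "l f = ip f g" if f: "f \<in> H" for f
  proof -
    have v: "fscale (l n) f - fscale (l f) n \<in> H" using f n by simp
    have "l (fscale (l n) f) = l (fscale (l n) f - fscale (l f) n) + l (fscale (l f) n)"
      using add[OF v, of "fscale (l f) n"] n by simp
    then have "fscale (l n) f - fscale (l f) n \<in> W"
      using v f n by (simp add: W_def scale)
    then have "ip n (fscale (l n) f - fscale (l f) n) = 0" using w(2) by (simp add: n_def)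
    then have "ip (fscale (l n) f - fscale (l f) n) n = 0"
      using ip_commute[OF v n] by simp
    then have "l n * ip f n = l f * of_real ((nrm n)\<^sup>2)"
      using f n by (simp add: ip_simps ip_self)
    then show ?thesis using f n n0 by (simp add: g_def ip_scale_r field_simps)
  qed
  moreover have "g \<in> H" unfolding g_def by (rule scale_in[OF n])
  ultimately show ?thesis by (rule that[rotated])
qed

end

lemma (in function_hilbert_space) ip_tendsto_right:
  assumes s: "\<And>i. s i \<in> H" and f: "f \<in> H" and lim: "(\<lambda>i. nrm (s i - f)) \<longlonglongrightarrow> 0" and g: "g \<in> H"
  shows "(\<lambda>i. ip g (s i)) \<longlonglongrightarrow> ip g f"
proof -
  have "(\<lambda>i. cnj (ip (s i) g)) \<longlonglongrightarrow> cnj (ip f g)"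
    by (intro tendsto_cnj ip_tendsto s f lim g)
  then show ?thesis using ip_commute[OF g s] ip_commute[OF g f] by simp
qed

lemma (in rkhs) kernel_in [simp]: "(\<lambda>p. K p q y) \<in> H"
  by (rule kernel_mem)

text \<open>A factorization \<open>K(z,w) = \<Gamma>\<^sub>z \<Gamma>\<^sub>w\<^sup>*\<close> of a kernel through a Hilbert space \<open>G\<close>: here
  \<open>\<Gamma> g\<close> is the function \<open>z \<mapsto> \<Gamma>\<^sub>z g\<close>, and \<open>\<phi> w\<close> is the adjoint of evaluation at \<open>w\<close>. Both a sum
  of kernels and a congruence \<open>u K u\<^sup>*\<close> are of this kind.\<close>

locale feature_map = rkhs K H ip + G: function_hilbert_space G ipG
  for K :: "'p \<Rightarrow> 'p \<Rightarrow> ('y::complex_hilbert \<Rightarrow>\<^sub>L 'y)"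
    and H :: "('p \<Rightarrow> 'y) set" and ip :: "('p \<Rightarrow> 'y) \<Rightarrow> ('p \<Rightarrow> 'y) \<Rightarrow> complex"
    and G :: "('q \<Rightarrow> 'g::complex_hilbert) set" and ipG :: "('q \<Rightarrow> 'g) \<Rightarrow> ('q \<Rightarrow> 'g) \<Rightarrow> complex" +
  fixes \<phi> :: "'p \<Rightarrow> 'y \<Rightarrow> ('q \<Rightarrow> 'g)" and \<Gamma> :: "('q \<Rightarrow> 'g) \<Rightarrow> ('p \<Rightarrow> 'y)"
  assumes feature_mem: "\<phi> w y \<in> G"
    and feature_rep: "g \<in> G \<Longrightarrow> cinner (\<Gamma> g w) y = ipG g (\<phi> w y)"
    and feature_kernel: "\<Gamma> (\<phi> q y) = (\<lambda>w. K w q y)"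
begin

lemma Gamma_eqI:
  assumes "g \<in> G" "\<And>w y. cinner (f w) y = ipG g (\<phi> w y)"
  shows "\<Gamma> g = f"
  using assms by (intro ext cinner_eqI) (simp add: feature_rep)

lemma Gamma_add: "g \<in> G \<Longrightarrow> g' \<in> G \<Longrightarrow> \<Gamma> (g + g') = \<Gamma> g + \<Gamma> g'"
  by (rule Gamma_eqI) (simp_all add: feature_rep feature_mem G.ip_simps cinner_simps)

lemma Gamma_diff: "g \<in> G \<Longrightarrow> g' \<in> G \<Longrightarrow> \<Gamma> (g - g') = \<Gamma> g - \<Gamma> g'"
  by (rule Gamma_eqI) (simp_all add: feature_rep feature_mem G.ip_simps cinner_simps)

lemma Gamma_scale: "g \<in> G \<Longrightarrow> \<Gamma> (fscale c g) = fscale c (\<Gamma> g)"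
  by (rule Gamma_eqI)
     (simp_all add: fscale_def[of c "\<Gamma> g"] feature_rep feature_mem G.ip_simps cinner_simps)

lemma Gamma_zero: "\<Gamma> 0 = 0"
  by (rule Gamma_eqI) (simp_all add: feature_mem)

text \<open>The part of \<open>G\<close> on which \<open>\<Gamma>\<close> acts isometrically. It is closed and contains all
  \<open>\<phi> w y\<close>, so what is orthogonal to it is annihilated by \<open>\<Gamma>\<close>. The definition refers to \<open>H\<close> because it is not clear in advance
  that \<open>\<Gamma>\<close> takes its values there.\<close>

definition isometric_part :: "('q \<Rightarrow> 'g) set"
  where "isometric_part =
    {b \<in> G. \<Gamma> b \<in> H \<and> (\<forall>g\<in>G. \<Gamma> g \<in> H \<longrightarrow> ip (\<Gamma> g) (\<Gamma> b) = ipG g b)}"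

lemma feature_isometric: "\<phi> w y \<in> isometric_part"
  unfolding isometric_part_def
  by (simp add: feature_mem feature_kernel reproducing feature_rep)

lemma nrm_isometric: "b \<in> isometric_part \<Longrightarrow> nrm (\<Gamma> b) = G.nrm b"
  by (simp add: isometric_part_def ip_norm_def)

lemma isometric_diff:
  "b \<in> isometric_part \<Longrightarrow> b' \<in> isometric_part \<Longrightarrow> b - b' \<in> isometric_part"
  unfolding isometric_part_def by (auto simp: Gamma_diff ip_simps G.ip_simps)

text \<open>The images of a convergent sequence converge in \<open>H\<close>, hence pointwise, and pointwise their limit
  can only be the image of the limit.\<close>

lemma isometric_limit:
  assumes s: "\<And>i. s i \<in> isometric_part" and f: "f \<in> G" and lim: "(\<lambda>i. G.nrm (s i - f)) \<longlonglongrightarrow> 0"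
    and h: "h \<in> H" and limh: "(\<lambda>i. nrm (\<Gamma> (s i) - h)) \<longlonglongrightarrow> 0"
  shows "\<Gamma> f = h" and "f \<in> isometric_part"
proof -
  have sG: "s i \<in> G" and sH: "\<Gamma> (s i) \<in> H" for i using s[of i] by (auto simp: isometric_part_def)
  show eq: "\<Gamma> f = h"
  proof (rule Gamma_eqI[OF f])
    fix w y
    have "(\<lambda>i. ip (\<Gamma> (s i)) (\<lambda>p. K p w y)) \<longlonglongrightarrow> ip h (\<lambda>p. K p w y)"
      by (rule ip_tendsto[OF sH h limh kernel_in])
    then have "(\<lambda>i. ipG (s i) (\<phi> w y)) \<longlonglongrightarrow> cinner (h w) y"
      using sG sH h by (simp add: reproducing feature_rep)
    then show "cinner (h w) y = ipG f (\<phi> w y)"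
      using LIMSEQ_unique G.ip_tendsto[OF sG f lim feature_mem] by blast
  qed
  have "ip (\<Gamma> g) (\<Gamma> f) = ipG g f" if g: "g \<in> G" "\<Gamma> g \<in> H" for g
  proof -
    have "(\<lambda>i. ip (\<Gamma> g) (\<Gamma> (s i))) \<longlonglongrightarrow> ip (\<Gamma> g) h" by (rule ip_tendsto_right[OF sH h limh g(2)])
    moreover have "ip (\<Gamma> g) (\<Gamma> (s i)) = ipG g (s i)" for i
      using s[of i] g by (simp add: isometric_part_def)
    ultimately show ?thesis using LIMSEQ_unique G.ip_tendsto_right[OF sG f lim g(1)] eq by simp
  qed
  then show "f \<in> isometric_part"
    unfolding isometric_part_def mem_Collect_eq using f h eq by blast
qed

lemma closed_isometric_part: "closed_subspace G ipG isometric_part"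
proof (rule G.closed_subspaceI)
  show "isometric_part \<subseteq> G" "0 \<in> isometric_part"
    by (auto simp: isometric_part_def Gamma_zero)
  show "f + g \<in> isometric_part" if "f \<in> isometric_part" "g \<in> isometric_part" for f g
    using that unfolding isometric_part_def by (auto simp: Gamma_add ip_simps G.ip_simps)
  show "fscale c f \<in> isometric_part" if "f \<in> isometric_part" for c f
    using that unfolding isometric_part_def by (auto simp: Gamma_scale ip_simps G.ip_simps)
  fix s f assume s: "\<And>i. s i \<in> isometric_part" and f: "f \<in> G" and lim: "(\<lambda>i. G.nrm (s i - f)) \<longlonglongrightarrow> 0"
  have sG: "s i \<in> G" and sH: "\<Gamma> (s i) \<in> H" for i using s[of i] by (auto simp: isometric_part_def)
  have "nrm (\<Gamma> (s i) - \<Gamma> (s j)) = G.nrm (s i - s j)" for i j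
    using nrm_isometric[OF isometric_diff[OF s s, of i j]] by (simp add: Gamma_diff sG)
  then have "\<exists>n. \<forall>i\<ge>n. \<forall>j\<ge>n. nrm (\<Gamma> (s i) - \<Gamma> (s j)) < e" if "e > 0" for e
    using G.convergent_imp_Cauchy[OF sG f lim that] by simp
  from completeD[OF sH this] obtain h where "h \<in> H" "(\<lambda>i. nrm (\<Gamma> (s i) - h)) \<longlonglongrightarrow> 0"
    by blast
  then show "f \<in> isometric_part" by (rule isometric_limit(2)[OF s f lim])
qed

lemma isometric_decomposition:
  assumes "g \<in> G"
  obtains b where "b \<in> isometric_part" "\<Gamma> b = \<Gamma> g" "\<And>v. v \<in> isometric_part \<Longrightarrow> ipG (g - b) v = 0"
proof -
  obtain b where b: "b \<in> isometric_part" "\<And>v. v \<in> isometric_part \<Longrightarrow> ipG (g - b) v = 0"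
    using G.orthogonal_projection[OF closed_isometric_part assms] by blast
  have bG: "b \<in> G" using b(1) by (simp add: isometric_part_def)
  have "\<Gamma> (g - b) = 0"
    by (rule Gamma_eqI) (use assms bG b(2) feature_isometric in auto)
  then have "\<Gamma> b = \<Gamma> g" using assms bG by (simp add: Gamma_diff)
  then show ?thesis using that b by blast
qed

text \<open>The component of \<open>g\<close> orthogonal to the isometric part does not contribute to \<open>\<Gamma> g\<close>.\<close>

theorem Gamma_mem: "g \<in> G \<Longrightarrow> \<Gamma> g \<in> H"
  by (elim isometric_decomposition) (auto simp: isometric_part_def)

lemma isometric_perp_ker: "b \<in> isometric_part \<Longrightarrow> k \<in> G \<Longrightarrow> \<Gamma> k = 0 \<Longrightarrow> ipG k b = 0"
proof -
  assume b: "b \<in> isometric_part" and k: "k \<in> G" "\<Gamma> k = 0"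
  then have "ip (\<Gamma> k) (\<Gamma> b) = ipG k b" "\<Gamma> b \<in> H"
    unfolding isometric_part_def by auto
  then show "ipG k b = 0" using k(2) by simp
qed

lemma nrm_decomposition:
  assumes "g \<in> G" "b \<in> isometric_part" "\<And>v. v \<in> isometric_part \<Longrightarrow> ipG (g - b) v = 0"
  shows "(G.nrm g)\<^sup>2 = (nrm (\<Gamma> b))\<^sup>2 + (G.nrm (g - b))\<^sup>2"
proof -
  have bG: "b \<in> G" using assms(2) by (simp add: isometric_part_def)
  then show ?thesis
    using G.nrm_sq_add[of "g - b" b] assms nrm_isometric[of b] by simp
qed

theorem nrm_Gamma_le: assumes g: "g \<in> G" shows "nrm (\<Gamma> g) \<le> G.nrm g"
proof -
  obtain b where b: "b \<in> isometric_part" "\<Gamma> b = \<Gamma> g" "\<And>v. v \<in> isometric_part \<Longrightarrow> ipG (g - b) v = 0"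
    using isometric_decomposition[OF g] by blast
  show ?thesis
    using nrm_decomposition[OF g b(1,3)] b(2) g by - (rule power2_le_imp_le, auto)
qed

theorem nrm_Gamma_eq_iff:
  assumes g: "g \<in> G"
  shows "nrm (\<Gamma> g) = G.nrm g \<longleftrightarrow> (\<forall>k\<in>G. \<Gamma> k = 0 \<longrightarrow> ipG g k = 0)"
proof -
  obtain b where b: "b \<in> isometric_part" "\<Gamma> b = \<Gamma> g" "\<And>v. v \<in> isometric_part \<Longrightarrow> ipG (g - b) v = 0"
    using isometric_decomposition[OF g] by blast
  have bG: "b \<in> G" using b(1) by (simp add: isometric_part_def)
  note dec = nrm_decomposition[OF g b(1,3), unfolded b(2)]
  show ?thesis
  proof
    assume "nrm (\<Gamma> g) = G.nrm g"
    then have "g - b = 0" using dec g bG by (intro G.nrm_eq_0) auto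
    then have "g \<in> isometric_part" using b(1) by simp
    then show "\<forall>k\<in>G. \<Gamma> k = 0 \<longrightarrow> ipG g k = 0"
      using isometric_perp_ker G.ip_commute[OF g] by simp
  next
    assume perp: "\<forall>k\<in>G. \<Gamma> k = 0 \<longrightarrow> ipG g k = 0"
    have "g - b \<in> G" "\<Gamma> (g - b) = 0" using g bG b(2) by (simp_all add: Gamma_diff)
    then have "ipG g (g - b) = 0" "ipG b (g - b) = 0"
      using perp isometric_perp_ker[OF b(1)] G.ip_commute[OF bG, of "g - b"] by auto
    then have "ipG (g - b) (g - b) = 0" using g bG by (subst G.ip_diff_l) auto
    then have "(G.nrm (g - b))\<^sup>2 = 0" using g bG by (simp add: G.nrm_sq)
    then have "(nrm (\<Gamma> g))\<^sup>2 = (G.nrm g)\<^sup>2" using dec by simp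
    then show "nrm (\<Gamma> g) = G.nrm g"
      using power2_eq_iff_nonneg[of "nrm (\<Gamma> g)" "G.nrm g"] g Gamma_mem[OF g] by simp
  qed
qed

text \<open>The image of the isometric part is complete, hence closed, and it contains the kernel functions,
  whose orthogonal complement is trivial.\<close>

theorem Gamma_onto:
  assumes f: "f \<in> H"
  obtains g where "g \<in> G" "\<Gamma> g = f" "\<And>k. k \<in> G \<Longrightarrow> \<Gamma> k = 0 \<Longrightarrow> ipG g k = 0"
proof -
  have partG: "b \<in> G" if "b \<in> isometric_part" for b using that by (simp add: isometric_part_def)
  have "closed_subspace H ip (\<Gamma> ` isometric_part)"
  proof (rule closed_subspaceI)
    have part: "0 \<in> isometric_part"
      "\<And>f g. f \<in> isometric_part \<Longrightarrow> g \<in> isometric_part \<Longrightarrow> f + g \<in> isometric_part"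
      "\<And>c f. f \<in> isometric_part \<Longrightarrow> fscale c f \<in> isometric_part"
      using closed_isometric_part unfolding closed_subspace_def by blast+
    show "\<Gamma> ` isometric_part \<subseteq> H" by (auto simp: isometric_part_def)
    show "0 \<in> \<Gamma> ` isometric_part" using part(1) Gamma_zero by force
    show "f + g \<in> \<Gamma> ` isometric_part"
      if "f \<in> \<Gamma> ` isometric_part" "g \<in> \<Gamma> ` isometric_part" for f g
    proof -
      from that obtain a b where "a \<in> isometric_part" "b \<in> isometric_part" "f = \<Gamma> a" "g = \<Gamma> b"
        by blast
      then show ?thesis using Gamma_add[of a b] partG part(2)[of a b] by (intro image_eqI[of _ _ "a + b"]) auto
    qed
    show "fscale c f \<in> \<Gamma> ` isometric_part" if "f \<in> \<Gamma> ` isometric_part" for c f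
    proof -
      from that obtain a where "a \<in> isometric_part" "f = \<Gamma> a" by blast
      then show ?thesis
        using Gamma_scale[of a c] partG part(3)[of a c] by (intro image_eqI[of _ _ "fscale c a"]) auto
    qed
    fix s f assume "\<And>i. s i \<in> \<Gamma> ` isometric_part" and f: "f \<in> H" and lim: "(\<lambda>i. nrm (s i - f)) \<longlonglongrightarrow> 0"
    then have "\<forall>i. \<exists>b\<in>isometric_part. s i = \<Gamma> b" by blast
    then obtain b where b: "\<And>i. b i \<in> isometric_part" and s: "\<And>i. s i = \<Gamma> (b i)" by metis
    have bG: "b i \<in> G" and sH: "s i \<in> H" for i using b[of i] s by (auto simp: isometric_part_def)
    have "nrm (s i - s j) = G.nrm (b i - b j)" for i j
      using nrm_isometric[OF isometric_diff[OF b b, of i j]] by (simp add: Gamma_diff bG s)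
    then have "\<exists>n. \<forall>i\<ge>n. \<forall>j\<ge>n. G.nrm (b i - b j) < e" if "e > 0" for e
      using convergent_imp_Cauchy[OF sH f lim that] by simp
    from G.completeD[OF bG this] obtain g where g: "g \<in> G" "(\<lambda>i. G.nrm (b i - g)) \<longlonglongrightarrow> 0"
      by blast
    have "\<Gamma> g = f" "g \<in> isometric_part"
      using isometric_limit[OF b g f] lim s by auto
    then show "f \<in> \<Gamma> ` isometric_part" by blast
  qed
  then obtain r where r: "r \<in> \<Gamma> ` isometric_part"
    and perp: "\<And>v. v \<in> \<Gamma> ` isometric_part \<Longrightarrow> ip (f - r) v = 0"
    using orthogonal_projection f by blast
  then obtain g where g: "g \<in> isometric_part" "r = \<Gamma> g" by blast
  then have rH: "r \<in> H" by (simp add: isometric_part_def)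
  have "cinner ((f - r) q) y = 0" for q y
    using reproducing[of "f - r" q y] perp[of "\<lambda>p. K p q y"] feature_isometric[of q y]
      feature_kernel[of q y] f rH by force
  then have "f - r = 0" by (intro ext cinner_eqI) simp
  then show ?thesis
    using that[of g] g partG isometric_perp_ker[OF g(1)] G.ip_commute[OF partG[OF g(1)]] by simp
qed

end

section \<open>Direct sums and constant functions\<close>

definition dsum :: "('p \<Rightarrow> 'a) set \<Rightarrow> ('p \<Rightarrow> 'b) set \<Rightarrow> ('p \<Rightarrow> 'a \<times> 'b) set"
  where "dsum H1 H2 = {F. (\<lambda>p. fst (F p)) \<in> H1 \<and> (\<lambda>p. snd (F p)) \<in> H2}"

definition dsum_ip ::
    "(('p \<Rightarrow> 'a) \<Rightarrow> ('p \<Rightarrow> 'a) \<Rightarrow> complex) \<Rightarrow> (('p \<Rightarrow> 'b) \<Rightarrow> ('p \<Rightarrow> 'b) \<Rightarrow> complex) \<Rightarrow>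
     ('p \<Rightarrow> 'a \<times> 'b) \<Rightarrow> ('p \<Rightarrow> 'a \<times> 'b) \<Rightarrow> complex"
  where "dsum_ip ip1 ip2 F F' =
    ip1 (\<lambda>p. fst (F p)) (\<lambda>p. fst (F' p)) + ip2 (\<lambda>p. snd (F p)) (\<lambda>p. snd (F' p))"

lemma function_hilbert_space_dsum:
  fixes H1 :: "('p \<Rightarrow> 'a::complex_hilbert) set" and H2 :: "('p \<Rightarrow> 'b::complex_hilbert) set"
  assumes "function_hilbert_space H1 ip1" "function_hilbert_space H2 ip2"
  shows "function_hilbert_space (dsum H1 H2) (dsum_ip ip1 ip2)"
proof -
  interpret A: function_hilbert_space H1 ip1 by fact
  interpret B: function_hilbert_space H2 ip2 by fact
  show ?thesis
  proof
    show "(\<lambda>_. 0) \<in> dsum H1 H2" by (simp add: dsum_def A.zero_mem B.zero_mem)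
    fix f assume f: "f \<in> dsum H1 H2"
    then have f1: "(\<lambda>p. fst (f p)) \<in> H1" and f2: "(\<lambda>p. snd (f p)) \<in> H2" by (auto simp: dsum_def)
    show "(\<lambda>p. c *\<^sub>C f p) \<in> dsum H1 H2" for c
      using f1 f2 by (simp add: dsum_def scaleC_prod_def A.scale_mem B.scale_mem)
    show "0 \<le> Re (dsum_ip ip1 ip2 f f)"
      using A.ip_nonneg[OF f1] B.ip_nonneg[OF f2] by (simp add: dsum_ip_def)
    show "f = (\<lambda>_. 0)" if "dsum_ip ip1 ip2 f f = 0"
    proof -
      have "A.nrm (\<lambda>p. fst (f p)) = 0" "B.nrm (\<lambda>p. snd (f p)) = 0"
        using arg_cong[OF that, of Re] A.ip_nonneg[OF f1] B.ip_nonneg[OF f2]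
        by (auto simp: dsum_ip_def ip_norm_def)
      from A.nrm_eq_0[OF f1 this(1)] B.nrm_eq_0[OF f2 this(2)]
      show ?thesis by (auto simp: fun_eq_iff prod_eq_iff)
    qed
    fix g assume g: "g \<in> dsum H1 H2"
    then have g1: "(\<lambda>p. fst (g p)) \<in> H1" and g2: "(\<lambda>p. snd (g p)) \<in> H2" by (auto simp: dsum_def)
    show "(\<lambda>p. f p + g p) \<in> dsum H1 H2"
      using f1 f2 g1 g2 by (simp add: dsum_def A.add_mem B.add_mem)
    show "dsum_ip ip1 ip2 f g = cnj (dsum_ip ip1 ip2 g f)"
      using A.ip_commute[OF f1 g1] B.ip_commute[OF f2 g2] by (simp add: dsum_ip_def)
    show "dsum_ip ip1 ip2 (\<lambda>p. c *\<^sub>C f p) g = c * dsum_ip ip1 ip2 f g" for c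
      using f1 f2 g1 g2
      by (simp add: dsum_ip_def scaleC_prod_def A.ip_scale_left B.ip_scale_left distrib_left)
    fix k assume k: "k \<in> dsum H1 H2"
    then show "dsum_ip ip1 ip2 (\<lambda>p. f p + g p) k = dsum_ip ip1 ip2 f k + dsum_ip ip1 ip2 g k"
      using f1 f2 g1 g2 by (simp add: dsum_def dsum_ip_def A.ip_add_left B.ip_add_left)
  next
    fix s :: "nat \<Rightarrow> 'p \<Rightarrow> 'a \<times> 'b"
    assume s: "\<And>i. s i \<in> dsum H1 H2"
      and Cauchy: "\<And>e. e > 0 \<Longrightarrow>
        \<exists>n. \<forall>i\<ge>n. \<forall>j\<ge>n. ip_norm (dsum_ip ip1 ip2) (\<lambda>p. s i p - s j p) < e"
    define a where "a i = (\<lambda>p. fst (s i p))" for i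
    define b where "b i = (\<lambda>p. snd (s i p))" for i
    have a: "a i \<in> H1" and b: "b i \<in> H2" for i using s[of i] by (auto simp: a_def b_def dsum_def)
    have split: "(ip_norm (dsum_ip ip1 ip2) f)\<^sup>2
        = (A.nrm (\<lambda>p. fst (f p)))\<^sup>2 + (B.nrm (\<lambda>p. snd (f p)))\<^sup>2" if "f \<in> dsum H1 H2" for f
      using A.ip_nonneg[of "\<lambda>p. fst (f p)"] B.ip_nonneg[of "\<lambda>p. snd (f p)"] that
      by (simp add: ip_norm_def dsum_ip_def dsum_def)
    have diff: "(\<lambda>p. s i p - s j p) \<in> dsum H1 H2" for i j
      using A.diff_in[OF a a, of i j] B.diff_in[OF b b, of i j]
      by (simp add: dsum_def a_def b_def fun_diff_def)
    have nonneg: "0 \<le> ip_norm (dsum_ip ip1 ip2) f" if "f \<in> dsum H1 H2" for f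
      using that by (simp add: ip_norm_def dsum_ip_def dsum_def A.ip_nonneg B.ip_nonneg)
    have le: "A.nrm (a i - a j) \<le> ip_norm (dsum_ip ip1 ip2) (\<lambda>p. s i p - s j p)"
      "B.nrm (b i - b j) \<le> ip_norm (dsum_ip ip1 ip2) (\<lambda>p. s i p - s j p)" for i j
      using split[OF diff, of i j]
      by - (rule power2_le_imp_le[OF _ nonneg[OF diff]], simp add: a_def b_def fun_diff_def)+
    have "\<exists>n. \<forall>i\<ge>n. \<forall>j\<ge>n. A.nrm (a i - a j) < e" if "e > 0" for e
      using Cauchy[OF that] le(1) by (meson le_less_trans)
    from A.completeD[OF a this] obtain f where f: "f \<in> H1" "(\<lambda>i. A.nrm (a i - f)) \<longlonglongrightarrow> 0"
      by blast
    have "\<exists>n. \<forall>i\<ge>n. \<forall>j\<ge>n. B.nrm (b i - b j) < e" if "e > 0" for e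
      using Cauchy[OF that] le(2) by (meson le_less_trans)
    from B.completeD[OF b this] obtain g where g: "g \<in> H2" "(\<lambda>i. B.nrm (b i - g)) \<longlonglongrightarrow> 0"
      by blast
    define h where "h = (\<lambda>p. (f p, g p))"
    have h: "h \<in> dsum H1 H2" using f g by (simp add: h_def dsum_def)
    have hdiff: "(\<lambda>p. s i p - h p) \<in> dsum H1 H2" for i
      using A.diff_in[OF a f(1), of i] B.diff_in[OF b g(1), of i]
      by (simp add: dsum_def a_def b_def h_def fun_diff_def)
    have "(\<lambda>i. (A.nrm (a i - f))\<^sup>2 + (B.nrm (b i - g))\<^sup>2) \<longlonglongrightarrow> 0\<^sup>2 + 0\<^sup>2"
      by (intro tendsto_intros f g)
    then have "(\<lambda>i. (ip_norm (dsum_ip ip1 ip2) (\<lambda>p. s i p - h p))\<^sup>2) \<longlonglongrightarrow> 0"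
      using split[OF hdiff] by (simp add: h_def a_def b_def fun_diff_def)
    then have "(\<lambda>i. sqrt ((ip_norm (dsum_ip ip1 ip2) (\<lambda>p. s i p - h p))\<^sup>2)) \<longlonglongrightarrow> sqrt 0"
      by (rule tendsto_real_sqrt)
    then show "\<exists>f\<in>dsum H1 H2. (\<lambda>i. ip_norm (dsum_ip ip1 ip2) (\<lambda>p. s i p - f p)) \<longlonglongrightarrow> 0"
      using h nonneg[OF hdiff] by auto
  qed
qed

text \<open>A Hilbert space as a space of constant functions. In this form a plain Hilbert space can be a summand
  of a direct sum of function spaces, and it inherits the Riesz representation theorem.\<close>

definition const_space :: "('p \<Rightarrow> 'x::complex_hilbert) set"
  where "const_space = range (\<lambda>v p. v)"

definition const_ip :: "('p \<Rightarrow> 'x::complex_hilbert) \<Rightarrow> ('p \<Rightarrow> 'x) \<Rightarrow> complex"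
  where "const_ip f g = cinner (f undefined) (g undefined)"

lemma function_hilbert_space_const:
  "function_hilbert_space (const_space :: ('p \<Rightarrow> 'x::complex_hilbert) set) const_ip"
proof
  fix s :: "nat \<Rightarrow> 'p \<Rightarrow> 'x"
  assume s: "\<And>i. s i \<in> const_space"
    and Cauchy: "\<And>e. e > 0 \<Longrightarrow> \<exists>n. \<forall>i\<ge>n. \<forall>j\<ge>n. ip_norm const_ip (\<lambda>p. s i p - s j p) < e"
  define v where "v i = s i undefined" for i
  have s_eq: "s i = (\<lambda>p. v i)" for i using s[of i] by (auto simp: v_def const_space_def)
  have nrm: "ip_norm const_ip (\<lambda>p::'p. w) = norm w" for w :: 'x
    by (simp add: ip_norm_def const_ip_def cinner_self)
  have "Cauchy v"
    using Cauchy unfolding Cauchy_def s_eq by (simp add: nrm dist_norm)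
  then obtain w where "v \<longlonglongrightarrow> w" using Cauchy_convergent convergentD by blast
  then have "(\<lambda>i. ip_norm const_ip (\<lambda>p. s i p - w)) \<longlonglongrightarrow> 0"
    unfolding s_eq by (simp add: nrm LIM_zero tendsto_norm_zero)
  then show "\<exists>f\<in>const_space. (\<lambda>i. ip_norm const_ip (\<lambda>p. s i p - f p)) \<longlonglongrightarrow> 0"
    by (intro bexI[of _ "\<lambda>p. w"]) (auto simp: const_space_def)
qed (auto simp: const_space_def const_ip_def cinner_simps cinner_self intro: cinner_commute)

section \<open>Adjoints\<close>

lemma Riesz_complex_hilbert:
  fixes l :: "'x::complex_hilbert \<Rightarrow> complex"
  assumes add: "\<And>v w. l (v + w) = l v + l w" and scale: "\<And>c v. l (c *\<^sub>C v) = c * l v"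
    and bound: "\<And>v. cmod (l v) \<le> C * norm v"
  obtains w where "\<And>v. l v = cinner v w"
proof -
  interpret function_hilbert_space "const_space :: (unit \<Rightarrow> 'x) set" const_ip
    by (rule function_hilbert_space_const)
  obtain g where "\<And>f. f \<in> const_space \<Longrightarrow> l (f ()) = const_ip f g"
  proof (rule Riesz_representation[of "\<lambda>f. l (f ())" C])
    show "cmod (l (f ())) \<le> C * nrm f" if "f \<in> const_space" for f
      using bound[of "f ()"] that
      by (auto simp: ip_norm_def const_ip_def cinner_self const_space_def)
  qed (auto simp: add scale fscale_def)
  then have "l v = cinner v (g ())" for v
    by (force simp: const_space_def const_ip_def)
  then show ?thesis by (rule that)
qed

lemma blinfun_bound_Blinfun:
  fixes f :: "'a::real_normed_vector \<Rightarrow> 'b::real_normed_vector"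
  assumes "\<And>x y. f (x + y) = f x + f y" "\<And>r x. f (r *\<^sub>R x) = r *\<^sub>R f x" "\<And>x. norm (f x) \<le> C * norm x"
  shows "blinfun_apply (Blinfun f) = f"
  by (rule bounded_linear_Blinfun_apply) (rule bounded_linear_intro[of f C], use assms in \<open>auto simp: mult.commute\<close>)

lemma complex_linearD: "complex_linear A \<Longrightarrow> A (c *\<^sub>C x) = c *\<^sub>C A x"
  by (simp add: complex_linear_def)

lemma adj_exists:
  fixes A :: "'a::complex_hilbert \<Rightarrow>\<^sub>L 'b::complex_hilbert"
  assumes A: "complex_linear A"
  shows "\<exists>!B. \<forall>x y. cinner (A x) y = cinner x (blinfun_apply B y)"
proof -
  have "\<exists>w. \<forall>v. cinner (A v) y = cinner v w" for y
  proof -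
    have "cmod (cinner (A v) y) \<le> norm A * norm y * norm v" for v
      using order_trans[OF cinner_Cauchy_Schwarz[of "A v" y]
          mult_right_mono[OF norm_blinfun[of A v], of "norm y"]]
      by (simp add: mult_ac)
    then show ?thesis
      by (rule Riesz_complex_hilbert[of "\<lambda>v. cinner (A v) y", rotated 2])
         (auto simp: blinfun.add_right cinner_simps complex_linearD[OF A])
  qed
  then obtain B where B: "\<And>v y. cinner (A v) y = cinner v (B y)" by metis
  have "blinfun_apply (Blinfun B) = B"
  proof (rule blinfun_bound_Blinfun)
    show "B (x + y) = B x + B y" for x y
      by (rule cinner_eqI_right) (simp add: B[symmetric] cinner_simps)
    show "B (r *\<^sub>R y) = r *\<^sub>R B y" for r y
      by (rule cinner_eqI_right) (simp add: B[symmetric] cinner_scaleR_right)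
    show "norm (B y) \<le> norm A * norm y" for y
    proof (cases "B y = 0")
      case False
      have "(norm (B y))\<^sup>2 = cmod (cinner (A (B y)) y)" by (simp add: B cinner_self norm_power)
      also have "\<dots> \<le> norm A * norm (B y) * norm y"
        by (rule order_trans[OF cinner_Cauchy_Schwarz]) (intro mult_right_mono norm_blinfun norm_ge_zero)
      finally show ?thesis using False by (simp add: power2_eq_square)
    qed simp
  qed
  then have ex: "\<forall>x y. cinner (A x) y = cinner x (blinfun_apply (Blinfun B) y)" by (simp add: B)
  then show ?thesis
  proof (rule ex1I)
    fix B' assume B': "\<forall>x y. cinner (A x) y = cinner x (blinfun_apply B' y)"
    show "B' = Blinfun B"
    proof (rule blinfun_eqI)
      fix y
      show "blinfun_apply B' y = blinfun_apply (Blinfun B) y"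
      proof (rule cinner_eqI_right)
        fix x
        have "cinner x (blinfun_apply B' y) = cinner (A x) y" using B' by simp
        also have "\<dots> = cinner x (blinfun_apply (Blinfun B) y)" using ex by blast
        finally show "cinner x (blinfun_apply B' y) = cinner x (blinfun_apply (Blinfun B) y)" .
      qed
    qed
  qed
qed

lemma adj_cinner: "complex_linear A \<Longrightarrow> cinner (A x) y = cinner x (adj A y)"
  unfolding adj_def by (rule theI'[OF adj_exists, rule_format])

lemma adj_cinner': "complex_linear A \<Longrightarrow> cinner (adj A x) y = cinner x (A y)"
  by (metis adj_cinner cinner_commute)

lemma adj_unique: "complex_linear A \<Longrightarrow> (\<And>x. cinner (A x) y = cinner x z) \<Longrightarrow> adj A y = z"
  by (metis adj_cinner cinner_eqI_right)

section \<open>Inverses, positivity and square roots\<close>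

lemma op_inv_exists: "op_invertible A \<Longrightarrow> \<exists>!B. A o\<^sub>L B = id_blinfun \<and> B o\<^sub>L A = id_blinfun"
  unfolding op_invertible_def
proof (elim exE, rule ex1I)
  fix B C assume B: "A o\<^sub>L B = id_blinfun \<and> B o\<^sub>L A = id_blinfun"
    and C: "A o\<^sub>L C = id_blinfun \<and> C o\<^sub>L A = id_blinfun"
  show "C = B"
  proof (rule blinfun_eqI)
    fix x
    have "C (A (B x)) = B x" using C by (metis blinfun_apply_blinfun_compose id_blinfun.rep_eq)
    moreover have "A (B x) = x" using B by (metis blinfun_apply_blinfun_compose id_blinfun.rep_eq)
    ultimately show "C x = B x" by simp
  qed
qed

lemma op_inv_right: "op_invertible A \<Longrightarrow> A o\<^sub>L op_inv A = id_blinfun"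
  and op_inv_left: "op_invertible A \<Longrightarrow> op_inv A o\<^sub>L A = id_blinfun"
  using theI'[OF op_inv_exists[of A]] by (auto simp: op_inv_def)

lemma op_inv_apply_right: "op_invertible A \<Longrightarrow> A (op_inv A x) = x"
  by (metis blinfun_apply_blinfun_compose id_blinfun.rep_eq op_inv_right)

lemma op_inv_apply_left: "op_invertible A \<Longrightarrow> op_inv A (A x) = x"
  by (metis blinfun_apply_blinfun_compose id_blinfun.rep_eq op_inv_left)

lemma op_inv_unique:
  "A o\<^sub>L B = id_blinfun \<Longrightarrow> B o\<^sub>L A = id_blinfun \<Longrightarrow> op_inv A = B"
  using op_inv_exists[of A] op_inv_right[of A] op_inv_left[of A]
  by (auto simp: op_invertible_def)

lemma op_invertible_inv: "op_invertible A \<Longrightarrow> op_invertible (op_inv A)"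
  using op_inv_left op_inv_right unfolding op_invertible_def[of "op_inv A"] by blast

lemma complex_linear_op_inv:
  assumes A: "op_invertible A" "complex_linear A"
  shows "complex_linear (op_inv A)"
  unfolding complex_linear_def
proof (intro allI)
  fix c x
  have "op_inv A (A (c *\<^sub>C op_inv A x)) = c *\<^sub>C op_inv A x" by (rule op_inv_apply_left[OF A(1)])
  then show "op_inv A (c *\<^sub>C x) = c *\<^sub>C op_inv A x"
    by (simp add: complex_linearD[OF A(2)] op_inv_apply_right[OF A(1)])
qed

lemma op_inv_adj:
  fixes A :: "'a::complex_hilbert \<Rightarrow>\<^sub>L 'a"
  assumes A: "op_invertible A" "complex_linear A"
  shows "op_inv (adj A) = adj (op_inv A)"
proof (rule op_inv_unique)
  note lin = complex_linear_op_inv[OF A]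
  show "adj A o\<^sub>L adj (op_inv A) = id_blinfun"
    by (intro blinfun_eqI cinner_eqI_right)
       (simp add: adj_cinner[OF A(2), symmetric] adj_cinner[OF lin, symmetric] op_inv_apply_left[OF A(1)])
  show "adj (op_inv A) o\<^sub>L adj A = id_blinfun"
    by (intro blinfun_eqI cinner_eqI_right)
       (simp add: adj_cinner[OF A(2), symmetric] adj_cinner[OF lin, symmetric] op_inv_apply_right[OF A(1)])
qed

lemma complex_linear_id: "complex_linear id_blinfun"
  by (simp add: complex_linear_def)

lemma complex_linear_diff: "complex_linear A \<Longrightarrow> complex_linear B \<Longrightarrow> complex_linear (A - B)"
  by (simp add: complex_linear_def blinfun.diff_left scaleC_diff_right)

lemma complex_linear_add: "complex_linear A \<Longrightarrow> complex_linear B \<Longrightarrow> complex_linear (A + B)"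
  by (simp add: complex_linear_def blinfun.add_left scaleC_add_right)

lemma complex_linear_compose: "complex_linear A \<Longrightarrow> complex_linear B \<Longrightarrow> complex_linear (A o\<^sub>L B)"
  by (simp add: complex_linear_def)

lemma complex_linear_scaleR: "complex_linear A \<Longrightarrow> complex_linear (r *\<^sub>R A)"
  by (simp add: complex_linear_def blinfun.scaleR_left)
     (simp add: scaleR_scaleC scaleC_scaleC mult.commute)

lemma blinfun_compose_id: "id_blinfun o\<^sub>L A = A" "A o\<^sub>L id_blinfun = A"
  by (auto intro: blinfun_eqI)

text \<open>Neumann series. The powers need only be geometrically bounded, which is what contractivity
  with respect to an equivalent norm provides.\<close>

theorem op_invertible_one_minus:
  fixes W :: "'a::banach \<Rightarrow>\<^sub>L 'a"
  assumes bound: "\<And>k x. norm ((blinfun_apply W ^^ k) x) \<le> C * q ^ k * norm x" and q: "0 \<le> q" "q < 1"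
  shows "op_invertible (id_blinfun - W)"
proof -
  define V where "V k = ((\<lambda>B. W o\<^sub>L B) ^^ k) id_blinfun" for k
  have V0: "V 0 = id_blinfun" and VSuc: "V (Suc k) = W o\<^sub>L V k" for k by (simp_all add: V_def)
  have Vapp: "blinfun_apply (V k) = blinfun_apply W ^^ k" for k
    by (induction k) (auto simp: V0 VSuc fun_eq_iff)
  have VSuc': "V (Suc k) = V k o\<^sub>L W" for k
    by (rule blinfun_eqI) (simp add: Vapp funpow_swap1)
  have C: "norm (V k) \<le> \<bar>C\<bar> * q ^ k" for k
  proof (rule norm_blinfun_bound)
    show "norm (V k x) \<le> \<bar>C\<bar> * q ^ k * norm x" for x
      using bound[of k x] q
      by (simp add: Vapp order_trans[OF _ mult_right_mono[OF mult_right_mono[OF abs_ge_self]]])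
  qed (use q in simp)
  have "summable (\<lambda>k. norm (V k))"
    by (rule summable_comparison_test'[OF summable_mult[OF summable_geometric[of q]], of 0 _ "\<bar>C\<bar>"])
       (use q C in auto)
  then have sV: "summable V" by (rule summable_norm_cancel)
  define S where "S = suminf V"
  have shift: "(\<Sum>k. V (Suc k)) = S - id_blinfun"
    using suminf_split_head[OF sV] by (simp add: S_def V0)
  have "W o\<^sub>L S = (\<Sum>k. W o\<^sub>L V k)"
    unfolding S_def
    by (rule bounded_linear.suminf[OF bounded_bilinear.bounded_linear_right[OF bounded_bilinear_blinfun_compose] sV])
  then have WS: "W o\<^sub>L S = S - id_blinfun" using shift by (simp add: VSuc)
  have "S o\<^sub>L W = (\<Sum>k. V k o\<^sub>L W)"
    unfolding S_def
    by (rule bounded_linear.suminf[OF bounded_bilinear.bounded_linear_left[OF bounded_bilinear_blinfun_compose] sV])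
  then have SW: "S o\<^sub>L W = S - id_blinfun" using shift by (simp add: VSuc')
  have "(id_blinfun - W) o\<^sub>L S = id_blinfun" "S o\<^sub>L (id_blinfun - W) = id_blinfun"
    using WS SW blinfun_compose_id by (simp_all add: bounded_bilinear.diff_left[OF bounded_bilinear_blinfun_compose]
        bounded_bilinear.diff_right[OF bounded_bilinear_blinfun_compose])
  then show ?thesis unfolding op_invertible_def by blast
qed

text \<open>Polarization: the quadratic form is real, in particular at \<open>x + y\<close> and at \<open>x + \<i> y\<close>.\<close>

lemma pos_semidef_selfadjoint:
  assumes A: "pos_semidef A"
  shows "cinner (A x) y = cinner x (A y)"
proof -
  have lin: "complex_linear A" and real: "Im (cinner (A v) v) = 0" for v
    using A by (auto simp: pos_semidef_def complex_is_Real_iff)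
  have "Im (cinner (A x) y) + Im (cinner (A y) x) = 0"
    using real[of "x + y"] real[of x] real[of y] by (simp add: blinfun.add_right cinner_simps)
  moreover have "Re (cinner (A y) x) = Re (cinner (A x) y)"
    using real[of "x + \<i> *\<^sub>C y"] real[of x] real[of y]
    by (simp add: blinfun.add_right cinner_simps complex_linearD[OF lin])
  ultimately have "cinner (A x) y = cnj (cinner (A y) x)" by (simp add: complex_eq_iff)
  then show ?thesis using cinner_commute[of x "A y"] by simp
qed

lemma pos_semidef_Cauchy_Schwarz:
  assumes A: "pos_semidef A"
  shows "(cmod (cinner (A x) y))\<^sup>2 \<le> Re (cinner (A x) x) * Re (cinner (A y) y)"
proof -
  define h where "h = cinner (A x) y"
  define a where "a = Re (cinner (A x) x)"
  define b where "b = Re (cinner (A y) y)"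
  have lin: "complex_linear A" and pos: "0 \<le> Re (cinner (A v) v)" for v
    using A by (auto simp: pos_semidef_def)
  have ab: "0 \<le> a" "0 \<le> b" using pos by (auto simp: a_def b_def)
  have yx: "cinner (A y) x = cnj h"
    using pos_semidef_selfadjoint[OF A, of y x] cinner_commute[of y "A x"] by (simp add: h_def)
  have quad: "0 \<le> a + t\<^sup>2 * (cmod h)\<^sup>2 * b - 2 * t * (cmod h)\<^sup>2" for t :: real
  proof -
    define c where "c = of_real t * h"
    have "cinner (A (x - c *\<^sub>C y)) (x - c *\<^sub>C y)
        = cinner (A x) x - cnj c * h - c * cnj h + c * cnj c * cinner (A y) y"
      by (simp add: blinfun.diff_right complex_linearD[OF lin] cinner_simps yx algebra_simps flip: h_def)
    moreover have "cnj c * h = of_real (t * (cmod h)\<^sup>2)" "c * cnj h = of_real (t * (cmod h)\<^sup>2)"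
      "c * cnj c = of_real (t\<^sup>2 * (cmod h)\<^sup>2)"
      using complex_norm_square[of h] by (simp_all add: c_def power2_eq_square mult_ac)
    ultimately have "Re (cinner (A (x - c *\<^sub>C y)) (x - c *\<^sub>C y))
        = a + t\<^sup>2 * (cmod h)\<^sup>2 * b - 2 * t * (cmod h)\<^sup>2"
      by (simp add: a_def b_def)
    then show ?thesis using pos[of "x - c *\<^sub>C y"] by simp
  qed
  \<comment> \<open>The quadratic polynomial is smallest at \<open>t = 1 / b\<close>; for \<open>b = 0\<close> it is affine and a large \<open>t\<close> does.\<close>
  have "(cmod h)\<^sup>2 \<le> a * b"
  proof (cases "b = 0")
    case True
    have "(cmod h)\<^sup>2 = 0"
    proof (rule ccontr)
      assume "(cmod h)\<^sup>2 \<noteq> 0"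
      then show False using quad[of "(a + 1) / (cmod h)\<^sup>2"] True ab by (simp add: power2_eq_square)
    qed
    then show ?thesis using True by simp
  next
    case False
    then show ?thesis using quad[of "1 / b"] ab by (simp add: power2_eq_square field_simps)
  qed
  then show ?thesis by (simp add: h_def a_def b_def)
qed

text \<open>Cauchy--Schwarz for the form of \<open>A\<close>, applied to \<open>x\<close> and \<open>A x\<close>.\<close>

lemma pos_semidef_norm_le:
  assumes A: "pos_semidef A" and q: "0 \<le> q" "\<And>x. Re (cinner (A x) x) \<le> q * (norm x)\<^sup>2"
  shows "norm A \<le> q"
proof (rule norm_blinfun_bound[OF q(1)])
  fix x
  have pos: "0 \<le> Re (cinner (A v) v)" for v using A by (auto simp: pos_semidef_def)
  have "((norm (A x))\<^sup>2)\<^sup>2 = (cmod (cinner (A x) (A x)))\<^sup>2" by (simp add: cinner_self norm_power)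
  also have "\<dots> \<le> Re (cinner (A x) x) * Re (cinner (A (A x)) (A x))"
    by (rule pos_semidef_Cauchy_Schwarz[OF A])
  also have "\<dots> \<le> (q * (norm x)\<^sup>2) * (q * (norm (A x))\<^sup>2)"
    using q pos by (intro mult_mono) auto
  finally have "(norm (A x))\<^sup>2 * (norm (A x))\<^sup>2 \<le> (q * norm x)\<^sup>2 * (norm (A x))\<^sup>2"
    by (simp add: power2_eq_square mult_ac)
  then have "(norm (A x))\<^sup>2 \<le> (q * norm x)\<^sup>2 \<or> norm (A x) = 0"
    using mult_right_le_imp_le[of "(norm (A x))\<^sup>2" "(norm (A x))\<^sup>2"] by (metis zero_less_power2)
  then show "norm (A x) \<le> q * norm x"
    using q(1) by (auto intro: power2_le_imp_le)
qed

text \<open>Cauchy--Schwarz for the form of \<open>A\<close>, applied to \<open>x\<close> and \<open>A\<^sup>-\<^sup>1 x\<close>.\<close>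

lemma strictly_pos_def_lower_bound:
  assumes A: "strictly_pos_def A"
  shows "(norm x)\<^sup>2 \<le> norm (op_inv A) * Re (cinner (A x) x)"
proof (cases "x = 0")
  case False
  have psd: "pos_semidef A" and inv: "op_invertible A" using A by (auto simp: strictly_pos_def_def)
  define z where "z = op_inv A x"
  have Az: "A z = x" by (simp add: z_def op_inv_apply_right[OF inv])
  have "cinner (A x) z = of_real ((norm x)\<^sup>2)"
    by (simp add: pos_semidef_selfadjoint[OF psd] Az cinner_self)
  then have "((norm x)\<^sup>2)\<^sup>2 \<le> Re (cinner (A x) x) * Re (cinner x z)"
    using pos_semidef_Cauchy_Schwarz[OF psd, of x z] by (simp add: Az norm_power)
  also have "\<dots> \<le> Re (cinner (A x) x) * (norm (op_inv A) * (norm x)\<^sup>2)"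
  proof (rule mult_left_mono)
    have "Re (cinner x z) \<le> norm x * norm z"
      using cinner_Cauchy_Schwarz complex_Re_le_cmod order_trans by blast
    also have "\<dots> \<le> norm x * (norm (op_inv A) * norm x)"
      by (intro mult_left_mono) (auto simp: z_def norm_blinfun)
    finally show "Re (cinner x z) \<le> norm (op_inv A) * (norm x)\<^sup>2" by (simp add: power2_eq_square mult_ac)
  qed (use psd in \<open>auto simp: pos_semidef_def\<close>)
  finally show ?thesis using False by (simp add: power2_eq_square mult_ac)
qed (use A in \<open>simp add: strictly_pos_def_def\<close>)

lemma strictly_pos_def_inv:
  assumes A: "strictly_pos_def A"
  shows "strictly_pos_def (op_inv A)"
proof -
  have psd: "pos_semidef A" and inv: "op_invertible A" and lin: "complex_linear A"
    using A by (auto simp: strictly_pos_def_def pos_semidef_def)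
  have "cinner (op_inv A x) x = cinner (A (op_inv A x)) (op_inv A x)" for x
    by (metis pos_semidef_selfadjoint[OF psd] op_inv_apply_right[OF inv])
  then show ?thesis
    using psd complex_linear_op_inv[OF inv lin] op_invertible_inv[OF inv]
    by (simp add: strictly_pos_def_def pos_semidef_def)
qed

text \<open>Write \<open>A = m (I - X)\<close> with \<open>X\<close> positive of norm at most \<open>q < 1\<close>. A square root
  \<open>\<surd>m (I - Y)\<close> of \<open>A\<close> is a fixed point of \<open>Y \<mapsto> (X + Y\<^sup>2) / 2\<close>, a contraction on the ball whose
  radius \<open>r < 1\<close> solves \<open>r = (q + r\<^sup>2) / 2\<close>. Restricted to the bicommutant of \<open>A\<close>, the
  iteration also provides the commutation needed for uniqueness.\<close>

theorem strictly_pos_def_sqrt: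
  fixes A :: "'a::complex_hilbert \<Rightarrow>\<^sub>L 'a"
  assumes A: "strictly_pos_def A"
  shows "\<exists>!B. pos_semidef B \<and> B o\<^sub>L B = A"
proof -
  have psd: "pos_semidef A" and lin: "complex_linear A" and real: "\<And>x. Im (cinner (A x) x) = 0"
    using A by (auto simp: strictly_pos_def_def pos_semidef_def complex_is_Real_iff)
  define m where "m = norm A + 1"
  define d where "d = 1 / (norm (op_inv A) + 1)"
  have m: "1 \<le> m" by (simp add: m_def)
  have d: "0 < d" "d \<le> 1" by (auto simp: d_def add_nonneg_pos)
  define q where "q = 1 - d / m"
  have "0 < d / m" "d / m \<le> 1" using d m by (auto simp: divide_le_eq)
  then have q: "0 \<le> q" "q < 1" by (simp_all add: q_def)
  have lower: "d * (norm x)\<^sup>2 \<le> Re (cinner (A x) x)" for x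
  proof -
    have "(norm x)\<^sup>2 \<le> (norm (op_inv A) + 1) * Re (cinner (A x) x)"
      using strictly_pos_def_lower_bound[OF A, of x] psd by (simp add: pos_semidef_def distrib_right)
        (metis add_increasing2)
    moreover have "0 < norm (op_inv A) + 1" by (simp add: add_nonneg_pos)
    ultimately show ?thesis by (simp add: d_def field_simps)
  qed
  have upper: "Re (cinner (A x) x) \<le> m * (norm x)\<^sup>2" for x
  proof -
    have "Re (cinner (A x) x) \<le> norm (A x) * norm x"
      using cinner_Cauchy_Schwarz complex_Re_le_cmod order_trans by blast
    also have "\<dots> \<le> norm A * norm x * norm x" by (intro mult_right_mono norm_blinfun) simp
    also have "\<dots> \<le> m * (norm x)\<^sup>2" by (simp add: m_def power2_eq_square distrib_right)
    finally show ?thesis .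
  qed
  define X where "X = id_blinfun - (1 / m) *\<^sub>R A"
  have Xapp: "X x = x - (1 / m) *\<^sub>R A x" for x
    by (simp add: X_def blinfun.diff_left blinfun.scaleR_left)
  have Xform: "cinner (X x) x = of_real ((norm x)\<^sup>2 - Re (cinner (A x) x) / m)" for x
    using real[of x] by (simp add: Xapp cinner_simps cinner_scaleR_left cinner_self complex_eq_iff)
  have Xlin: "complex_linear X"
    unfolding X_def by (intro complex_linear_diff complex_linear_id complex_linear_scaleR lin)
  have Xpsd: "pos_semidef X"
    unfolding pos_semidef_def using Xlin upper m by (simp add: Xform divide_le_eq mult.commute)
  have Xnorm: "norm X \<le> q"
  proof (rule pos_semidef_norm_le[OF Xpsd q(1)])
    show "Re (cinner (X x) x) \<le> q * (norm x)\<^sup>2" for x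
      using divide_right_mono[OF lower[of x], of m] m by (simp add: Xform q_def left_diff_distrib)
  qed
  define r where "r = 1 - sqrt (1 - q)"
  have r: "0 \<le> r" "r < 1" using q by (auto simp: r_def)
  have fix_r: "q + r\<^sup>2 = 2 * r"
    using q by (simp add: r_def power2_diff)
  define f where "f Y = (1/2::real) *\<^sub>R (X + (Y o\<^sub>L Y))" for Y
  define S where "S = {Y. norm Y \<le> r \<and> complex_linear Y \<and> (\<forall>x y. cinner (Y x) y = cinner x (Y y)) \<and>
      (\<forall>C. C o\<^sub>L A = A o\<^sub>L C \<longrightarrow> C o\<^sub>L Y = Y o\<^sub>L C)}"
  have fapp: "f Y x = (1/2::real) *\<^sub>R (X x + Y (Y x))" for Y x
    by (simp add: f_def blinfun.scaleR_left blinfun.add_left)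
  have "closed S"
    unfolding S_def complex_linear_def
    by (intro closed_Collect_conj closed_Collect_all closed_Collect_imp closed_Collect_le closed_Collect_eq
        continuous_intros open_Collect_const
        bounded_linear.continuous_on[OF bounded_linear_scaleC_right]
        bounded_linear.continuous_on[OF bounded_linear_cinner_left]
        bounded_linear.continuous_on[OF bounded_linear_cinner_right]
        bounded_bilinear.continuous_on[OF bounded_bilinear_blinfun_compose])
  then have complete: "complete S" by (simp add: complete_eq_closed)
  have nonempty: "0 \<in> S" using r by (auto simp: S_def complex_linear_def)
  have maps: "f ` S \<subseteq> S"
  proof (rule image_subsetI)
    fix Y assume Y: "Y \<in> S"
    have "norm (X + (Y o\<^sub>L Y)) \<le> q + r * r"
      using Y r by (intro norm_triangle_mono Xnorm order_trans[OF norm_blinfun_compose] mult_mono)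
        (auto simp: S_def)
    then have "norm (f Y) \<le> r" using fix_r by (simp add: f_def power2_eq_square)
    moreover have "complex_linear (f Y)"
      unfolding f_def using Y
      by (intro complex_linear_scaleR complex_linear_add complex_linear_compose Xlin) (auto simp: S_def)
    moreover have "cinner (f Y x) y = cinner x (f Y y)" for x y
      using Y by (simp add: fapp cinner_scaleR_left cinner_scaleR_right cinner_simps S_def
          pos_semidef_selfadjoint[OF Xpsd])
    moreover have "C o\<^sub>L f Y = f Y o\<^sub>L C" if C: "C o\<^sub>L A = A o\<^sub>L C" for C
    proof (rule blinfun_eqI)
      fix x
      have CY: "C o\<^sub>L Y = Y o\<^sub>L C" using Y C by (auto simp: S_def)
      have "C (Y v) = Y (C v)" "C (A v) = A (C v)" for v
        using C CY by (metis blinfun_apply_blinfun_compose)+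
      then show "(C o\<^sub>L f Y) x = (f Y o\<^sub>L C) x"
        by (simp add: fapp Xapp blinfun.scaleR_right blinfun.add_right blinfun.diff_right)
    qed
    ultimately show "f Y \<in> S" by (simp add: S_def)
  qed
  have contr: "dist (f Y) (f Y') \<le> r * dist Y Y'" if "Y \<in> S" "Y' \<in> S" for Y Y'
  proof -
    have "f Y - f Y' = (1/2::real) *\<^sub>R ((Y o\<^sub>L (Y - Y')) + ((Y - Y') o\<^sub>L Y'))"
      by (rule blinfun_eqI) (simp add: blinfun.diff_left fapp blinfun.scaleR_left blinfun.add_left
          blinfun.diff_right flip: scaleR_diff_right)
    moreover have "norm ((Y o\<^sub>L (Y - Y')) + ((Y - Y') o\<^sub>L Y')) \<le> r * norm (Y - Y') + norm (Y - Y') * r"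
      using that r
      by (intro norm_triangle_mono order_trans[OF norm_blinfun_compose] mult_mono) (auto simp: S_def)
    ultimately show ?thesis by (simp add: dist_norm mult.commute)
  qed
  obtain Y where Y: "Y \<in> S" "f Y = Y"
    using Banach_fix[OF complete _ r maps contr] nonempty by blast
  have Yself: "cinner (Y x) y = cinner x (Y y)" and Ynorm: "norm Y \<le> r" and Ylin: "complex_linear Y" for x y
    using Y(1) by (auto simp: S_def)
  have YY: "Y (Y x) = 2 *\<^sub>R Y x - X x" for x
  proof -
    have "2 *\<^sub>R Y x = 2 *\<^sub>R f Y x" using Y(2) by simp
    then show ?thesis by (simp add: fapp)
  qed
  define B where "B = sqrt m *\<^sub>R (id_blinfun - Y)"
  have Bapp: "B x = sqrt m *\<^sub>R (x - Y x)" for x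
    by (simp add: B_def blinfun.scaleR_left blinfun.diff_left)
  have BB: "B o\<^sub>L B = A"
  proof (rule blinfun_eqI)
    fix x
    have "(B o\<^sub>L B) x = m *\<^sub>R (x - 2 *\<^sub>R Y x + Y (Y x))"
      using m by (simp add: Bapp blinfun.scaleR_right blinfun.diff_right scaleR_2 algebra_simps)
    also have "\<dots> = A x" using m by (simp add: YY Xapp algebra_simps)
    finally show "(B o\<^sub>L B) x = A x" .
  qed
  have Breal: "Im (cinner (B x) x) = 0" for x
  proof -
    have "cinner (B x) x = cinner x (B x)"
      by (simp add: Bapp cinner_scaleR_left cinner_scaleR_right cinner_simps Yself)
    then show ?thesis using arg_cong[OF cinner_commute[of x "B x"], of Im] by simp
  qed
  have Bpos: "sqrt m * (1 - r) * (norm x)\<^sup>2 \<le> Re (cinner (B x) x)" for x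
  proof -
    have "Re (cinner (Y x) x) \<le> norm (Y x) * norm x"
      using cinner_Cauchy_Schwarz complex_Re_le_cmod order_trans by blast
    also have "\<dots> \<le> r * norm x * norm x"
      by (intro mult_right_mono order_trans[OF norm_blinfun] Ynorm) simp_all
    finally have "(1 - r) * (norm x)\<^sup>2 \<le> (norm x)\<^sup>2 - Re (cinner (Y x) x)"
      by (simp add: power2_eq_square algebra_simps)
    then show ?thesis
      using mult_left_mono[of _ _ "sqrt m"] m
      by (simp add: Bapp cinner_scaleR_left cinner_simps cinner_self mult.assoc)
  qed
  have Blin: "complex_linear B"
    unfolding B_def by (intro complex_linear_scaleR complex_linear_diff complex_linear_id Ylin)
  have "0 \<le> sqrt m * (1 - r) * (norm x)\<^sup>2" for x :: 'a using m r by simp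
  then have Bpsd: "pos_semidef B"
    using Blin Breal Bpos unfolding pos_semidef_def complex_is_Real_iff by (meson order_trans)
  show ?thesis
  proof (rule ex1I)
    show "pos_semidef B \<and> B o\<^sub>L B = A" using Bpsd BB by blast
    fix C assume C: "pos_semidef C \<and> C o\<^sub>L C = A"
    then have CC: "C (C x) = A x" for x by (metis blinfun_apply_blinfun_compose)
    have BBx: "B (B x) = A x" for x using BB by (metis blinfun_apply_blinfun_compose)
    have "C o\<^sub>L A = A o\<^sub>L C" by (rule blinfun_eqI) (simp flip: CC)
    then have "C o\<^sub>L Y = Y o\<^sub>L C" using Y(1) by (simp add: S_def)
    then have "C (Y x) = Y (C x)" for x by (metis blinfun_apply_blinfun_compose)
    then have CB: "C (B x) = B (C x)" for x
      by (simp add: Bapp blinfun.scaleR_right blinfun.diff_right)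
    show "C = B"
    proof (rule blinfun_eqI)
      fix x
      define y where "y = B x - C x"
      have "B y + C y = 0" by (simp add: y_def blinfun.diff_right CB CC BBx)
      then have "cinner (B y) y + cinner (C y) y = 0" by (metis cinner_add_left cinner_zero_left)
      then have "Re (cinner (B y) y) + Re (cinner (C y) y) = 0" by (metis plus_complex.simps(1) zero_complex.simps(1))
      moreover have "0 \<le> Re (cinner (C y) y)" using C by (simp add: pos_semidef_def)
      ultimately have "sqrt m * (1 - r) * (norm y)\<^sup>2 \<le> 0" using Bpos[of y] by simp
      moreover have "0 < sqrt m * (1 - r)" using m r by simp
      ultimately have "(norm y)\<^sup>2 \<le> 0" by (metis mult_le_0_iff not_less)
      then show "C x = B x" by (simp add: y_def)
    qed
  qed
qed

lemma op_sqrt: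
  assumes "strictly_pos_def A"
  shows "pos_semidef (op_sqrt A)" "op_sqrt A (op_sqrt A x) = A x"
  using theI'[OF strictly_pos_def_sqrt[OF assms]] unfolding op_sqrt_def
  by (simp, metis (no_types, lifting) blinfun_apply_blinfun_compose)

section \<open>Multi-indices and power series on the ball\<close>

text \<open>The monomials at arbitrary arguments. The type of points of the ball is too narrow for arguments
  such as \<open>z\<^sub>j \<cdot> cnj w\<^sub>j\<close> or \<open>\<bar>z\<^sub>j\<bar>\<close>, at which the multinomial series is summed below.\<close>

definition mpow :: "('d::finite \<Rightarrow> 'a::comm_monoid_mult) \<Rightarrow> ('d \<Rightarrow> nat) \<Rightarrow> 'a"
  where "mpow \<zeta> n = (\<Prod>j\<in>UNIV. \<zeta> j ^ n j)"

definition mi_unit :: "'d::finite \<Rightarrow> 'd \<Rightarrow> nat"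
  where "mi_unit j = (\<lambda>i. if i = j then 1 else 0)"

definition multinom :: "('d::finite \<Rightarrow> nat) \<Rightarrow> real"
  where "multinom n = fact (mi_abs n) / real (mi_fact n)"

lemma monomial_eq_mpow: "monomial z n = mpow (coord z) n"
  by (simp add: monomial_def mpow_def)

lemma mpow_zero [simp]: "mpow \<zeta> 0 = 1"
  by (simp add: mpow_def)

lemma mpow_add_unit: "mpow \<zeta> (n + mi_unit j) = \<zeta> j * mpow \<zeta> n"
proof -
  have "mpow \<zeta> (n + mi_unit j) = (\<Prod>i\<in>UNIV. (if i = j then \<zeta> j else 1) * \<zeta> i ^ n i)"
    unfolding mpow_def by (intro prod.cong) (auto simp: mi_unit_def)
  then show ?thesis by (simp add: prod.distrib mpow_def)
qed

lemma mpow_mult: "mpow (\<lambda>j. \<zeta> j * \<xi> j) n = mpow \<zeta> n * mpow \<xi> n"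
  by (simp add: mpow_def power_mult_distrib prod.distrib)

lemma norm_mpow: "norm (mpow \<zeta> n) = mpow (\<lambda>j. norm (\<zeta> j)) n" for \<zeta> :: "'d::finite \<Rightarrow> complex"
  by (simp add: mpow_def norm_power flip: prod_norm)

lemma mi_abs_zero [simp]: "mi_abs 0 = 0"
  by (simp add: mi_abs_def)

lemma mi_abs_add_unit [simp]: "mi_abs (n + mi_unit j) = Suc (mi_abs n)"
  by (simp add: mi_abs_def sum.distrib mi_unit_def)

lemma mi_abs_eq_0: "mi_abs n = 0 \<longleftrightarrow> n = 0"
  by (auto simp: mi_abs_def fun_eq_iff)

lemma mi_fact_add_unit: "mi_fact (n + mi_unit j) = Suc (n j) * mi_fact n"
proof -
  have "mi_fact (n + mi_unit j) = (\<Prod>i\<in>UNIV. (if i = j then Suc (n j) else 1) * fact (n i))"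
    unfolding mi_fact_def by (intro prod.cong) (auto simp: mi_unit_def)
  then show ?thesis by (simp add: prod.distrib mi_fact_def)
qed

lemma mi_fact_pos: "0 < mi_fact n"
  by (simp add: mi_fact_def prod_pos)

lemma multinom_pos: "0 < multinom n"
  using mi_fact_pos[of n] by (simp add: multinom_def)

lemma da_weight_pos: "0 < da_weight n"
  using mi_fact_pos[of n] by (simp add: da_weight_def)

lemma da_weight_multinom [simp]: "da_weight n * multinom n = 1"
  using mi_fact_pos[of n] by (simp add: da_weight_def multinom_def)

lemma multinom_zero [simp]: "multinom 0 = 1" and da_weight_zero [simp]: "da_weight 0 = 1"
  by (simp_all add: multinom_def da_weight_def mi_fact_def)

lemma real_mi_fact_add_unit:
  "real (mi_fact (n + mi_unit j)) = real (Suc (n j)) * real (mi_fact n)"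
  by (simp only: mi_fact_add_unit of_nat_mult)

lemma fact_mi_abs_add_unit:
  "(fact (mi_abs (n + mi_unit j)) :: real) = real (Suc (mi_abs n)) * fact (mi_abs n)"
  by (simp only: mi_abs_add_unit fact_Suc of_nat_mult)

lemma multinom_add_unit:
  "multinom (n + mi_unit j) * real (Suc (n j)) = multinom n * real (Suc (mi_abs n))"
  unfolding multinom_def real_mi_fact_add_unit fact_mi_abs_add_unit
  by (simp del: of_nat_Suc)

lemma da_weight_add_unit_le: "da_weight (n + mi_unit j) \<le> da_weight n"
proof -
  have "n j \<le> mi_abs n" unfolding mi_abs_def by (rule member_le_sum) auto
  then have "real (Suc (n j)) / real (Suc (mi_abs n)) \<le> 1" by simp
  then have "da_weight n * (real (Suc (n j)) / real (Suc (mi_abs n))) \<le> da_weight n"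
    using da_weight_pos[of n] by (intro mult_left_le) auto
  moreover have "da_weight (n + mi_unit j) = da_weight n * (real (Suc (n j)) / real (Suc (mi_abs n)))"
    unfolding da_weight_def real_mi_fact_add_unit fact_mi_abs_add_unit
    by (simp add: mult.commute del: of_nat_Suc)
  ultimately show ?thesis by simp
qed

lemma inj_add_unit: "inj (\<lambda>n. n + mi_unit j)"
  by (rule injI) simp

lemma range_add_unit: "range (\<lambda>n. n + mi_unit j) = {n. 0 < n j}"
proof (rule set_eqI)
  fix n :: "'a \<Rightarrow> nat"
  have "n = (\<lambda>i. n i - mi_unit j i) + mi_unit j" if "0 < n j"
    using that by (auto simp: mi_unit_def fun_eq_iff)
  then show "n \<in> range (\<lambda>n. n + mi_unit j) \<longleftrightarrow> n \<in> {n. 0 < n j}"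
    by (auto simp: mi_unit_def)
qed

lemma finite_mi_abs_le: "finite {n :: 'd::finite \<Rightarrow> nat. mi_abs n \<le> k}"
proof (rule finite_subset)
  have "n j \<le> mi_abs n" for n :: "'d \<Rightarrow> nat" and j
    unfolding mi_abs_def by (rule member_le_sum) auto
  then show "{n :: 'd \<Rightarrow> nat. mi_abs n \<le> k} \<subseteq> PiE UNIV (\<lambda>_. {..k})"
    by (fastforce intro: order_trans)
qed (simp add: finite_PiE)

lemma finite_mi_abs_eq: "finite {n :: 'd::finite \<Rightarrow> nat. mi_abs n = k}"
  by (rule finite_subset[OF _ finite_mi_abs_le[of k]]) auto

text \<open>Pascal's rule for multinomial coefficients: the coefficient of \<open>n\<close> is the sum of those of the
  predecessors \<open>n - e\<^sub>j\<close>, which are its fractions \<open>n\<^sub>j / \<bar>n\<bar>\<close>.\<close>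

lemma sum_homogeneous_Suc:
  fixes f :: "('d::finite \<Rightarrow> nat) \<Rightarrow> 'v::real_vector"
  shows "(\<Sum>n | mi_abs n = Suc k. multinom n *\<^sub>R f n)
    = (\<Sum>j\<in>UNIV. \<Sum>n | mi_abs n = k. multinom n *\<^sub>R f (n + mi_unit j))"
proof -
  define D where "D k = {n :: 'd \<Rightarrow> nat. mi_abs n = k}" for k
  have fin: "finite (D k)" for k unfolding D_def by (rule finite_mi_abs_eq)
  have inner: "(\<Sum>n\<in>D k. multinom n *\<^sub>R f (n + mi_unit j))
      = (\<Sum>n\<in>D (Suc k). (multinom n * (real (n j) / real (Suc k))) *\<^sub>R f n)" for j
  proof -
    have "(\<Sum>n\<in>D k. multinom n *\<^sub>R f (n + mi_unit j))
        = (\<Sum>n\<in>D k. (multinom (n + mi_unit j) * (real ((n + mi_unit j) j) / real (Suc k))) *\<^sub>R f (n + mi_unit j))"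
    proof (rule sum.cong[OF refl])
      fix n assume "n \<in> D k"
      then have "multinom n = multinom (n + mi_unit j) * (real ((n + mi_unit j) j) / real (Suc k))"
        using multinom_add_unit[of n j] by (simp add: D_def mi_unit_def field_simps)
      then show "multinom n *\<^sub>R f (n + mi_unit j)
          = (multinom (n + mi_unit j) * (real ((n + mi_unit j) j) / real (Suc k))) *\<^sub>R f (n + mi_unit j)"
        by simp
    qed
    also have "\<dots> = (\<Sum>n\<in>(\<lambda>n. n + mi_unit j) ` D k. (multinom n * (real (n j) / real (Suc k))) *\<^sub>R f n)"
      by (subst sum.reindex) (auto simp: o_def intro: inj_on_subset[OF inj_add_unit])
    also have "\<dots> = (\<Sum>n\<in>D (Suc k). (multinom n * (real (n j) / real (Suc k))) *\<^sub>R f n)"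
    proof (rule sum.mono_neutral_left[OF fin])
      show "(\<lambda>n. n + mi_unit j) ` D k \<subseteq> D (Suc k)" by (auto simp: D_def)
      have "n j = 0" if "n \<in> D (Suc k)" "n \<notin> (\<lambda>n. n + mi_unit j) ` D k" for n
      proof (rule ccontr)
        assume "n j \<noteq> 0"
        then obtain m where m: "n = m + mi_unit j" using range_add_unit[of j] by blast
        then have "m \<in> D k" using that(1) by (simp add: D_def)
        then show False using that(2) m by blast
      qed
      then show "\<forall>n\<in>D (Suc k) - (\<lambda>n. n + mi_unit j) ` D k.
          (multinom n * (real (n j) / real (Suc k))) *\<^sub>R f n = 0" by simp
    qed
    finally show ?thesis .
  qed
  have "(\<Sum>j\<in>UNIV. \<Sum>n\<in>D k. multinom n *\<^sub>R f (n + mi_unit j))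
      = (\<Sum>n\<in>D (Suc k). (\<Sum>j\<in>UNIV. multinom n * (real (n j) / real (Suc k))) *\<^sub>R f n)"
    unfolding inner by (subst sum.swap) (simp add: scaleR_sum_left)
  also have "\<dots> = (\<Sum>n\<in>D (Suc k). multinom n *\<^sub>R f n)"
  proof (rule sum.cong[OF refl])
    fix n assume "n \<in> D (Suc k)"
    then have "(\<Sum>j\<in>UNIV. real (n j)) = real (Suc k)"
      by (simp add: D_def mi_abs_def flip: of_nat_sum)
    then have "(\<Sum>j\<in>UNIV. multinom n * (real (n j) / real (Suc k))) = multinom n"
      by (simp flip: sum_distrib_left sum_divide_distrib)
    then show "(\<Sum>j\<in>UNIV. multinom n * (real (n j) / real (Suc k))) *\<^sub>R f n = multinom n *\<^sub>R f n"
      by simp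
  qed
  finally show ?thesis by (simp add: D_def)
qed

lemma multinomial_theorem:
  fixes \<zeta> :: "'d::finite \<Rightarrow> 'a::{real_algebra_1,comm_ring_1}"
  shows "(\<Sum>n | mi_abs n = k. multinom n *\<^sub>R mpow \<zeta> n) = (\<Sum>j\<in>UNIV. \<zeta> j) ^ k"
proof (induction k)
  case (Suc k)
  have "(\<Sum>n | mi_abs n = Suc k. multinom n *\<^sub>R mpow \<zeta> n)
      = (\<Sum>j\<in>UNIV. \<zeta> j * (\<Sum>n | mi_abs n = k. multinom n *\<^sub>R mpow \<zeta> n))"
    unfolding sum_homogeneous_Suc by (simp add: mpow_add_unit sum_distrib_left)
  then show ?case by (simp add: Suc.IH sum_distrib_right)
next
  case 0
  have "{n :: 'd \<Rightarrow> nat. mi_abs n = 0} = {0}" by (auto simp: mi_abs_eq_0)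
  then show ?case
    by (simp only: sum.insert finite.emptyI empty_iff not_False_eq_True sum.empty multinom_zero
        mpow_zero power_0 scaleR_one add_0_right)
qed

lemma sum_by_degree:
  "(\<Sum>n | mi_abs n \<le> K. f n) = (\<Sum>k\<le>K. \<Sum>n | mi_abs n = k. f (n::'d::finite \<Rightarrow> nat))"
proof -
  have "(\<Sum>k\<le>K. sum f {n \<in> {n. mi_abs n \<le> K}. mi_abs n = k}) = sum f {n. mi_abs n \<le> K}"
    by (rule sum.group[OF finite_mi_abs_le]) auto
  moreover have "sum f {n \<in> {n. mi_abs n \<le> K}. mi_abs n = k} = sum f {n. mi_abs n = k}" if "k \<le> K" for k
    using that by (intro sum.cong) auto
  ultimately show ?thesis by simp
qed

text \<open>The sets of multi-indices of bounded degree are cofinal among the finite sets.\<close>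

lemma has_sum_degree_limit:
  assumes "(f has_sum s) (UNIV :: ('d::finite \<Rightarrow> nat) set)"
  shows "(\<lambda>k. \<Sum>n | mi_abs n = k. f n) sums s"
proof -
  have "filterlim (\<lambda>K. {n :: 'd \<Rightarrow> nat. mi_abs n \<le> K}) (finite_subsets_at_top UNIV) sequentially"
    unfolding filterlim_finite_subsets_at_top
  proof (intro allI impI)
    fix F :: "('d \<Rightarrow> nat) set" assume F: "finite F \<and> F \<subseteq> UNIV"
    then have "F \<subseteq> {n. mi_abs n \<le> K}" if "K \<ge> Max (insert 0 (mi_abs ` F))" for K
      using that by (auto simp: Max_ge_iff)
    then show "\<forall>\<^sub>F K in sequentially. finite {n. mi_abs n \<le> K} \<and> F \<subseteq> {n. mi_abs n \<le> K} \<and>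
        {n. mi_abs n \<le> K} \<subseteq> UNIV"
      using finite_mi_abs_le by (auto simp: eventually_sequentially)
  qed
  then have "(\<lambda>K. \<Sum>n | mi_abs n \<le> K. f n) \<longlonglongrightarrow> s"
    using assms unfolding has_sum_def by (rule filterlim_compose[rotated])
  then show ?thesis by (simp add: sum_by_degree sums_def_le)
qed

lemma multinomial_series:
  fixes \<zeta> :: "'d::finite \<Rightarrow> complex"
  assumes "(\<Sum>j\<in>UNIV. norm (\<zeta> j)) < 1"
  shows "((\<lambda>n. of_real (multinom n) * mpow \<zeta> n) has_sum 1 / (1 - (\<Sum>j\<in>UNIV. \<zeta> j))) UNIV"
    and "(\<lambda>n. multinom n * mpow (\<lambda>j. norm (\<zeta> j)) n) summable_on UNIV"
proof -
  define s where "s = (\<Sum>j\<in>UNIV. norm (\<zeta> j))"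
  have s: "0 \<le> s" "s < 1" using assms by (auto simp: s_def intro: sum_nonneg)
  have nonneg: "0 \<le> multinom n * mpow (\<lambda>j. norm (\<zeta> j)) n" for n
    using multinom_pos[of n] by (simp add: mpow_def prod_nonneg)
  show abs: "(\<lambda>n. multinom n * mpow (\<lambda>j. norm (\<zeta> j)) n) summable_on UNIV"
  proof (rule nonneg_bdd_above_summable_on[OF nonneg])
    show "bdd_above (sum (\<lambda>n. multinom n * mpow (\<lambda>j. norm (\<zeta> j)) n) ` {F. F \<subseteq> UNIV \<and> finite F})"
    proof (rule bdd_aboveI2)
      fix F :: "('d \<Rightarrow> nat) set" assume "F \<in> {F. F \<subseteq> UNIV \<and> finite F}"
      then have F: "finite F" by simp
      define K where "K = Max (insert 0 (mi_abs ` F))"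
      have "F \<subseteq> {n. mi_abs n \<le> K}" using F by (auto simp: K_def Max_ge_iff)
      then have "(\<Sum>n\<in>F. multinom n * mpow (\<lambda>j. norm (\<zeta> j)) n)
          \<le> (\<Sum>n | mi_abs n \<le> K. multinom n * mpow (\<lambda>j. norm (\<zeta> j)) n)"
        by (intro sum_mono2 finite_mi_abs_le nonneg)
      also have "\<dots> = (\<Sum>k\<le>K. s ^ k)"
        using multinomial_theorem[of "\<lambda>j. norm (\<zeta> j)"] by (simp add: sum_by_degree s_def)
      also have "\<dots> \<le> (\<Sum>k. s ^ k)"
        using s by (intro sum_le_suminf summable_geometric) auto
      finally show "(\<Sum>n\<in>F. multinom n * mpow (\<lambda>j. norm (\<zeta> j)) n) \<le> (\<Sum>k. s ^ k)" .
    qed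
  qed
  have "(\<lambda>n. norm (of_real (multinom n) * mpow \<zeta> n)) summable_on UNIV"
    using abs by (simp add: norm_mult norm_mpow abs_of_pos[OF multinom_pos])
  from abs_summable_summable[OF this]
  obtain t where t: "((\<lambda>n. of_real (multinom n) * mpow \<zeta> n) has_sum t) UNIV"
    unfolding summable_on_def by blast
  have "(\<lambda>k. (\<Sum>j\<in>UNIV. \<zeta> j) ^ k) sums t"
    using has_sum_degree_limit[OF t] multinomial_theorem[of \<zeta>] by (simp add: scaleR_conv_of_real)
  moreover have "norm (\<Sum>j\<in>UNIV. \<zeta> j) < 1"
    using s norm_sum[of \<zeta> UNIV] by (simp add: s_def)
  then have "(\<lambda>k. (\<Sum>j\<in>UNIV. \<zeta> j) ^ k) sums (1 / (1 - (\<Sum>j\<in>UNIV. \<zeta> j)))"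
    by (rule geometric_sums)
  ultimately show "((\<lambda>n. of_real (multinom n) * mpow \<zeta> n) has_sum 1 / (1 - (\<Sum>j\<in>UNIV. \<zeta> j))) UNIV"
    using t sums_unique2 by blast
qed

text \<open>After division by \<open>t\<^sup>k\<close>, the first coefficient that might not vanish is the limit at \<open>0\<close>.\<close>

lemma power_series_zero:
  fixes b :: "nat \<Rightarrow> complex"
  assumes sums: "\<And>t. norm t < 1 \<Longrightarrow> (\<lambda>k. b k * t ^ k) sums 0"
  shows "b k = 0"
proof (induction k rule: less_induct)
  case (less k)
  have "(\<lambda>i. b (i + k) * t ^ i) sums 0" if t: "t \<noteq> 0" "norm t < 1" for t
  proof -
    have "(\<lambda>i. b (i + k) * t ^ (i + k)) sums 0"
      using sums_split_initial_segment[OF sums[OF t(2)], of k] less by simp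
    from sums_divide[OF this, of "t ^ k"] show ?thesis using t by (simp add: power_add)
  qed
  then have "((\<lambda>_. 0) \<longlongrightarrow> b (0 + k)) (at (0::complex))"
    by (intro powser_limit_0_strong[of 1 "\<lambda>i. b (i + k)"]) auto
  then show ?case by (simp add: tendsto_const_iff)
qed

lemma digits_unique:
  fixes f g :: "nat \<Rightarrow> nat"
  assumes "\<And>i. i < L \<Longrightarrow> f i < K" "\<And>i. i < L \<Longrightarrow> g i < K"
    "(\<Sum>i<L. f i * K ^ i) = (\<Sum>i<L. g i * K ^ i)" "i < L"
  shows "f i = g i"
  using assms
proof (induction L arbitrary: f g i)
  case (Suc L)
  have split: "(\<Sum>i<Suc L. h i * K ^ i) = h 0 + K * (\<Sum>i<L. h (Suc i) * K ^ i)" for h :: "nat \<Rightarrow> nat"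
    by (simp add: sum.lessThan_Suc_shift sum_distrib_left mult_ac del: sum.lessThan_Suc)
  have eq: "f 0 + K * (\<Sum>i<L. f (Suc i) * K ^ i) = g 0 + K * (\<Sum>i<L. g (Suc i) * K ^ i)"
    using Suc.prems(3) unfolding split .
  have 0: "f 0 < K" "g 0 < K" using Suc.prems by auto
  have "f 0 = g 0" using arg_cong[OF eq, of "\<lambda>x. x mod K"] 0 by simp
  moreover have "f (Suc i) = g (Suc i)" if "i < L" for i
  proof (rule Suc.IH[where f = "\<lambda>i. f (Suc i)" and g = "\<lambda>i. g (Suc i)", OF _ _ _ that])
    show "(\<Sum>i<L. f (Suc i) * K ^ i) = (\<Sum>i<L. g (Suc i) * K ^ i)"
      using eq \<open>f 0 = g 0\<close> 0 by simp
  qed (use Suc.prems in auto)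
  ultimately show ?case using Suc.prems(4) by (cases i) auto
qed simp

text \<open>Kronecker's substitution \<open>\<zeta>\<^sub>j = \<rho> s\<^bsup>K^j\<^esup>\<close> with \<open>K\<close> above the degree turns distinct
  monomials of that degree into distinct powers of \<open>s\<close>.\<close>

lemma homogeneous_polynomial_zero:
  fixes \<beta> :: "('d::finite \<Rightarrow> nat) \<Rightarrow> complex"
  assumes zero: "\<And>\<zeta>. (\<Sum>j\<in>UNIV. norm (\<zeta> j)) < 1 \<Longrightarrow> (\<Sum>n | mi_abs n = k. mpow \<zeta> n * \<beta> n) = 0"
    and m: "mi_abs m = k"
  shows "\<beta> m = 0"
proof -
  obtain e where "bij_betw e (UNIV :: 'd set) {0..<CARD('d)}"
    using ex_bij_betw_finite_nat finite by blast
  then have e: "bij_betw e UNIV {..<CARD('d)}" by (simp add: atLeast0LessThan)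
  define K where "K = Suc k"
  define \<phi> where "\<phi> n = (\<Sum>j\<in>UNIV. n j * K ^ e j)" for n :: "'d \<Rightarrow> nat"
  define \<rho> where "\<rho> = 1 / (2 * of_nat CARD('d) :: complex)"
  have le: "n j < K" if "mi_abs n = k" for n :: "'d \<Rightarrow> nat" and j
    using that member_le_sum[of j UNIV n] by (simp add: K_def mi_abs_def)
  have inj: "n = m" if "mi_abs n = k" "\<phi> n = \<phi> m" for n
  proof
    fix j
    let ?e' = "inv_into UNIV e"
    have re: "\<phi> n = (\<Sum>i<CARD('d). n (?e' i) * K ^ i)" for n
      unfolding \<phi>_def
      by (rule sum.reindex_bij_witness[of _ ?e' e])
         (use e in \<open>auto simp: bij_betw_def f_inv_into_f inv_into_f_f\<close>)
    have "e j < CARD('d)" using e by (auto simp: bij_betw_def)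
    then have "n (?e' (e j)) = m (?e' (e j))"
      using digits_unique[of "CARD('d)" "\<lambda>i. n (?e' i)" K "\<lambda>i. m (?e' i)" "e j"] that m le e
      by (auto simp: re bij_betw_def)
    then show "n j = m j" using e by (simp add: bij_betw_def inv_into_f_f)
  qed
  define Q where "Q = (\<Sum>n | mi_abs n = k. monom (\<beta> n) (\<phi> n))"
  have "poly Q s = 0" if s: "norm s < 1" for s
  proof -
    define \<zeta> where "\<zeta> j = \<rho> * s ^ (K ^ e j)" for j
    have "norm (\<zeta> j) \<le> 1 / (2 * real CARD('d))" for j
      using s by (simp add: \<zeta>_def \<rho>_def norm_mult norm_divide norm_power mult_left_le power_le_one divide_le_cancel)
    then have "(\<Sum>j\<in>UNIV. norm (\<zeta> j)) \<le> (\<Sum>j\<in>(UNIV::'d set). 1 / (2 * real CARD('d)))"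
      by (intro sum_mono)
    then have small: "(\<Sum>j\<in>UNIV. norm (\<zeta> j)) < 1" by simp
    have "mpow \<zeta> n = \<rho> ^ mi_abs n * s ^ \<phi> n" for n
      by (simp add: mpow_def \<zeta>_def \<phi>_def mi_abs_def power_mult_distrib prod.distrib power_sum
          mult.commute flip: power_mult)
    then have "\<rho> ^ k * (\<Sum>n | mi_abs n = k. s ^ \<phi> n * \<beta> n) = 0"
      using zero[OF small] by (simp add: sum_distrib_left mult.assoc)
    moreover have "\<rho> \<noteq> 0" by (simp add: \<rho>_def)
    ultimately show ?thesis by (simp add: Q_def poly_sum poly_monom mult.commute)
  qed
  then have sub: "ball 0 1 \<subseteq> {s. poly Q s = 0}" by auto
  have "uncountable (ball (0::complex) 1)" by (rule uncountable_ball) simp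
  then have "infinite {s. poly Q s = 0}" using infinite_super[OF sub] countable_finite by blast
  then have "Q = 0" using poly_roots_finite by blast
  have "coeff Q (\<phi> m) = (\<Sum>n | mi_abs n = k. if n = m then \<beta> m else 0)"
    unfolding Q_def coeff_sum using inj by (intro sum.cong) (auto simp: coeff_monom)
  also have "\<dots> = \<beta> m" by (subst sum.delta[OF finite_mi_abs_eq]) (simp add: m)
  finally show ?thesis using \<open>Q = 0\<close> by simp
qed

lemma ball_point:
  fixes \<zeta> :: "'d::finite \<Rightarrow> complex"
  assumes "(\<Sum>j\<in>UNIV. norm (\<zeta> j)) < 1"
  obtains z :: "'d unit_ball" where "coord z = \<zeta>"
proof
  have "norm (\<chi> j. \<zeta> j) \<le> (\<Sum>j\<in>UNIV. norm (\<zeta> j))"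
    unfolding norm_vec_def by (rule order_trans[OF L2_set_le_sum]) auto
  then show "coord (Abs_unit_ball (\<chi> j. \<zeta> j)) = \<zeta>"
    using assms by (auto simp: coord_def Abs_unit_ball_inverse)
qed

text \<open>Replacing \<open>z\<close> by \<open>t z\<close> makes the sum over each degree a coefficient of a power series in the single
  variable \<open>t\<close>; Kronecker's substitution then separates the monomials of that degree.\<close>

theorem has_power_series_unique:
  fixes c c' :: "('d::finite \<Rightarrow> nat) \<Rightarrow> 'a::complex_hilbert"
  assumes "has_power_series c f" "has_power_series c' f"
  shows "c = c'"
proof (intro ext cinner_eqI)
  fix m v
  define \<beta> where "\<beta> n = cinner (c n - c' n) v" for n
  have sum0: "((\<lambda>n. monomial z n * \<beta> n) has_sum 0) UNIV" for z
  proof -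
    have "((\<lambda>n. monomial z n *\<^sub>C c n + - (monomial z n *\<^sub>C c' n)) has_sum (f z + - f z)) UNIV"
      using assms by (intro has_sum_add) (auto simp: has_power_series_def has_sum_uminus)
    from has_sum_bounded_linear[OF bounded_linear_cinner_left this, of v]
    show ?thesis by (simp add: \<beta>_def cinner_simps right_diff_distrib)
  qed
  have "(\<Sum>n | mi_abs n = k. mpow \<zeta> n * \<beta> n) = 0" if \<zeta>: "(\<Sum>j\<in>UNIV. norm (\<zeta> j)) < 1" for k \<zeta>
  proof (rule power_series_zero[of "\<lambda>k. \<Sum>n | mi_abs n = k. mpow \<zeta> n * \<beta> n"])
    fix t :: complex assume t: "norm t < 1"
    have "(\<Sum>j\<in>UNIV. norm (t * \<zeta> j)) \<le> (\<Sum>j\<in>UNIV. norm (\<zeta> j))"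
      using t by (intro sum_mono) (simp add: norm_mult mult_left_le_one_le)
    then obtain z :: "'d unit_ball" where z: "coord z = (\<lambda>j. t * \<zeta> j)"
      using ball_point[of "\<lambda>j. t * \<zeta> j"] \<zeta> by (metis le_less_trans)
    have "monomial z n = t ^ mi_abs n * mpow \<zeta> n" for n
      unfolding monomial_eq_mpow z mpow_mult by (simp add: mpow_def mi_abs_def power_sum)
    then have "(\<Sum>n | mi_abs n = k. mpow \<zeta> n * \<beta> n) * t ^ k
        = (\<Sum>n | mi_abs n = k. monomial z n * \<beta> n)" for k
      unfolding sum_distrib_right by (intro sum.cong) auto
    then show "(\<lambda>k. (\<Sum>n | mi_abs n = k. mpow \<zeta> n * \<beta> n) * t ^ k) sums 0"
      using has_sum_degree_limit[OF sum0[of z]] by simp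
  qed
  from homogeneous_polynomial_zero[OF this refl, of m]
  show "cinner (c m) v = cinner (c' m) v" by (simp add: \<beta>_def cinner_simps)
qed

lemma power_coeff_eq:
  fixes c :: "('d::finite \<Rightarrow> nat) \<Rightarrow> 'a::complex_hilbert"
  assumes "has_power_series c f"
  shows "power_coeff f = c"
  unfolding power_coeff_def using assms has_power_series_unique by blast

section \<open>The Drury--Arveson space\<close>

lemma bounded_linear_scaleC_left: "bounded_linear (\<lambda>c. c *\<^sub>C (x::'a::complex_normed_vector))"
  by (rule bounded_linear_intro[of _ "norm x"])
     (simp_all add: scaleC_add_left norm_scaleC scaleR_scaleC scaleC_scaleC scaleR_conv_of_real)

definition da_summable :: "(('d::finite \<Rightarrow> nat) \<Rightarrow> 'y::complex_hilbert) \<Rightarrow> bool"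
  where "da_summable c \<longleftrightarrow> (\<lambda>n. da_weight n * (norm (c n))\<^sup>2) summable_on UNIV"

lemma da_term_nonneg: "0 \<le> da_weight n * (norm (c n))\<^sup>2"
  using da_weight_pos[of n] by simp

lemma da_summable_add:
  assumes "da_summable c" "da_summable d"
  shows "da_summable (\<lambda>n. c n + d n)"
  unfolding da_summable_def
proof (rule summable_on_comparison_test)
  show "(\<lambda>n. 2 * (da_weight n * (norm (c n))\<^sup>2) + 2 * (da_weight n * (norm (d n))\<^sup>2)) summable_on UNIV"
    using assms unfolding da_summable_def by (intro summable_on_add summable_on_cmult_right)
  fix n
  have "(norm (c n + d n))\<^sup>2 \<le> (norm (c n) + norm (d n))\<^sup>2"
    by (intro power_mono norm_triangle_ineq) simp
  also have "\<dots> \<le> 2 * (norm (c n))\<^sup>2 + 2 * (norm (d n))\<^sup>2"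
    using sum_squares_bound[of "norm (c n)" "norm (d n)"] by (simp add: power2_sum)
  finally show "da_weight n * (norm (c n + d n))\<^sup>2
      \<le> 2 * (da_weight n * (norm (c n))\<^sup>2) + 2 * (da_weight n * (norm (d n))\<^sup>2)"
    using mult_left_mono[of _ _ "da_weight n"] da_weight_pos[of n] by (fastforce simp: distrib_left)
qed (rule da_term_nonneg)

lemma da_summable_scale: "da_summable c \<Longrightarrow> da_summable (\<lambda>n. a *\<^sub>C c n)"
  using summable_on_cmult_right[of "\<lambda>n. da_weight n * (norm (c n))\<^sup>2" UNIV "(cmod a)\<^sup>2"]
  by (simp add: da_summable_def norm_scaleC power_mult_distrib mult_ac)

lemma da_inner_summable:
  assumes "da_summable c" "da_summable d"
  shows "(\<lambda>n. of_real (da_weight n) * cinner (c n) (d n)) summable_on UNIV"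
proof (rule abs_summable_summable, rule summable_on_comparison_test)
  show "(\<lambda>n. da_weight n * (norm (c n))\<^sup>2 + da_weight n * (norm (d n))\<^sup>2) summable_on UNIV"
    using assms unfolding da_summable_def by (intro summable_on_add)
  fix n
  have "cmod (cinner (c n) (d n)) \<le> (norm (c n))\<^sup>2 + (norm (d n))\<^sup>2"
    using cinner_Cauchy_Schwarz[of "c n" "d n"] sum_squares_bound[of "norm (c n)" "norm (d n)"]
      mult_nonneg_nonneg[OF norm_ge_zero[of "c n"] norm_ge_zero[of "d n"]] by linarith
  then show "norm (of_real (da_weight n) * cinner (c n) (d n))
      \<le> da_weight n * (norm (c n))\<^sup>2 + da_weight n * (norm (d n))\<^sup>2"
    using da_weight_pos[of n] by (simp add: norm_mult flip: distrib_left)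
qed simp

lemma sum_coord_sq_less_1: "(\<Sum>j\<in>UNIV. (cmod (coord z j))\<^sup>2) < 1"
proof -
  have "norm (Rep_unit_ball z) < 1" using Rep_unit_ball[of z] by simp
  then have "(norm (Rep_unit_ball z))\<^sup>2 < 1" by (simp add: power_less_one_iff)
  then show ?thesis by (simp add: norm_vec_def L2_set_def sum_nonneg coord_def)
qed

lemma sum_coord_prod_less_1: "(\<Sum>j\<in>UNIV. cmod (coord z j * cnj (coord w j))) < 1"
proof -
  have "(\<Sum>j\<in>UNIV. cmod (coord z j * cnj (coord w j)))
      \<le> (\<Sum>j\<in>UNIV. ((cmod (coord z j))\<^sup>2 + (cmod (coord w j))\<^sup>2) / 2)"
  proof (rule sum_mono)
    show "cmod (coord z j * cnj (coord w j)) \<le> ((cmod (coord z j))\<^sup>2 + (cmod (coord w j))\<^sup>2) / 2" for j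
      using sum_squares_bound[of "cmod (coord z j)" "cmod (coord w j)"] by (simp add: norm_mult)
  qed
  also have "\<dots> < 1"
    using sum_coord_sq_less_1[of z] sum_coord_sq_less_1[of w]
    by (simp add: sum.distrib flip: sum_divide_distrib)
  finally show ?thesis .
qed

lemma ball_inner_neq_1: "1 - ball_inner z w \<noteq> 0"
proof
  assume "1 - ball_inner z w = 0"
  then have "ball_inner z w = 1" by simp
  then have "1 \<le> (\<Sum>j\<in>UNIV. cmod (coord z j * cnj (coord w j)))"
    using norm_sum[of "\<lambda>j. coord z j * cnj (coord w j)" UNIV] by (simp add: ball_inner_def)
  then show False using sum_coord_prod_less_1[of z w] by simp
qed

lemma monomial_sq_summable: "(\<lambda>n. multinom n * (cmod (monomial z n))\<^sup>2) summable_on UNIV"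
proof -
  have "mpow (\<lambda>j. norm (coord z j * cnj (coord z j))) n = (cmod (monomial z n))\<^sup>2" for n
    by (simp add: norm_mult mpow_mult monomial_eq_mpow norm_mpow power2_eq_square)
  then show ?thesis
    using multinomial_series(2)[OF sum_coord_prod_less_1[of z z]] by simp
qed

text \<open>The weight of a coefficient and the multinomial coefficient are reciprocal, so by the inequality of
  the means each term is dominated by a term of the square sum plus one of the multinomial series.\<close>

lemma da_summable_has_power_series:
  fixes c :: "('d::finite \<Rightarrow> nat) \<Rightarrow> 'y::complex_hilbert"
  assumes c: "da_summable c"
  obtains f where "has_power_series c f"
proof -
  have "(\<lambda>n. monomial z n *\<^sub>C c n) summable_on UNIV" for z :: "'d unit_ball"
  proof (rule abs_summable_summable, rule summable_on_comparison_test)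
    show "(\<lambda>n. multinom n * (cmod (monomial z n))\<^sup>2 + da_weight n * (norm (c n))\<^sup>2) summable_on UNIV"
      using monomial_sq_summable c unfolding da_summable_def by (rule summable_on_add)
    fix n
    let ?a = "sqrt (multinom n) * cmod (monomial z n)" and ?b = "sqrt (da_weight n) * norm (c n)"
    have "norm (monomial z n *\<^sub>C c n) = ?a * ?b"
      using da_weight_multinom[of n]
      by (simp add: norm_scaleC real_sqrt_mult[symmetric] mult.commute mult.left_commute)
    also have "\<dots> \<le> ?a\<^sup>2 + ?b\<^sup>2"
    proof -
      have "0 \<le> ?a * ?b" using multinom_pos[of n] da_weight_pos[of n] by simp
      then show ?thesis using sum_squares_bound[of ?a ?b] by linarith
    qed
    also have "\<dots> = multinom n * (cmod (monomial z n))\<^sup>2 + da_weight n * (norm (c n))\<^sup>2"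
      using multinom_pos[of n] da_weight_pos[of n] by (simp add: power_mult_distrib)
    finally show "norm (monomial z n *\<^sub>C c n) \<le> \<dots>" .
  qed simp
  then have "has_power_series c (\<lambda>z. \<Sum>\<^sub>\<infinity>n. monomial z n *\<^sub>C c n)"
    unfolding has_power_series_def by simp
  then show ?thesis by (rule that)
qed

lemma drury_arvesonI: "has_power_series c f \<Longrightarrow> da_summable c \<Longrightarrow> f \<in> drury_arveson"
  unfolding drury_arveson_def da_summable_def by blast

lemma drury_arvesonD:
  assumes "f \<in> drury_arveson"
  shows "has_power_series (power_coeff f) f" and "da_summable (power_coeff f)"
  using assms power_coeff_eq unfolding drury_arveson_def da_summable_def by force+

lemma has_power_series_add:
  "has_power_series c f \<Longrightarrow> has_power_series d g \<Longrightarrow>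
    has_power_series (\<lambda>n. c n + d n) (\<lambda>z. f z + g z)"
  unfolding has_power_series_def by (simp add: scaleC_add_right has_sum_add)

lemma has_power_series_scale:
  "has_power_series c f \<Longrightarrow> has_power_series (\<lambda>n. a *\<^sub>C c n) (\<lambda>z. a *\<^sub>C f z)"
  unfolding has_power_series_def
proof
  fix z assume "\<forall>z. ((\<lambda>n. monomial z n *\<^sub>C c n) has_sum f z) UNIV"
  then have "((\<lambda>n. a *\<^sub>C (monomial z n *\<^sub>C c n)) has_sum a *\<^sub>C f z) UNIV"
    by (intro has_sum_bounded_linear[OF bounded_linear_scaleC_right]) auto
  then show "((\<lambda>n. monomial z n *\<^sub>C a *\<^sub>C c n) has_sum a *\<^sub>C f z) UNIV"
    by (simp add: scaleC_scaleC mult.commute)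
qed

lemma has_power_series_zero: "has_power_series (\<lambda>_. 0) (\<lambda>_. 0)"
  by (simp add: has_power_series_def)

lemma da_inner_self:
  "da_inner f f = of_real (\<Sum>\<^sub>\<infinity>n. da_weight n * (norm (power_coeff f n))\<^sup>2)"
proof -
  have "da_inner f f = (\<Sum>\<^sub>\<infinity>n. complex_of_real (da_weight n * (norm (power_coeff f n))\<^sup>2))"
    by (simp add: da_inner_def cinner_self)
  also have "\<dots> = of_real (\<Sum>\<^sub>\<infinity>n. da_weight n * (norm (power_coeff f n))\<^sup>2)"
    by (intro infsum_bounded_linear_strong bounded_linear_of_real
        summable_on_bounded_linear_iff[OF bounded_linear_of_real bounded_linear_Re]) simp
  finally show ?thesis .
qed

lemma ip_norm_da_inner: "ip_norm da_inner = da_norm"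
  by (rule ext) (simp add: ip_norm_def da_inner_self da_norm_def)

lemma da_norm_sq: "(da_norm f)\<^sup>2 = (\<Sum>\<^sub>\<infinity>n. da_weight n * (norm (power_coeff f n))\<^sup>2)"
  by (simp add: da_norm_def infsum_nonneg da_term_nonneg)

text \<open>The space is a weighted \<open>\<ell>\<^sup>2\<close> space of coefficient families; only its completeness is not
  immediate.\<close>

lemma function_hilbert_space_drury_arveson:
  "function_hilbert_space (drury_arveson :: ('d::finite unit_ball \<Rightarrow> 'y::complex_hilbert) set) da_inner"
proof
  show "(\<lambda>_. 0) \<in> (drury_arveson :: ('d unit_ball \<Rightarrow> 'y) set)"
    by (rule drury_arvesonI[OF has_power_series_zero]) (simp add: da_summable_def)
  fix f :: "'d unit_ball \<Rightarrow> 'y" assume f: "f \<in> drury_arveson"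
  note f' = drury_arvesonD[OF f]
  show "(\<lambda>p. c *\<^sub>C f p) \<in> drury_arveson" for c
    by (rule drury_arvesonI[OF has_power_series_scale[OF f'(1)] da_summable_scale[OF f'(2)]])
  show "0 \<le> Re (da_inner f f)" by (simp add: da_inner_self infsum_nonneg da_term_nonneg)
  show "f = (\<lambda>_. 0)" if "da_inner f f = 0"
  proof -
    have 0: "(\<Sum>\<^sub>\<infinity>n. da_weight n * (norm (power_coeff f n))\<^sup>2) \<le> 0"
      using that by (simp add: da_inner_self)
    have nonneg: "0 \<le> da_weight n * (norm (power_coeff f n))\<^sup>2" for n by (rule da_term_nonneg)
    have "power_coeff f n = 0" for n
      using nonneg_infsum_le_0D[OF 0 _ nonneg, of n] f'(2) da_weight_pos[of n]
      by (simp add: da_summable_def)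
    then have "has_power_series (\<lambda>_. 0) f" using f'(1) by (metis ext)
    then show ?thesis using has_power_series_zero
      unfolding has_power_series_def by (metis ext has_sum_unique)
  qed
  fix g :: "'d unit_ball \<Rightarrow> 'y" assume g: "g \<in> drury_arveson"
  note g' = drury_arvesonD[OF g]
  show "(\<lambda>p. f p + g p) \<in> drury_arveson"
    by (rule drury_arvesonI[OF has_power_series_add[OF f'(1) g'(1)] da_summable_add[OF f'(2) g'(2)]])
  show "da_inner f g = cnj (da_inner g f)"
    unfolding da_inner_def infsum_cnj[symmetric]
    by (intro infsum_cong) (simp flip: cinner_commute)
  show "da_inner (\<lambda>p. c *\<^sub>C f p) g = c * da_inner f g" for c
    unfolding da_inner_def power_coeff_eq[OF has_power_series_scale[OF f'(1)]]
    using infsum_cmult_right[OF da_inner_summable[OF f'(2) g'(2)], of c]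
    by (simp add: cinner_simps mult_ac)
  fix k :: "'d unit_ball \<Rightarrow> 'y" assume k: "k \<in> drury_arveson"
  note k' = drury_arvesonD[OF k]
  show "da_inner (\<lambda>p. f p + g p) k = da_inner f k + da_inner g k"
    unfolding da_inner_def power_coeff_eq[OF has_power_series_add[OF f'(1) g'(1)]]
    using infsum_add[OF da_inner_summable[OF f'(2) k'(2)] da_inner_summable[OF g'(2) k'(2)]]
    by (simp add: cinner_simps distrib_left)
next
  fix s :: "nat \<Rightarrow> 'd unit_ball \<Rightarrow> 'y"
  assume s: "\<And>i. s i \<in> drury_arveson"
    and Cauchy: "\<And>e. e > 0 \<Longrightarrow> \<exists>n. \<forall>i\<ge>n. \<forall>j\<ge>n. ip_norm da_inner (\<lambda>p. s i p - s j p) < e"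
  define c where "c i = power_coeff (s i)" for i
  have c: "has_power_series (c i) (s i)" "da_summable (c i)" for i
    using drury_arvesonD[OF s] by (simp_all add: c_def)
  have diff: "has_power_series (\<lambda>n. a n - b n) (\<lambda>z. f z - g z)" "da_summable a \<Longrightarrow> da_summable b \<Longrightarrow>
      da_summable (\<lambda>n. a n - b n)"
    if "has_power_series a f" "has_power_series b g"
    for a b :: "('d \<Rightarrow> nat) \<Rightarrow> 'y" and f g :: "'d unit_ball \<Rightarrow> 'y"
    using has_power_series_add[OF that(1) has_power_series_scale[OF that(2), of "- 1"]]
      da_summable_add[of a, OF _ da_summable_scale[of b "- 1"]]
    by (simp_all add: scaleC_minus_one)
  \<comment> \<open>Finite partial sums of the squared norm of a difference are bounded by the full sum, and
    unlike the full sum they visibly pass to the coefficientwise limit.\<close>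
  let ?w = "\<lambda>F c d. \<Sum>n\<in>F. da_weight n * (norm (c n - d n :: 'y))\<^sup>2"
  have partial: "?w F (c i) (c j) \<le> (ip_norm da_inner (\<lambda>p. s i p - s j p))\<^sup>2"
    if "finite F" for F i j
    unfolding ip_norm_da_inner da_norm_sq power_coeff_eq[OF diff(1)[OF c(1) c(1)]]
    using diff(2)[OF c(1) c(1) c(2) c(2), of i j] that unfolding da_summable_def
    by (intro finite_sum_le_infsum) (auto intro: da_term_nonneg)
  have "Cauchy (\<lambda>i. c i n)" for n
  proof (rule CauchyI)
    fix e :: real assume e: "e > 0"
    define e' where "e' = sqrt (da_weight n) * e"
    have e': "e' > 0" using e da_weight_pos[of n] by (simp add: e'_def)
    obtain N where N: "\<And>i j. i \<ge> N \<Longrightarrow> j \<ge> N \<Longrightarrow> ip_norm da_inner (\<lambda>p. s i p - s j p) < e'"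
      using Cauchy[OF e'] by blast
    have "norm (c i n - c j n) < e" if "i \<ge> N" "j \<ge> N" for i j
    proof -
      have "da_weight n * (norm (c i n - c j n))\<^sup>2 \<le> (ip_norm da_inner (\<lambda>p. s i p - s j p))\<^sup>2"
        using partial[of "{n}" i j] by simp
      also have "\<dots> < e'\<^sup>2"
        using N[OF that] by (intro power_strict_mono) (auto simp: ip_norm_da_inner da_norm_def infsum_nonneg da_term_nonneg)
      also have "\<dots> = da_weight n * e\<^sup>2" using da_weight_pos[of n] by (simp add: e'_def power_mult_distrib)
      finally have "(norm (c i n - c j n))\<^sup>2 < e\<^sup>2" using da_weight_pos[of n] by simp
      then show ?thesis using e by (simp add: power2_less_imp_less)
    qed
    then show "\<exists>N. \<forall>i\<ge>N. \<forall>j\<ge>N. norm (c i n - c j n) < e" by blast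
  qed
  then have "\<exists>v. (\<lambda>i. c i n) \<longlonglongrightarrow> v" for n using Cauchy_convergent convergentD by blast
  then obtain d where d: "\<And>n. (\<lambda>i. c i n) \<longlonglongrightarrow> d n" by metis
  have close: "\<exists>N. \<forall>i\<ge>N. \<forall>F. finite F \<longrightarrow> ?w F (c i) d \<le> e\<^sup>2"
    if e: "e > 0" for e
  proof -
    obtain N where N: "\<And>i j. i \<ge> N \<Longrightarrow> j \<ge> N \<Longrightarrow> ip_norm da_inner (\<lambda>p. s i p - s j p) < e"
      using Cauchy[OF e] by blast
    have "?w F (c i) d \<le> e\<^sup>2" if F: "finite F" and i: "i \<ge> N" for F i
    proof (rule LIMSEQ_le_const2)
      show "(\<lambda>j. ?w F (c i) (c j)) \<longlonglongrightarrow> ?w F (c i) d"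
        by (intro tendsto_intros d)
      have "?w F (c i) (c j) \<le> e\<^sup>2" if "j \<ge> N" for j
        using order_trans[OF partial[OF F] power_mono] N[OF i that]
        by (fastforce simp: ip_norm_da_inner da_norm_def infsum_nonneg da_term_nonneg)
      then show "\<exists>N. \<forall>j\<ge>N. ?w F (c i) (c j) \<le> e\<^sup>2" by blast
    qed
    then show ?thesis by blast
  qed
  have cd: "da_summable (\<lambda>n. c i n - d n)"
    if "\<forall>F. finite F \<longrightarrow> ?w F (c i) d \<le> e\<^sup>2" for i e
    unfolding da_summable_def using that
    by (intro nonneg_bdd_above_summable_on da_term_nonneg) (auto intro!: bdd_aboveI2[of _ _ "e\<^sup>2"])
  obtain N where N: "\<forall>F. finite F \<longrightarrow> ?w F (c N) d \<le> 1\<^sup>2"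
    using close[of 1] by auto
  have "da_summable (\<lambda>n. c N n + (- 1) *\<^sub>C (c N n - d n))"
    by (intro da_summable_add da_summable_scale c(2) cd[OF N])
  then have dsum: "da_summable d" by (simp add: scaleC_minus_one)
  obtain f where f: "has_power_series d f" using da_summable_has_power_series[OF dsum] by blast
  have "(\<lambda>i. ip_norm da_inner (\<lambda>p. s i p - f p)) \<longlonglongrightarrow> 0"
  proof (rule LIMSEQ_I)
    fix e :: real assume e: "e > 0"
    obtain N where N: "\<And>i F. i \<ge> N \<Longrightarrow> finite F \<Longrightarrow> ?w F (c i) d \<le> (e/2)\<^sup>2"
      using close[of "e/2"] e by auto
    have "norm (ip_norm da_inner (\<lambda>p. s i p - f p) - 0) < e" if i: "i \<ge> N" for i
    proof -
      have "(da_norm (\<lambda>p. s i p - f p))\<^sup>2 \<le> (e/2)\<^sup>2"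
        unfolding da_norm_sq power_coeff_eq[OF diff(1)[OF c(1) f]]
      proof (rule infsum_le_finite_sums)
        have "da_summable (\<lambda>n. c i n - d n)" using cd N[OF i] by blast
        then show "(\<lambda>n. da_weight n * (norm (c i n - d n))\<^sup>2) summable_on UNIV"
          by (simp only: da_summable_def)
      qed (rule N[OF i])
      then have "da_norm (\<lambda>p. s i p - f p) \<le> e/2" by (rule power2_le_imp_le) (use e in simp)
      moreover have "0 \<le> da_norm (\<lambda>p. s i p - f p)"
        by (simp add: da_norm_def infsum_nonneg da_term_nonneg)
      ultimately show ?thesis using e by (simp add: ip_norm_da_inner)
    qed
    then show "\<exists>N. \<forall>i\<ge>N. norm (ip_norm da_inner (\<lambda>p. s i p - f p) - 0) < e" by blast
  qed
  then show "\<exists>f\<in>drury_arveson. (\<lambda>i. ip_norm da_inner (\<lambda>p. s i p - f p)) \<longlonglongrightarrow> 0"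
    using drury_arvesonI[OF f dsum] by blast
qed

definition da_kernel :: "'d::finite unit_ball \<Rightarrow> 'd unit_ball \<Rightarrow> ('y::complex_hilbert \<Rightarrow>\<^sub>L 'y)"
  where "da_kernel z w = (1 / (1 - ball_inner z w)) *\<^sub>C id_blinfun"

lemma da_kernel_apply: "da_kernel z w y = (1 / (1 - ball_inner z w)) *\<^sub>C y"
  by (simp add: da_kernel_def scaleC_blinfun.rep_eq)

lemma da_kernel_series:
  fixes y :: "'y::complex_hilbert" and w :: "'d::finite unit_ball"
  defines "\<kappa> \<equiv> \<lambda>n. (of_real (multinom n) * cnj (monomial w n)) *\<^sub>C y"
  shows "has_power_series \<kappa> (\<lambda>z. da_kernel z w y)" and "da_summable \<kappa>"
proof -
  show "has_power_series \<kappa> (\<lambda>z. da_kernel z w y)"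
    unfolding has_power_series_def
  proof
    fix z :: "'d unit_ball"
    have "mpow (\<lambda>j. coord z j * cnj (coord w j)) n = monomial z n * cnj (monomial w n)" for n
      unfolding mpow_mult by (simp add: monomial_eq_mpow mpow_def cnj_prod)
    then show "((\<lambda>n. monomial z n *\<^sub>C \<kappa> n) has_sum da_kernel z w y) UNIV"
      using has_sum_bounded_linear[OF bounded_linear_scaleC_left
          multinomial_series(1)[OF sum_coord_prod_less_1[of z w]], of y]
      by (simp add: \<kappa>_def da_kernel_apply ball_inner_def scaleC_scaleC mult_ac)
  qed
  have "da_weight n * (norm (\<kappa> n))\<^sup>2 = multinom n * (cmod (monomial w n))\<^sup>2 * (norm y)\<^sup>2" for n
  proof -
    have "da_weight n * (norm (\<kappa> n))\<^sup>2
        = (da_weight n * multinom n) * (multinom n * (cmod (monomial w n))\<^sup>2 * (norm y)\<^sup>2)"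
      using multinom_pos[of n]
      by (simp add: \<kappa>_def norm_scaleC norm_mult power_mult_distrib power2_eq_square mult_ac
          del: da_weight_multinom)
    then show ?thesis by simp
  qed
  then show "da_summable \<kappa>"
    unfolding da_summable_def by (simp add: summable_on_cmult_left[OF monomial_sq_summable])
qed

lemma rkhs_drury_arveson:
  "rkhs da_kernel (drury_arveson :: ('d::finite unit_ball \<Rightarrow> 'y::complex_hilbert) set) da_inner"
proof (intro rkhs.intro function_hilbert_space_drury_arveson rkhs_axioms.intro)
  show "(\<lambda>z. da_kernel z w y) \<in> drury_arveson" for w :: "'d unit_ball" and y :: 'y
    by (rule drury_arvesonI[OF da_kernel_series])
  fix f :: "'d unit_ball \<Rightarrow> 'y" and w y assume "f \<in> drury_arveson"
  then have "((\<lambda>n. monomial w n *\<^sub>C power_coeff f n) has_sum f w) UNIV"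
    using drury_arvesonD(1) by (auto simp: has_power_series_def)
  from has_sum_bounded_linear[OF bounded_linear_cinner_left this, of y]
  have "((\<lambda>n. monomial w n * cinner (power_coeff f n) y) has_sum cinner (f w) y) UNIV"
    by (simp add: cinner_simps)
  moreover have "of_real (da_weight n) *
      cinner (power_coeff f n) ((of_real (multinom n) * cnj (monomial w n)) *\<^sub>C y)
      = monomial w n * cinner (power_coeff f n) y" for n
  proof -
    have "of_real (da_weight n) * cinner (power_coeff f n) ((of_real (multinom n) * cnj (monomial w n)) *\<^sub>C y)
        = of_real (da_weight n * multinom n) * (monomial w n * cinner (power_coeff f n) y)"
      by (simp add: cinner_simps mult_ac del: da_weight_multinom)
    then show ?thesis by simp
  qed
  ultimately show "da_inner f (\<lambda>z. da_kernel z w y) = cinner (f w) y"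
    unfolding da_inner_def power_coeff_eq[OF da_kernel_series(1)] by (simp add: infsumI)
qed

text \<open>The kernel decomposition \<open>k I = K\<^sub>S + S k S\<^sup>*\<close> exhibits \<open>H(k)\<close> as the image of
  \<open>H(S) \<oplus> H(k)\<close> under \<open>(f, g) \<mapsto> f + S g\<close>; hence \<open>H(S)\<close> is contractively contained in it.\<close>

theorem deBranges_Rovnyak_subset_drury_arveson:
  fixes S :: "'d::finite unit_ball \<Rightarrow> 'u::complex_hilbert \<Rightarrow>\<^sub>L 'y::complex_hilbert"
  assumes S: "\<And>z. complex_linear (S z)" and HS: "rkhs (deBranges_Rovnyak_kernel S) HS ipS"
    and f: "f \<in> HS"
  shows "f \<in> drury_arveson" and "da_norm f \<le> ip_norm ipS f"
proof -
  interpret HS: rkhs "deBranges_Rovnyak_kernel S" HS ipS by fact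
  interpret DY: rkhs da_kernel "drury_arveson :: ('d unit_ball \<Rightarrow> 'y) set" da_inner
    by (rule rkhs_drury_arveson)
  interpret DU: rkhs da_kernel "drury_arveson :: ('d unit_ball \<Rightarrow> 'u) set" da_inner
    by (rule rkhs_drury_arveson)
  interpret G: function_hilbert_space "dsum HS (drury_arveson :: ('d unit_ball \<Rightarrow> 'u) set)" "dsum_ip ipS da_inner"
    by (rule function_hilbert_space_dsum[OF HS.function_hilbert_space_axioms DU.function_hilbert_space_axioms])
  define \<phi> where "\<phi> w y = (\<lambda>z. (deBranges_Rovnyak_kernel S z w y, da_kernel z w (adj (S w) y)))" for w y
  define \<Gamma> where "\<Gamma> F = (\<lambda>z. fst (F z) + S z (snd (F z)))" for F :: "'d unit_ball \<Rightarrow> 'y \<times> 'u"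
  interpret feature_map da_kernel "drury_arveson :: ('d unit_ball \<Rightarrow> 'y) set" da_inner
    "dsum HS drury_arveson" "dsum_ip ipS da_inner" \<phi> \<Gamma>
  proof
    show "\<phi> w y \<in> dsum HS drury_arveson" for w y
      by (simp add: \<phi>_def dsum_def HS.kernel_mem DU.kernel_mem)
    show "cinner (\<Gamma> g w) y = dsum_ip ipS da_inner g (\<phi> w y)" if "g \<in> dsum HS drury_arveson" for g w y
      using that by (simp add: \<phi>_def \<Gamma>_def dsum_def dsum_ip_def HS.reproducing DU.reproducing cinner_simps
          adj_cinner[OF S])
    show "\<Gamma> (\<phi> q y) = (\<lambda>w. da_kernel w q y)" for q y
      by (simp add: \<phi>_def \<Gamma>_def deBranges_Rovnyak_kernel_def scaleC_blinfun.rep_eq blinfun.diff_left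
          da_kernel_apply complex_linearD[OF S] scaleC_diff_right)
  qed
  define F where "F = (\<lambda>z. (f z, 0 :: 'u))"
  have F: "F \<in> dsum HS drury_arveson" using f DU.zero_mem by (simp add: F_def dsum_def)
  have \<Gamma>F: "\<Gamma> F = f" by (simp add: F_def \<Gamma>_def)
  show "f \<in> drury_arveson" using Gamma_mem[OF F] \<Gamma>F by simp
  have "G.nrm F = ip_norm ipS f"
    using DU.ip_zero_l[OF DU.zero_in] by (simp add: ip_norm_def dsum_ip_def F_def zero_fun_def)
  then show "da_norm f \<le> ip_norm ipS f"
    using nrm_Gamma_le[OF F] \<Gamma>F by (simp add: ip_norm_da_inner)
qed

section \<open>Multiplication by the coordinate functions\<close>

definition coord_mult :: "'d::finite \<Rightarrow> ('d unit_ball \<Rightarrow> 'y::complex_hilbert) \<Rightarrow> ('d unit_ball \<Rightarrow> 'y)"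
  where "coord_mult j f = (\<lambda>z. coord z j *\<^sub>C f z)"

lemma has_power_series_coord_mult:
  fixes f :: "'d::finite unit_ball \<Rightarrow> 'y::complex_hilbert"
  assumes f: "has_power_series c f" and shift: "\<And>n. d (n + mi_unit j) = c n" "\<And>n. n j = 0 \<Longrightarrow> d n = 0"
  shows "has_power_series d (coord_mult j f)"
  unfolding has_power_series_def
proof
  fix z
  have "((\<lambda>n. coord z j *\<^sub>C (monomial z n *\<^sub>C c n)) has_sum coord z j *\<^sub>C f z) UNIV"
    using f unfolding has_power_series_def
    by (intro has_sum_bounded_linear[OF bounded_linear_scaleC_right]) auto
  then have "(((\<lambda>n. monomial z n *\<^sub>C d n) \<circ> (\<lambda>n. n + mi_unit j)) has_sum coord_mult j f z) UNIV"
    by (simp add: o_def shift monomial_eq_mpow mpow_add_unit scaleC_scaleC coord_mult_def)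
  then have "((\<lambda>n. monomial z n *\<^sub>C d n) has_sum coord_mult j f z) (range (\<lambda>n. n + mi_unit j))"
    by (subst has_sum_reindex[OF inj_add_unit])
  then show "((\<lambda>n. monomial z n *\<^sub>C d n) has_sum coord_mult j f z) UNIV"
    by (rule has_sum_cong_neutral[THEN iffD1, rotated -1]) (auto simp: range_add_unit shift)
qed

lemma coord_mult_drury_arveson:
  fixes f :: "'d::finite unit_ball \<Rightarrow> 'y::complex_hilbert"
  assumes f: "f \<in> drury_arveson"
  shows "coord_mult j f \<in> drury_arveson"
    and "power_coeff (coord_mult j f) (n + mi_unit j) = power_coeff f n"
    and "n j = 0 \<Longrightarrow> power_coeff (coord_mult j f) n = 0"
proof -
  define c where "c = power_coeff f"
  have c: "has_power_series c f" "da_summable c" using drury_arvesonD[OF f] by (simp_all add: c_def)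
  define d where "d n = (if n j = 0 then 0 else c (\<lambda>i. n i - mi_unit j i))" for n
  have shift: "d (n + mi_unit j) = c n" "n j = 0 \<Longrightarrow> d n = 0" for n
    by (auto simp: d_def mi_unit_def)
  have series: "has_power_series d (coord_mult j f)"
    by (rule has_power_series_coord_mult[OF c(1)]) (auto simp: shift)
  have "(\<lambda>n. da_weight (n + mi_unit j) * (norm (c n))\<^sup>2) summable_on UNIV"
    using c(2) unfolding da_summable_def
    by (rule summable_on_comparison_test)
       (auto intro!: mult_right_mono da_weight_add_unit_le mult_nonneg_nonneg less_imp_le[OF da_weight_pos])
  then have "((\<lambda>n. da_weight n * (norm (d n))\<^sup>2) \<circ> (\<lambda>n. n + mi_unit j)) summable_on UNIV"
    by (simp add: o_def shift)
  then have "(\<lambda>n. da_weight n * (norm (d n))\<^sup>2) summable_on range (\<lambda>n. n + mi_unit j)"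
    by (subst summable_on_reindex[OF inj_add_unit])
  then have "da_summable d"
    unfolding da_summable_def
    by (rule summable_on_cong_neutral[THEN iffD1, rotated -1]) (auto simp: range_add_unit shift)
  then show "coord_mult j f \<in> drury_arveson" by (rule drury_arvesonI[OF series])
  show "power_coeff (coord_mult j f) (n + mi_unit j) = power_coeff f n"
    and "n j = 0 \<Longrightarrow> power_coeff (coord_mult j f) n = 0"
    unfolding power_coeff_eq[OF series] by (auto simp: shift c_def)
qed

section \<open>Powers of commuting tuples\<close>

lemma mi_induct [case_names zero add_unit]:
  fixes n :: "'d::finite \<Rightarrow> nat"
  assumes "P 0" "\<And>n j. P n \<Longrightarrow> P (n + mi_unit j)"
  shows "P n"
proof (induction "mi_abs n" arbitrary: n)
  case 0
  then show ?case using assms(1) by (metis mi_abs_eq_0)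
next
  case (Suc k)
  then have "n \<noteq> 0" by auto
  then obtain j where "0 < n j" by (auto simp: fun_eq_iff)
  then obtain m where m: "n = m + mi_unit j" using range_add_unit[of j] by blast
  then show ?case using Suc assms(2) by simp
qed

context
  fixes T :: "'d::finite \<Rightarrow> 'x::complex_hilbert \<Rightarrow>\<^sub>L 'x"
  assumes T_comm: "commuting_tuple T"
begin

lemma commuting_apply: "T i (T j x) = T j (T i x)"
  using T_comm unfolding commuting_tuple_def by (metis blinfun_apply_blinfun_compose)

lemma tuple_power_comp_fun_commute: "comp_fun_commute (\<lambda>j. ((o\<^sub>L) (T j)) ^^ n j)"
proof -
  interpret comp_fun_commute "\<lambda>j. (o\<^sub>L) (T j)"
    by standard (auto simp: fun_eq_iff commuting_apply intro!: blinfun_eqI)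
  show ?thesis by (rule comp_fun_commute_funpow)
qed

lemma tuple_power_zero: "tuple_power T 0 = id_blinfun"
proof -
  have "Finite_Set.fold (\<lambda>j. (o\<^sub>L) (T j) ^^ (0 :: 'd \<Rightarrow> nat) j) id_blinfun A = id_blinfun" if "finite A" for A
    using that
  proof induction
    case (insert j A)
    interpret comp_fun_commute "\<lambda>j. ((o\<^sub>L) (T j)) ^^ (0 :: 'd \<Rightarrow> nat) j" by (rule tuple_power_comp_fun_commute)
    show ?case using fold_insert[OF insert.hyps, of id_blinfun] insert.IH by (simp add: id_def)
  qed simp
  from this[of UNIV] show ?thesis unfolding tuple_power_def by simp
qed

lemma tuple_power_add_unit: "tuple_power T (n + mi_unit j) = T j o\<^sub>L tuple_power T n"
proof -
  interpret a: comp_fun_commute "\<lambda>i. ((o\<^sub>L) (T i)) ^^ n i" by (rule tuple_power_comp_fun_commute)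
  interpret b: comp_fun_commute "\<lambda>i. ((o\<^sub>L) (T i)) ^^ (n + mi_unit j) i" by (rule tuple_power_comp_fun_commute)
  have eq: "Finite_Set.fold (\<lambda>i. ((o\<^sub>L) (T i)) ^^ (n + mi_unit j) i) id_blinfun A
      = Finite_Set.fold (\<lambda>i. ((o\<^sub>L) (T i)) ^^ n i) id_blinfun A" if "finite A" "j \<notin> A" for A
    using that
  proof induction
    case (insert i A)
    then have "(n + mi_unit j) i = n i" by (auto simp: mi_unit_def)
    then show ?case using insert by (simp del: plus_fun_apply)
  qed simp
  have j: "(n + mi_unit j) j = Suc (n j)" by (simp add: mi_unit_def)
  have "tuple_power T (n + mi_unit j)
      = (((o\<^sub>L) (T j)) ^^ (n + mi_unit j) j) (Finite_Set.fold (\<lambda>i. ((o\<^sub>L) (T i)) ^^ (n + mi_unit j) i) id_blinfun (UNIV - {j}))"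
    unfolding tuple_power_def by (rule b.fold_rec) auto
  also have "\<dots> = T j o\<^sub>L (((o\<^sub>L) (T j)) ^^ n j) (Finite_Set.fold (\<lambda>i. ((o\<^sub>L) (T i)) ^^ n i) id_blinfun (UNIV - {j}))"
    unfolding j by (subst eq) auto
  also have "(((o\<^sub>L) (T j)) ^^ n j) (Finite_Set.fold (\<lambda>i. ((o\<^sub>L) (T i)) ^^ n i) id_blinfun (UNIV - {j}))
      = tuple_power T n"
    unfolding tuple_power_def by (rule a.fold_rec[symmetric]) auto
  finally show ?thesis .
qed

lemma tuple_power_add_unit_apply: "tuple_power T (n + mi_unit j) x = tuple_power T n (T j x)"
proof -
  have "tuple_power T n (T j x) = T j (tuple_power T n x)"
    by (induction n rule: mi_induct)
       (simp_all add: tuple_power_zero tuple_power_add_unit commuting_apply[of j]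
         del: zero_fun_apply plus_fun_apply)
  then show ?thesis by (simp add: tuple_power_add_unit)
qed

lemma complex_linear_tuple_power:
  "(\<And>j. complex_linear (T j)) \<Longrightarrow> complex_linear (tuple_power T n)"
  by (induction n rule: mi_induct)
     (simp_all add: tuple_power_zero tuple_power_add_unit complex_linear_id complex_linear_compose
       del: zero_fun_apply plus_fun_apply)

end

section \<open>Output stable pairs\<close>

lemma has_power_series_monomial:
  "has_power_series (\<lambda>m. if m = n then v else 0) (\<lambda>z. monomial z n *\<^sub>C (v::'y::complex_hilbert))"
  unfolding has_power_series_def
proof
  fix z :: "'a unit_ball"
  have "((\<lambda>m. monomial z m *\<^sub>C (if m = n then v else 0)) has_sum monomial z n *\<^sub>C v) {n}"
    by (rule has_sum_finiteI) auto
  then show "((\<lambda>m. monomial z m *\<^sub>C (if m = n then v else 0)) has_sum monomial z n *\<^sub>C v) UNIV"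
    by (rule has_sum_cong_neutral[THEN iffD1, rotated -1]) auto
qed

lemma da_summable_monomial: "da_summable (\<lambda>m. if m = n then v else 0)"
  unfolding da_summable_def
  by (rule finite_nonzero_values_imp_summable_on) (rule finite_subset[of _ "{n}"], auto)

lemma monomial_drury_arveson:
  "(\<lambda>z. monomial z n *\<^sub>C (v::'y::complex_hilbert)) \<in> drury_arveson"
  by (rule drury_arvesonI[OF has_power_series_monomial da_summable_monomial])

lemma constant_as_monomial: "(\<lambda>z. v) = (\<lambda>z. monomial z 0 *\<^sub>C (v::'y::complex_hilbert))"
  by (simp add: monomial_eq_mpow scaleC_one)

lemma constant_drury_arveson: "(\<lambda>z. v::'y::complex_hilbert) \<in> drury_arveson"
  unfolding constant_as_monomial by (rule monomial_drury_arveson)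

interpretation DA: rkhs da_kernel "drury_arveson :: ('d::finite unit_ball \<Rightarrow> 'y::complex_hilbert) set" da_inner
  by (rule rkhs_drury_arveson)

lemma has_power_series_function_unique:
  "has_power_series c f \<Longrightarrow> has_power_series c g \<Longrightarrow> f = g"
  unfolding has_power_series_def by (intro ext) (blast intro: has_sum_unique)

locale output_pair =
  fixes E :: "'x::complex_hilbert \<Rightarrow>\<^sub>L 'y::complex_hilbert" and T :: "'d::finite \<Rightarrow> 'x \<Rightarrow>\<^sub>L 'x"
  assumes E_lin: "complex_linear E" and T_lin: "\<And>j. complex_linear (T j)"
    and T_comm: "commuting_tuple T" and stable: "output_stable E T"
begin

lemma obs_coeff_multinom: "obs_coeff E T x n = multinom n *\<^sub>R E (tuple_power T n x)"
  by (simp add: obs_coeff_def multinom_def)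

lemma obs_series: "has_power_series (obs_coeff E T x) (obs E T x)"
  and obs_mem [simp]: "obs E T x \<in> drury_arveson"
  using stable by (auto simp: output_stable_def)

lemma obs_bound: obtains C where "0 \<le> C" "\<And>x. da_norm (obs E T x) \<le> C * norm x"
proof -
  obtain C where "\<And>x. da_norm (obs E T x) \<le> C * norm x"
    using stable by (auto simp: output_stable_def)
  then have "da_norm (obs E T x) \<le> max C 0 * norm x" for x
    by (meson max.cobounded1 mult_right_mono norm_ge_zero order_trans)
  then show ?thesis using that[of "max C 0"] by simp
qed

lemma obs_add: "obs E T (x + y) = obs E T x + obs E T y"
proof -
  have "obs_coeff E T (x + y) = (\<lambda>n. obs_coeff E T x n + obs_coeff E T y n)"
    by (simp add: fun_eq_iff obs_coeff_multinom blinfun.add_right scaleR_add_right)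
  then have "has_power_series (obs_coeff E T (x + y)) (obs E T x + obs E T y)"
    using has_power_series_add[OF obs_series[of x] obs_series[of y]] by (simp add: plus_fun_def)
  then show ?thesis by (rule has_power_series_function_unique[OF obs_series])
qed

lemma obs_scale: "obs E T (c *\<^sub>C x) = fscale c (obs E T x)"
proof -
  have "obs_coeff E T (c *\<^sub>C x) = (\<lambda>n. c *\<^sub>C obs_coeff E T x n)"
    by (simp add: fun_eq_iff obs_coeff_multinom complex_linearD[OF E_lin]
        complex_linearD[OF complex_linear_tuple_power[OF T_comm T_lin]] scaleR_scaleC scaleC_scaleC mult.commute)
  then have "has_power_series (obs_coeff E T (c *\<^sub>C x)) (fscale c (obs E T x))"
    using has_power_series_scale[OF obs_series[of x], of c] by (simp add: fscale_def)
  then show ?thesis by (rule has_power_series_function_unique[OF obs_series])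
qed

text \<open>The factorials in the coefficients of \<open>\<O> x\<close> cancel the weights of the space.\<close>

lemma da_inner_obs:
  assumes g: "g \<in> drury_arveson"
  shows "((\<lambda>n. cinner (E (tuple_power T n x)) (power_coeff g n)) has_sum da_inner (obs E T x) g) UNIV"
proof -
  have "of_real (da_weight n) * cinner (obs_coeff E T x n) (power_coeff g n)
      = cinner (E (tuple_power T n x)) (power_coeff g n)" for n
  proof -
    have "complex_of_real (da_weight n) * complex_of_real (multinom n) = 1"
      by (metis da_weight_multinom of_real_1 of_real_mult)
    then show ?thesis by (simp add: obs_coeff_multinom cinner_scaleR_left flip: mult.assoc)
  qed
  then show ?thesis
    using da_inner_summable[OF drury_arvesonD(2)[OF obs_mem[of x]] drury_arvesonD(2)[OF g]]
    by (simp add: da_inner_def power_coeff_eq[OF obs_series])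
qed

lemma da_inner_obs_coord_mult:
  assumes g: "g \<in> drury_arveson"
  shows "da_inner (obs E T x) (coord_mult j g) = da_inner (obs E T (T j x)) g"
proof -
  note cm = coord_mult_drury_arveson[OF g, where j = j]
  have "((\<lambda>n. cinner (E (tuple_power T n x)) (power_coeff (coord_mult j g) n))
      has_sum da_inner (obs E T x) (coord_mult j g)) (range (\<lambda>n. n + mi_unit j))"
    using da_inner_obs[OF cm(1), of x]
    by (rule has_sum_cong_neutral[THEN iffD1, rotated -1]) (auto simp: range_add_unit cm(3))
  then have "((\<lambda>n. cinner (E (tuple_power T n (T j x))) (power_coeff g n))
      has_sum da_inner (obs E T x) (coord_mult j g)) UNIV"
    by (simp add: has_sum_reindex[OF inj_add_unit] o_def cm(2) tuple_power_add_unit_apply[OF T_comm])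
  then show ?thesis using da_inner_obs[OF g] has_sum_unique by blast
qed

lemma da_inner_obs_const: "da_inner (obs E T x) (\<lambda>_. y) = cinner (E x) y"
proof -
  have "((\<lambda>n. cinner (E (tuple_power T n x)) (if n = 0 then y else 0)) has_sum da_inner (obs E T x) (\<lambda>_. y)) UNIV"
    using da_inner_obs[OF constant_drury_arveson, of x y]
    unfolding constant_as_monomial power_coeff_eq[OF has_power_series_monomial] .
  then have "((\<lambda>n. cinner (E (tuple_power T n x)) (if n = 0 then y else 0)) has_sum da_inner (obs E T x) (\<lambda>_. y)) {0}"
    by (rule has_sum_cong_neutral[THEN iffD1, rotated -1]) auto
  then show ?thesis by (auto simp: has_sum_finite_iff tuple_power_zero[OF T_comm])
qed

lemma da_inner_obs_adj:
  assumes f: "f \<in> drury_arveson"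
  shows "da_inner (obs E T x) f = cinner x (obs_adj E T f)"
proof -
  obtain C where C: "0 \<le> C" "\<And>x. da_norm (obs E T x) \<le> C * norm x" using obs_bound by blast
  have "cmod (da_inner (obs E T x) f) \<le> C * da_norm f * norm x" for x
  proof -
    have "cmod (da_inner (obs E T x) f) \<le> da_norm (obs E T x) * da_norm f"
      using DA.ip_Cauchy_Schwarz[OF obs_mem f] by (simp add: ip_norm_da_inner)
    also have "\<dots> \<le> (C * norm x) * da_norm f"
      using C DA.nrm_nonneg[OF f] by (intro mult_right_mono) (simp_all add: ip_norm_da_inner)
    finally show ?thesis by (simp add: mult_ac)
  qed
  then obtain w where w: "\<And>x. da_inner (obs E T x) f = cinner x w"
    by (rule Riesz_complex_hilbert[rotated 2])
       (auto simp: obs_add obs_scale DA.ip_simps f)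
  have "\<exists>!v. \<forall>x. da_inner (obs E T x) f = cinner x v"
  proof (rule ex1I[of _ w])
    fix v assume v: "\<forall>x. da_inner (obs E T x) f = cinner x v"
    show "v = w"
    proof (rule cinner_eqI_right)
      show "cinner x v = cinner x w" for x using v w[of x] by simp
    qed
  qed (simp add: w)
  from theI'[OF this] show ?thesis unfolding obs_adj_def by blast
qed

lemma obs_gramian: "cinner x (obs_gramian E T y) = da_inner (obs E T x) (obs E T y)"
proof -
  obtain C where C: "0 \<le> C" "\<And>x. da_norm (obs E T x) \<le> C * norm x" using obs_bound by blast
  let ?g = "\<lambda>x. obs_adj E T (obs E T x)"
  have g: "cinner v (?g y) = da_inner (obs E T v) (obs E T y)" for v y
    by (simp add: da_inner_obs_adj)
  have "blinfun_apply (Blinfun ?g) = ?g"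
  proof (rule blinfun_bound_Blinfun)
    show "?g (x + y) = ?g x + ?g y" for x y
      by (rule cinner_eqI_right) (simp only: g cinner_add_right, simp add: obs_add DA.ip_add_r)
    show "?g (r *\<^sub>R y) = r *\<^sub>R ?g y" for r y
      by (rule cinner_eqI_right)
        (simp only: g cinner_scaleR_right, simp add: scaleR_scaleC obs_scale DA.ip_scale_r)
    show "norm (?g y) \<le> (C * C) * norm y" for y
    proof (cases "?g y = 0")
      case False
      have "(norm (?g y))\<^sup>2 = cmod (cinner (?g y) (?g y))" by (simp add: cinner_self norm_power)
      also have "\<dots> \<le> da_norm (obs E T (?g y)) * da_norm (obs E T y)"
        unfolding g using DA.ip_Cauchy_Schwarz[OF obs_mem obs_mem] by (simp add: ip_norm_da_inner)
      also have "\<dots> \<le> (C * norm (?g y)) * (C * norm y)"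
        using C DA.nrm_nonneg[OF obs_mem] by (intro mult_mono) (simp_all add: ip_norm_da_inner)
      finally show ?thesis using False by (simp add: power2_eq_square)
    qed (use C in simp)
  qed
  then show ?thesis by (simp add: obs_gramian_def g)
qed

lemma da_norm_obs: "((\<lambda>n. multinom n * (norm (E (tuple_power T n x)))\<^sup>2) has_sum (da_norm (obs E T x))\<^sup>2) UNIV"
proof -
  have "da_weight n * (norm (obs_coeff E T x n))\<^sup>2 = multinom n * (norm (E (tuple_power T n x)))\<^sup>2" for n
  proof -
    have "da_weight n * (norm (obs_coeff E T x n))\<^sup>2
        = (da_weight n * multinom n) * (multinom n * (norm (E (tuple_power T n x)))\<^sup>2)"
      by (simp add: obs_coeff_multinom power_mult_distrib power2_eq_square mult_ac del: da_weight_multinom)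
    then show ?thesis by simp
  qed
  then show ?thesis
    using drury_arvesonD(2)[OF obs_mem[of x]]
    by (simp add: da_norm_sq da_summable_def power_coeff_eq[OF obs_series])
qed

text \<open>The Stein inequality \<open>\<Sum>\<^sub>j T\<^sub>j\<^sup>* G T\<^sub>j \<le> G\<close> for the observability Gramian \<open>G\<close>: by the multinomial
  recursion, the degrees up to \<open>K\<close> on the left give the degrees \<open>1, \<dots>, K + 1\<close> on the right.\<close>

lemma Stein_inequality: "(\<Sum>j\<in>UNIV. (da_norm (obs E T (T j x)))\<^sup>2) \<le> (da_norm (obs E T x))\<^sup>2"
proof -
  define g where "g n = (norm (E (tuple_power T n x)))\<^sup>2" for n
  have part: "(\<Sum>j\<in>UNIV. \<Sum>k\<le>K. \<Sum>n | mi_abs n = k. multinom n * g (n + mi_unit j)) \<le> (da_norm (obs E T x))\<^sup>2" for K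
  proof -
    have "(\<Sum>j\<in>UNIV. \<Sum>k\<le>K. \<Sum>n | mi_abs n = k. multinom n * g (n + mi_unit j))
        = (\<Sum>k\<le>K. \<Sum>n | mi_abs n = Suc k. multinom n * g n)"
      using sum_homogeneous_Suc[of g] by (subst sum.swap) simp
    also have "\<dots> \<le> (\<Sum>k\<le>Suc K. \<Sum>n | mi_abs n = k. multinom n * g n)"
      unfolding sum.atMost_Suc_shift
      by (simp add: sum_nonneg g_def less_imp_le[OF multinom_pos])
    also have "\<dots> = (\<Sum>n | mi_abs n \<le> Suc K. multinom n * g n)" by (rule sum_by_degree[symmetric])
    also have "\<dots> \<le> (da_norm (obs E T x))\<^sup>2"
      using da_norm_obs[of x] unfolding g_def
      by (rule finite_sum_le_has_sum) (auto simp: finite_mi_abs_le less_imp_le[OF multinom_pos])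
    finally show ?thesis .
  qed
  have "(\<lambda>K. \<Sum>j\<in>UNIV. \<Sum>k\<le>K. \<Sum>n | mi_abs n = k. multinom n * g (n + mi_unit j))
      \<longlonglongrightarrow> (\<Sum>j\<in>UNIV. (da_norm (obs E T (T j x)))\<^sup>2)"
  proof (rule tendsto_sum)
    fix j
    show "(\<lambda>K. \<Sum>k\<le>K. \<Sum>n | mi_abs n = k. multinom n * g (n + mi_unit j)) \<longlonglongrightarrow> (da_norm (obs E T (T j x)))\<^sup>2"
      using has_sum_degree_limit[OF da_norm_obs[of "T j x"]]
      by (simp add: sums_def_le g_def tuple_power_add_unit_apply[OF T_comm])
  qed
  then show ?thesis by (rule LIMSEQ_le_const2) (use part in blast)
qed

lemma ZT_apply: "ZT T z x = (\<Sum>j\<in>UNIV. coord z j *\<^sub>C T j x)"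
  by (simp add: ZT_def blinfun.sum_left scaleC_blinfun.rep_eq)

lemma complex_linear_ZT: "complex_linear (ZT T z)"
  by (simp add: complex_linear_def ZT_apply scaleC_sum_right complex_linearD[OF T_lin] scaleC_scaleC mult.commute)

lemma da_norm_obs_ZT:
  "da_norm (obs E T (ZT T z x)) \<le> sqrt (\<Sum>j\<in>UNIV. (cmod (coord z j))\<^sup>2) * da_norm (obs E T x)"
proof -
  have nrm: "DA.nrm (obs E T v) = da_norm (obs E T v)" for v by (simp add: ip_norm_da_inner)
  have obs0: "obs E T 0 = 0" using obs_add[of 0 0] by simp
  have da0: "da_norm (0 :: 'd unit_ball \<Rightarrow> 'y) = 0"
    using DA.nrm_zero by (simp only: ip_norm_da_inner)
  have "da_norm (obs E T (\<Sum>j\<in>J. coord z j *\<^sub>C T j x)) \<le> (\<Sum>j\<in>J. cmod (coord z j) * da_norm (obs E T (T j x)))"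
    if "finite J" for J
    using that
  proof induction
    case (insert j J)
    have "da_norm (obs E T (\<Sum>j\<in>insert j J. coord z j *\<^sub>C T j x))
        \<le> DA.nrm (fscale (coord z j) (obs E T (T j x))) + DA.nrm (obs E T (\<Sum>j\<in>J. coord z j *\<^sub>C T j x))"
      using DA.nrm_triangle[of "fscale (coord z j) (obs E T (T j x))" "obs E T (\<Sum>j\<in>J. coord z j *\<^sub>C T j x)"] insert
      by (simp add: obs_add obs_scale ip_norm_da_inner)
    then show ?case using insert by (simp add: DA.nrm_scale ip_norm_da_inner[symmetric])
  qed (simp add: obs0 da0 del: zero_fun_apply)
  from this[of UNIV] have "da_norm (obs E T (ZT T z x)) \<le> (\<Sum>j\<in>UNIV. \<bar>cmod (coord z j)\<bar> * \<bar>da_norm (obs E T (T j x))\<bar>)"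
    using DA.nrm_nonneg[OF obs_mem] by (simp add: ZT_apply ip_norm_da_inner)
  also have "\<dots> \<le> L2_set (\<lambda>j. cmod (coord z j)) UNIV * L2_set (\<lambda>j. da_norm (obs E T (T j x))) UNIV"
    by (rule L2_set_mult_ineq)
  also have "L2_set (\<lambda>j. da_norm (obs E T (T j x))) UNIV \<le> da_norm (obs E T x)"
    unfolding L2_set_def using Stein_inequality[of x] DA.nrm_nonneg[OF obs_mem[of x]]
    by (intro real_le_lsqrt) (simp_all add: ip_norm_da_inner)
  finally show ?thesis by (simp add: L2_set_def mult_left_mono sum_nonneg)
qed

text \<open>If the pair is exactly observable, then the norm of \<open>\<O> x\<close> is equivalent to that of \<open>x\<close>, and
  \<open>Z(z)T\<close> is a strict contraction in the former.\<close>

lemma op_invertible_resolvent: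
  assumes lower: "\<And>x. norm x \<le> K * da_norm (obs E T x)"
  shows "op_invertible (id_blinfun - ZT T z)"
proof -
  define r where "r = sqrt (\<Sum>j\<in>UNIV. (cmod (coord z j))\<^sup>2)"
  have r: "0 \<le> r" "r < 1" using sum_coord_sq_less_1[of z] by (auto simp: r_def sum_nonneg)
  obtain C where C: "0 \<le> C" "\<And>x. da_norm (obs E T x) \<le> C * norm x" using obs_bound by blast
  have pow: "da_norm (obs E T ((blinfun_apply (ZT T z) ^^ k) x)) \<le> r ^ k * da_norm (obs E T x)" for k x
  proof (induction k)
    case (Suc k)
    have "da_norm (obs E T ((blinfun_apply (ZT T z) ^^ Suc k) x))
        \<le> r * da_norm (obs E T ((blinfun_apply (ZT T z) ^^ k) x))"
      using da_norm_obs_ZT by (simp add: r_def)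
    also have "\<dots> \<le> r * (r ^ k * da_norm (obs E T x))" using Suc r by (intro mult_left_mono)
    finally show ?case by (simp add: mult_ac)
  qed simp
  have "norm ((blinfun_apply (ZT T z) ^^ k) x) \<le> \<bar>K\<bar> * C * r ^ k * norm x" for k x
  proof -
    have "norm ((blinfun_apply (ZT T z) ^^ k) x) \<le> K * da_norm (obs E T ((blinfun_apply (ZT T z) ^^ k) x))"
      by (rule lower)
    also have "\<dots> \<le> \<bar>K\<bar> * da_norm (obs E T ((blinfun_apply (ZT T z) ^^ k) x))"
      using DA.nrm_nonneg[OF obs_mem] by (intro mult_right_mono) (simp_all add: ip_norm_da_inner)
    also have "\<dots> \<le> \<bar>K\<bar> * (r ^ k * (C * norm x))"
      using order_trans[OF pow mult_left_mono[OF C(2)]] r by (intro mult_left_mono) auto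
    finally show ?thesis by (simp add: mult_ac)
  qed
  then show ?thesis by (rule op_invertible_one_minus[OF _ r])
qed

text \<open>Pairing \<open>\<O> x\<close> with a function \<open>h\<close> of the form \<open>k(\<cdot>, w) h\<^sub>0\<close>: multiplying by
  \<open>1 - \<langle>z, w\<rangle>\<close> turns \<open>h\<close> into \<open>h\<^sub>0\<close>, while its adjoint turns \<open>\<O> x\<close> into \<open>\<O> (I - Z(w)T) x\<close>.\<close>

lemma da_inner_obs_resolvent:
  assumes inv: "op_invertible (id_blinfun - ZT T w)"
    and h: "h \<in> drury_arveson" and h0: "h0 \<in> drury_arveson"
    and eq: "\<And>z. h z = (1 / (1 - ball_inner z w)) *\<^sub>C h0 z"
  shows "da_inner (obs E T x) h = da_inner (obs E T (op_inv (id_blinfun - ZT T w) x)) h0"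
proof -
  define v where "v = op_inv (id_blinfun - ZT T w) x"
  have v: "v - ZT T w v = x"
    using op_inv_apply_right[OF inv, of x] by (simp add: v_def blinfun.diff_left)
  have mem: "(\<Sum>j\<in>J. fscale (cnj (coord w j)) (coord_mult j h)) \<in> drury_arveson"
    and sum: "da_inner (obs E T v) (\<Sum>j\<in>J. fscale (cnj (coord w j)) (coord_mult j h))
      = da_inner (obs E T (\<Sum>j\<in>J. coord w j *\<^sub>C T j v)) h" if "finite J" for J
    unfolding atomize_conj using that
  proof induction
    case empty
    have "obs E T 0 = 0" using obs_add[of 0 0] by simp
    then show ?case using h by (simp del: zero_fun_apply)
  next
    case (insert j J)
    have cm: "coord_mult j h \<in> drury_arveson" by (rule coord_mult_drury_arveson(1)[OF h])
    show ?case
      using insert cm h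
      by (simp add: DA.ip_simps obs_add obs_scale da_inner_obs_coord_mult del: plus_fun_apply)
  qed
  have h0_eq: "h0 = h - (\<Sum>j\<in>UNIV. fscale (cnj (coord w j)) (coord_mult j h))"
  proof
    fix z
    have "(\<Sum>j\<in>UNIV. fscale (cnj (coord w j)) (coord_mult j h)) z = (\<Sum>j\<in>UNIV. (cnj (coord w j) * coord z j) *\<^sub>C h z)"
    proof -
      have "(\<Sum>j\<in>J. fscale (cnj (coord w j)) (coord_mult j h)) z = (\<Sum>j\<in>J. (cnj (coord w j) * coord z j) *\<^sub>C h z)"
        if "finite J" for J
        using that by induction (auto simp: fscale_def coord_mult_def scaleC_scaleC)
      then show ?thesis by simp
    qed
    also have "\<dots> = ball_inner z w *\<^sub>C h z"
    proof -
      have "bounded_linear (\<lambda>c. c *\<^sub>C h z)" by (rule bounded_linear_scaleC_left)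
      from linear_sum[OF bounded_linear.linear[OF this], symmetric] show ?thesis
        by (simp add: ball_inner_def mult.commute[of "cnj _"])
    qed
    finally have "(h - (\<Sum>j\<in>UNIV. fscale (cnj (coord w j)) (coord_mult j h))) z = h z - ball_inner z w *\<^sub>C h z"
      by simp
    also have "\<dots> = (1 - ball_inner z w) *\<^sub>C h z"
      using scaleC_add_left[of "1 - ball_inner z w" "ball_inner z w" "h z"] by (simp add: scaleC_one diff_eq_eq)
    also have "\<dots> = h0 z" using ball_inner_neq_1[of z w] by (simp add: eq scaleC_scaleC scaleC_one)
    finally show "h0 z = (h - (\<Sum>j\<in>UNIV. fscale (cnj (coord w j)) (coord_mult j h))) z" by simp
  qed
  have "da_inner (obs E T v) h0 = da_inner (obs E T v) h - da_inner (obs E T (ZT T w v)) h"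
    unfolding h0_eq using mem[of UNIV] sum[of UNIV] h by (simp add: DA.ip_diff_r ZT_apply)
  also have "\<dots> = da_inner (obs E T (v - ZT T w v)) h"
    using obs_add[of "v - ZT T w v" "ZT T w v"] h by (simp add: DA.ip_add_l)
  finally show ?thesis by (simp only: v flip: v_def)
qed

text \<open>The case \<open>h\<^sub>0 = y\<close> of \<open>da_inner_obs_resolvent\<close>.\<close>

lemma obs_apply:
  assumes inv: "op_invertible (id_blinfun - ZT T w)"
  shows "obs E T x w = E (op_inv (id_blinfun - ZT T w) x)"
proof (rule cinner_eqI)
  fix y
  have "cinner (obs E T x w) y = da_inner (obs E T x) (\<lambda>z. da_kernel z w y)"
    by (simp add: DA.reproducing)
  also have "\<dots> = cinner (E (op_inv (id_blinfun - ZT T w) x)) y"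
    by (subst da_inner_obs_resolvent[OF inv DA.kernel_mem constant_drury_arveson])
       (simp_all add: da_kernel_apply da_inner_obs_const)
  finally show "cinner (obs E T x w) y = cinner (E (op_inv (id_blinfun - ZT T w) x)) y" .
qed

end

section \<open>The adjoint of a Schur multiplier on observability functions\<close>

lemma da_inner_monomial:
  "da_inner (\<lambda>z. monomial z n *\<^sub>C v) h = of_real (da_weight n) * cinner v (power_coeff h n)"
proof -
  have "((\<lambda>m. of_real (da_weight m) * cinner (if m = n then v else 0) (power_coeff h m))
      has_sum of_real (da_weight n) * cinner v (power_coeff h n)) {n}"
    by (rule has_sum_finiteI) auto
  then have "((\<lambda>m. of_real (da_weight m) * cinner (if m = n then v else 0) (power_coeff h m))
      has_sum of_real (da_weight n) * cinner v (power_coeff h n)) UNIV"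
    by (rule has_sum_cong_neutral[THEN iffD1, rotated -1]) auto
  then show ?thesis
    unfolding da_inner_def power_coeff_eq[OF has_power_series_monomial] by (rule infsumI)
qed

locale schur_output_pair = output_pair E T
  for E :: "'x::complex_hilbert \<Rightarrow>\<^sub>L 'y::complex_hilbert" and T :: "'d::finite \<Rightarrow> 'x \<Rightarrow>\<^sub>L 'x" +
  fixes S :: "'d unit_ball \<Rightarrow> 'u::complex_hilbert \<Rightarrow>\<^sub>L 'y" and Sc :: "('d \<Rightarrow> nat) \<Rightarrow> 'u \<Rightarrow>\<^sub>L 'y"
    and N :: "'x \<Rightarrow>\<^sub>L 'u"
  assumes S_schur: "S \<in> schur_class" and Sc_lin: "\<And>n. complex_linear (Sc n)"
    and S_series: "has_power_series Sc S" and N_lin: "complex_linear N"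
    and N_series: "has_weak_sum (\<lambda>n. adj (Sc n) o\<^sub>L E o\<^sub>L tuple_power T n) N"
begin

lemma S_lin: "complex_linear (S z)"
  using S_schur by (simp add: schur_class_def)

lemma S_mem: "g \<in> drury_arveson \<Longrightarrow> (\<lambda>z. S z (g z)) \<in> drury_arveson"
  and S_contractive: "g \<in> drury_arveson \<Longrightarrow> da_norm (\<lambda>z. S z (g z)) \<le> da_norm g"
  using S_schur by (auto simp: schur_class_def)

lemma S_const_series: "has_power_series (\<lambda>n. Sc n v) (\<lambda>z. S z v)"
  unfolding has_power_series_def
proof
  fix z
  have "((\<lambda>n. monomial z n *\<^sub>C Sc n) has_sum S z) UNIV"
    using S_series by (simp add: has_power_series_def)
  from has_sum_bounded_linear[OF blinfun.bounded_linear_left[of v] this]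
  show "((\<lambda>n. monomial z n *\<^sub>C Sc n v) has_sum S z v) UNIV"
    by (simp add: scaleC_blinfun.rep_eq)
qed

lemma da_inner_obs_S_const: "da_inner (obs E T x) (\<lambda>z. S z v) = cinner (N x) v"
proof -
  have "((\<lambda>n. cinner (E (tuple_power T n x)) (Sc n v)) has_sum da_inner (obs E T x) (\<lambda>z. S z v)) UNIV"
    using da_inner_obs[OF S_mem[OF constant_drury_arveson], of x v]
    by (simp add: power_coeff_eq[OF S_const_series])
  moreover have "((\<lambda>n. cinner (E (tuple_power T n x)) (Sc n v)) has_sum cinner (N x) v) UNIV"
    using N_series by (simp add: has_weak_sum_def adj_cinner'[OF Sc_lin])
  ultimately show ?thesis by (rule has_sum_unique)
qed

text \<open>The adjoint of a coordinate multiplication shifts \<open>\<O> x\<close> to \<open>\<O> (T\<^sub>j x)\<close>, and coordinate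
  multiplications commute with \<open>M\<^sub>S\<close>; so monomials reduce to the constants.\<close>

lemma da_inner_obs_S_monomial:
  "da_inner (obs E T x) (\<lambda>z. S z (monomial z n *\<^sub>C v)) = cinner (N (tuple_power T n x)) v"
proof (induction n arbitrary: x rule: mi_induct)
  case zero
  have "(\<lambda>z. S z (monomial z 0 *\<^sub>C v)) = (\<lambda>z. S z v)"
    by (simp add: monomial_eq_mpow scaleC_one)
  then show ?case
    by (simp add: da_inner_obs_S_const tuple_power_zero[OF T_comm] del: zero_fun_apply)
next
  case (add_unit n j)
  have "(\<lambda>z. S z (monomial z (n + mi_unit j) *\<^sub>C v)) = coord_mult j (\<lambda>z. S z (monomial z n *\<^sub>C v))"
    by (simp add: monomial_eq_mpow mpow_add_unit coord_mult_def complex_linearD[OF S_lin] scaleC_scaleC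
        del: plus_fun_apply)
  then have "da_inner (obs E T x) (\<lambda>z. S z (monomial z (n + mi_unit j) *\<^sub>C v))
      = cinner (N (tuple_power T n (T j x))) v"
    by (simp add: da_inner_obs_coord_mult S_mem monomial_drury_arveson add_unit del: plus_fun_apply)
  then show ?case
    by (simp add: tuple_power_add_unit_apply[OF T_comm] del: plus_fun_apply)
qed

text \<open>\<open>\<O>\<^bsub>N,T\<^esub> = M\<^sub>S\<^sup>* \<O>\<^bsub>E,T\<^esub>\<close>. The Riesz representation theorem provides the right-hand side as an
  element of the Drury--Arveson space; its coefficients are found by pairing with monomials.\<close>

theorem
  shows obs_N_series: "has_power_series (obs_coeff N T x) (obs N T x)"
    and obs_N_mem: "obs N T x \<in> drury_arveson"
    and obs_N_adjoint: "g \<in> drury_arveson \<Longrightarrow>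
      da_inner g (obs N T x) = da_inner (\<lambda>z. S z (g z)) (obs E T x)"
proof -
  have bound: "cmod (da_inner (\<lambda>z. S z (g z)) (obs E T x)) \<le> da_norm (obs E T x) * DA.nrm g"
    if g: "g \<in> drury_arveson" for g
  proof -
    have "cmod (da_inner (\<lambda>z. S z (g z)) (obs E T x)) \<le> da_norm (\<lambda>z. S z (g z)) * da_norm (obs E T x)"
      using DA.ip_Cauchy_Schwarz[OF S_mem[OF g] obs_mem] by (simp add: ip_norm_da_inner)
    also have "\<dots> \<le> da_norm g * da_norm (obs E T x)"
      using DA.nrm_nonneg[OF obs_mem[of x]]
      by (intro mult_right_mono S_contractive[OF g]) (simp add: ip_norm_da_inner)
    finally show ?thesis by (simp add: ip_norm_da_inner mult.commute)
  qed
  obtain h where h: "h \<in> drury_arveson"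
    and hg: "\<And>g. g \<in> drury_arveson \<Longrightarrow> da_inner (\<lambda>z. S z (g z)) (obs E T x) = da_inner g h"
  proof (rule DA.Riesz_representation[of "\<lambda>g. da_inner (\<lambda>z. S z (g z)) (obs E T x)", OF _ _ bound])
    fix f g :: "'d unit_ball \<Rightarrow> 'u" assume fg: "f \<in> drury_arveson" "g \<in> drury_arveson"
    have "(\<lambda>z. S z ((f + g) z)) = (\<lambda>z. S z (f z)) + (\<lambda>z. S z (g z))"
      by (simp add: fun_eq_iff blinfun.add_right)
    then show "da_inner (\<lambda>z. S z ((f + g) z)) (obs E T x)
        = da_inner (\<lambda>z. S z (f z)) (obs E T x) + da_inner (\<lambda>z. S z (g z)) (obs E T x)"
      by (simp only: DA.ip_add_l[OF S_mem[OF fg(1)] S_mem[OF fg(2)] obs_mem])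
  next
    fix c and f :: "'d unit_ball \<Rightarrow> 'u" assume f: "f \<in> drury_arveson"
    have "(\<lambda>z. S z (fscale c f z)) = fscale c (\<lambda>z. S z (f z))"
      by (simp add: fscale_def complex_linearD[OF S_lin])
    then show "da_inner (\<lambda>z. S z (fscale c f z)) (obs E T x) = c * da_inner (\<lambda>z. S z (f z)) (obs E T x)"
      by (simp only: DA.ip_scale_l[OF S_mem[OF f] obs_mem])
  qed (assumption, rule that)
  have coeff: "power_coeff h n = obs_coeff N T x n" for n
  proof (rule cinner_eqI_right)
    fix v
    have "of_real (da_weight n) * cinner v (power_coeff h n)
        = cnj (da_inner (obs E T x) (\<lambda>z. S z (monomial z n *\<^sub>C v)))"
      using hg[OF monomial_drury_arveson, of n v] DA.ip_commute[OF S_mem[OF monomial_drury_arveson] obs_mem]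
      by (simp add: da_inner_monomial)
    also have "\<dots> = cinner v (N (tuple_power T n x))"
      unfolding da_inner_obs_S_monomial by (rule cinner_commute[symmetric])
    finally have *: "of_real (da_weight n) * cinner v (power_coeff h n) = cinner v (N (tuple_power T n x))" .
    have "of_real (multinom n) * of_real (da_weight n) = (1::complex)"
      by (metis da_weight_multinom mult.commute of_real_1 of_real_mult)
    then have "cinner v (power_coeff h n) = of_real (multinom n) * (of_real (da_weight n) * cinner v (power_coeff h n))"
      by (simp flip: mult.assoc)
    then show "cinner v (power_coeff h n) = cinner v (obs_coeff N T x n)"
      unfolding * by (simp add: obs_coeff_def multinom_def cinner_scaleR_right)
  qed
  have "has_power_series (obs_coeff N T x) h"
    using drury_arvesonD(1)[OF h] coeff by (metis ext)
  moreover from this have "obs N T x = h"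
    unfolding has_power_series_def obs_def by (intro ext infsumI) simp
  ultimately show "has_power_series (obs_coeff N T x) (obs N T x)" "obs N T x \<in> drury_arveson"
    "g \<in> drury_arveson \<Longrightarrow> da_inner g (obs N T x) = da_inner (\<lambda>z. S z (g z)) (obs E T x)"
    using h hg by simp_all
qed

lemma output_pair_N: "output_pair N T"
proof
  obtain C where C: "0 \<le> C" "\<And>x. da_norm (obs E T x) \<le> C * norm x" using obs_bound by blast
  have "da_norm (obs N T x) \<le> C * norm x" for x
  proof (cases "da_norm (obs N T x) = 0")
    case False
    have "(da_norm (obs N T x))\<^sup>2 = cmod (da_inner (obs N T x) (obs N T x))"
      using DA.ip_self[OF obs_N_mem] by (simp add: ip_norm_da_inner norm_power)
    also have "\<dots> = cmod (da_inner (\<lambda>z. S z (obs N T x z)) (obs E T x))"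
      by (simp add: obs_N_adjoint obs_N_mem)
    also have "\<dots> \<le> da_norm (\<lambda>z. S z (obs N T x z)) * da_norm (obs E T x)"
      using DA.ip_Cauchy_Schwarz[OF S_mem[OF obs_N_mem] obs_mem] by (simp add: ip_norm_da_inner)
    also have "\<dots> \<le> da_norm (obs N T x) * (C * norm x)"
      using C DA.nrm_nonneg[OF obs_mem[of x]] DA.nrm_nonneg[OF obs_N_mem[of x]]
      by (intro mult_mono S_contractive[OF obs_N_mem] C(2)) (simp_all add: ip_norm_da_inner)
    finally show ?thesis
      using False DA.nrm_nonneg[OF obs_N_mem[of x]] by (simp add: ip_norm_da_inner power2_eq_square)
  qed (use C in simp)
  then show "output_stable N T"
    using obs_N_series obs_N_mem unfolding output_stable_def by blast
qed (rule N_lin T_lin T_comm)+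

lemma obs_N_adjoint': "g \<in> drury_arveson \<Longrightarrow>
    da_inner (obs N T x) g = da_inner (obs E T x) (\<lambda>z. S z (g z))"
  using obs_N_adjoint[of g x] DA.ip_commute[OF obs_N_mem, of g x] DA.ip_commute[OF S_mem obs_mem, of g x]
  by simp

lemma gramian_difference:
  "cinner x ((obs_gramian E T - obs_gramian N T) y)
    = da_inner (obs E T x) (obs E T y) - da_inner (obs N T x) (obs N T y)"
  by (simp add: blinfun.diff_left cinner_simps obs_gramian output_pair.obs_gramian[OF output_pair_N])

text \<open>The operator \<open>P\<close> is bounded below and dominated by the Gramian of \<open>(E, T)\<close>.\<close>

lemma exactly_observable:
  assumes P: "strictly_pos_def P" and P_def: "P = obs_gramian E T - obs_gramian N T"
  shows "norm x \<le> sqrt (norm (op_inv P)) * da_norm (obs E T x)"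
proof (rule power2_le_imp_le)
  have "Re (cinner (P x) x) = Re (cinner x (P x))"
    using arg_cong[OF cinner_commute[of "P x" x], of Re] by simp
  also have "\<dots> = (da_norm (obs E T x))\<^sup>2 - (da_norm (obs N T x))\<^sup>2"
    using DA.nrm_sq[OF obs_mem[of x]] DA.nrm_sq[OF obs_N_mem[of x]]
    unfolding P_def gramian_difference by (simp add: ip_norm_da_inner)
  finally have "Re (cinner (P x) x) \<le> (da_norm (obs E T x))\<^sup>2" by simp
  then have "norm (op_inv P) * Re (cinner (P x) x) \<le> norm (op_inv P) * (da_norm (obs E T x))\<^sup>2"
    by (intro mult_left_mono) simp_all
  then show "(norm x)\<^sup>2 \<le> (sqrt (norm (op_inv P)) * da_norm (obs E T x))\<^sup>2"
    using strictly_pos_def_lower_bound[OF P, of x] by (simp add: power_mult_distrib)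
  show "0 \<le> sqrt (norm (op_inv P)) * da_norm (obs E T x)"
    using DA.nrm_nonneg[OF obs_mem[of x]] by (simp add: ip_norm_da_inner)
qed

text \<open>The functions \<open>F(\<cdot>) v\<close> form the range of the adjoint of \<open>\<O>\<^sup>*\<close> restricted to \<open>H(S)\<close>.\<close>

definition F_op :: "'d unit_ball \<Rightarrow> 'x \<Rightarrow>\<^sub>L 'y"
  where "F_op z = (E - (S z o\<^sub>L N)) o\<^sub>L op_inv (id_blinfun - ZT T z)"

lemma complex_linear_F_op:
  assumes "op_invertible (id_blinfun - ZT T z)" shows "complex_linear (F_op z)"
  unfolding F_op_def
  by (intro complex_linear_compose complex_linear_diff complex_linear_op_inv[OF assms]
      complex_linear_id complex_linear_ZT E_lin N_lin S_lin)

text \<open>The map \<open>x \<mapsto> F(\<cdot>) x = (I - M\<^sub>S M\<^sub>S\<^sup>*) \<O> x\<close> into \<open>H(S)\<close> is the adjoint of \<open>\<O>\<^sup>*\<close> restricted to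
  \<open>H(S)\<close>: for fixed \<open>x\<close> the functional \<open>f \<mapsto> \<langle>f, \<O> x\<rangle>\<close> is represented by some element of \<open>H(S)\<close>, whose
  values are its inner products with the kernel functions.\<close>

context
  fixes HS ipS
  assumes HS: "rkhs (deBranges_Rovnyak_kernel S) HS ipS"
    and inv: "\<And>z. op_invertible (id_blinfun - ZT T z)"
begin

interpretation HS: rkhs "deBranges_Rovnyak_kernel S" HS ipS by (rule HS)

lemma deBranges_in_DA: "f \<in> HS \<Longrightarrow> f \<in> drury_arveson"
  and da_norm_le_deBranges: "f \<in> HS \<Longrightarrow> da_norm f \<le> HS.nrm f"
  using deBranges_Rovnyak_subset_drury_arveson[OF S_lin HS] by blast+

lemma F_op_apply: "F_op w x = obs E T x w - S w (obs N T x w)"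
  by (simp add: F_op_def obs_apply[OF inv] output_pair.obs_apply[OF output_pair_N inv]
      blinfun.diff_left)

lemma
  shows F_op_mem: "(\<lambda>z. F_op z x) \<in> HS"
    and ip_F_op: "f \<in> HS \<Longrightarrow> ipS f (\<lambda>z. F_op z x) = da_inner f (obs E T x)"
proof -
  have "cmod (da_inner f (obs E T x)) \<le> da_norm (obs E T x) * HS.nrm f" if f: "f \<in> HS" for f
  proof -
    have "cmod (da_inner f (obs E T x)) \<le> da_norm f * da_norm (obs E T x)"
      using DA.ip_Cauchy_Schwarz[OF deBranges_in_DA[OF f] obs_mem] by (simp add: ip_norm_da_inner)
    also have "\<dots> \<le> HS.nrm f * da_norm (obs E T x)"
      using DA.nrm_nonneg[OF obs_mem[of x]]
      by (intro mult_right_mono da_norm_le_deBranges[OF f]) (simp add: ip_norm_da_inner)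
    finally show ?thesis by (simp add: mult.commute)
  qed
  then obtain g where g: "g \<in> HS" and fg: "\<And>f. f \<in> HS \<Longrightarrow> da_inner f (obs E T x) = ipS f g"
    by (rule HS.Riesz_representation[of "\<lambda>f. da_inner f (obs E T x)", rotated 2])
       (simp_all add: DA.ip_simps deBranges_in_DA)
  have "g w = F_op w x" for w
  proof (rule cinner_eqI)
    fix y
    let ?Ky = "\<lambda>z. deBranges_Rovnyak_kernel S z w y" and ?k = "\<lambda>z. da_kernel z w y"
    let ?kS = "\<lambda>z. da_kernel z w (adj (S w) y)"
    have K_eq: "?Ky = ?k - (\<lambda>z. S z (?kS z))"
      by (simp add: fun_eq_iff deBranges_Rovnyak_kernel_def scaleC_blinfun.rep_eq blinfun.diff_left
          da_kernel_apply complex_linearD[OF S_lin] scaleC_diff_right)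
    have "cinner (g w) y = cnj (ipS ?Ky g)"
      using HS.reproducing[OF g, of w y] HS.ip_commute[OF g HS.kernel_mem, of w y] by simp
    also have "\<dots> = da_inner (obs E T x) ?Ky"
      using fg[OF HS.kernel_mem, of w y] DA.ip_commute[OF obs_mem deBranges_in_DA[OF HS.kernel_mem], of x w y]
      by simp
    also have "\<dots> = da_inner (obs E T x) ?k - da_inner (obs E T x) (\<lambda>z. S z (?kS z))"
      unfolding K_eq by (rule DA.ip_diff_r) (auto intro: DA.kernel_mem S_mem)
    also have "da_inner (obs E T x) (\<lambda>z. S z (?kS z)) = da_inner (obs N T x) ?kS"
      by (rule obs_N_adjoint'[OF DA.kernel_mem, symmetric])
    also have "da_inner (obs E T x) ?k - da_inner (obs N T x) ?kS
        = cinner (obs E T x w) y - cinner (obs N T x w) (adj (S w) y)"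
      by (simp add: DA.reproducing obs_N_mem)
    also have "\<dots> = cinner (F_op w x) y"
      by (simp add: F_op_apply cinner_simps adj_cinner[OF S_lin])
    finally show "cinner (g w) y = cinner (F_op w x) y" .
  qed
  then have "g = (\<lambda>z. F_op z x)" by blast
  then show "(\<lambda>z. F_op z x) \<in> HS" "f \<in> HS \<Longrightarrow> ipS f (\<lambda>z. F_op z x) = da_inner f (obs E T x)"
    using g fg by simp_all
qed

lemma ip_F_op_obs_adj:
  assumes f: "f \<in> HS" shows "ipS (\<lambda>z. F_op z y) f = cinner y (obs_adj E T f)"
proof -
  have "ipS (\<lambda>z. F_op z y) f = cnj (da_inner f (obs E T y))"
    using HS.ip_commute[OF F_op_mem f] ip_F_op[OF f] by simp
  also have "\<dots> = da_inner (obs E T y) f"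
    using DA.ip_commute[OF obs_mem deBranges_in_DA[OF f]] by simp
  finally show ?thesis using da_inner_obs_adj[OF deBranges_in_DA[OF f]] by simp
qed

lemma ip_F_op_F_op:
  "ipS (\<lambda>z. F_op z x) (\<lambda>z. F_op z y) = cinner x ((obs_gramian E T - obs_gramian N T) y)"
proof -
  have "(\<lambda>z. F_op z x) = obs E T x - (\<lambda>z. S z (obs N T x z))"
    by (simp add: fun_eq_iff F_op_apply)
  then have "ipS (\<lambda>z. F_op z x) (\<lambda>z. F_op z y)
      = da_inner (obs E T x) (obs E T y) - da_inner (\<lambda>z. S z (obs N T x z)) (obs E T y)"
    using ip_F_op[OF F_op_mem, of x y] by (simp only: DA.ip_diff_l[OF obs_mem S_mem[OF obs_N_mem] obs_mem])
  also have "da_inner (\<lambda>z. S z (obs N T x z)) (obs E T y) = da_inner (obs N T x) (obs N T y)"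
    by (simp add: obs_N_adjoint obs_N_mem)
  finally show ?thesis unfolding gramian_difference .
qed

end

end

section \<open>The kernel identity\<close>

lemma block_col_apply: "block_col A B x = (A x, B x)"
  unfolding block_col_def
  by (subst bounded_linear_Blinfun_apply) (auto intro!: bounded_linear_Pair blinfun.bounded_linear_right)

lemma bounded_linear_fst_snd:
  "bounded_linear (\<lambda>p. blinfun_apply A (fst p) + blinfun_apply B (snd p))"
  by (intro bounded_linear_add bounded_linear_compose[OF blinfun.bounded_linear_right]
      bounded_linear_fst bounded_linear_snd)

lemma block_row_apply: "block_row A B p = A (fst p) + B (snd p)"
  unfolding block_row_def case_prod_beta
  by (subst bounded_linear_Blinfun_apply[OF bounded_linear_fst_snd]) simp

lemma block_op_apply: "block_op A B C D p = (A (fst p) + B (snd p), C (fst p) + D (snd p))"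
  unfolding block_op_def case_prod_beta
  by (subst bounded_linear_Blinfun_apply[OF bounded_linear_Pair[OF bounded_linear_fst_snd bounded_linear_fst_snd]]) simp

lemma J_op_apply: "J_op p = (fst p, - snd p)"
  by (simp add: J_op_def block_op_apply blinfun.minus_left)

lemma complex_linear_block_op:
  assumes "complex_linear (block_op A B C D)"
  shows "complex_linear A" "complex_linear B" "complex_linear C" "complex_linear D"
proof -
  have "block_op A B C D (c *\<^sub>C (x, 0)) = c *\<^sub>C block_op A B C D (x, 0)"
    "block_op A B C D (c *\<^sub>C (0, y)) = c *\<^sub>C block_op A B C D (0, y)" for c x y
    using complex_linearD[OF assms] by blast+
  then show "complex_linear A" "complex_linear B" "complex_linear C" "complex_linear D"
    by (simp_all add: complex_linear_def block_op_apply scaleC_prod_def)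
qed

lemma adj_diff:
  "complex_linear A \<Longrightarrow> complex_linear B \<Longrightarrow> adj (A - B) = adj A - adj B"
  by (intro blinfun_eqI adj_unique complex_linear_diff)
     (simp_all add: blinfun.diff_left cinner_simps adj_cinner)

lemma adj_id: "adj id_blinfun = id_blinfun"
  by (intro blinfun_eqI adj_unique complex_linear_id) simp

context schur_output_pair
begin

text \<open>Compressing the identity for \<open>\<AA>\<close> by \<open>[I, -S]\<close>: since \<open>[I, -S] \<AA> = [u, - u \<E>\<^sub>0]\<close>, it becomes
  \<open>K\<^sub>S - u K\<^sub>\<E> u\<^sup>* = F Q F\<^sup>*\<close>. The pairs \<open>p\<close> and \<open>q\<close> below are the images of \<open>y\<close> and \<open>v\<close>
  under \<open>[I, -S]\<^sup>*\<close> at the points \<open>w\<close> and \<open>z\<close>.\<close>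

lemma deBranges_Rovnyak_kernel_decomposition:
  fixes A :: "'d unit_ball \<Rightarrow> ('f::complex_hilbert \<times> 'u) \<Rightarrow>\<^sub>L ('y \<times> 'u)"
    and E0 :: "'d unit_ball \<Rightarrow> 'u \<Rightarrow>\<^sub>L 'f"
  assumes inv: "\<And>z. op_invertible (id_blinfun - ZT T z)"
    and A_lin: "\<And>z. complex_linear (A z)"
    and A_blocks: "\<And>z. A z = block_op (A11 z) (A12 z) (A21 z) (A22 z)"
    and A_kernel: "\<And>z w.
          (1 / (1 - ball_inner z w)) *\<^sub>C (J_op - (A z o\<^sub>L J_op o\<^sub>L adj (A w)))
        = block_col E N o\<^sub>L op_inv (id_blinfun - ZT T z) o\<^sub>L Q
            o\<^sub>L op_inv (id_blinfun - adj (ZT T w)) o\<^sub>L block_row (adj E) (adj N)"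
    and E0_lin: "\<And>z. complex_linear (E0 z)"
    and E0_inv: "\<And>z. op_invertible ((A21 z o\<^sub>L E0 z) + A22 z)"
    and S_lft: "\<And>z. S z = ((A11 z o\<^sub>L E0 z) + A12 z) o\<^sub>L op_inv ((A21 z o\<^sub>L E0 z) + A22 z)"
    and u_def: "u = (\<lambda>z. A11 z - (S z o\<^sub>L A21 z))"
  shows "deBranges_Rovnyak_kernel S z w y
    = u z (deBranges_Rovnyak_kernel E0 z w (adj (u w) y)) + F_op z (Q (adj (F_op w) y))"
proof (rule cinner_eqI)
  fix v
  have blocks_lin: "complex_linear (A11 z)" "complex_linear (A21 z)" for z
    using complex_linear_block_op[OF A_lin[of z, unfolded A_blocks]] by auto
  have u_lin: "complex_linear (u z)" for z
    unfolding u_def by (intro complex_linear_diff complex_linear_compose blocks_lin S_lin)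
  have uE0: "A12 z g - S z (A22 z g) = - u z (E0 z g)" for z g
  proof -
    have "S z (((A21 z o\<^sub>L E0 z) + A22 z) g) = ((A11 z o\<^sub>L E0 z) + A12 z) g"
      by (subst S_lft) (simp add: op_inv_apply_left[OF E0_inv])
    then show ?thesis
      by (simp add: u_def blinfun.diff_left blinfun.add_left blinfun.add_right algebra_simps)
  qed
  define c where "c = 1 / (1 - ball_inner z w)"
  define p where "p = (y, - adj (S w) y)"
  define q where "q = (v, - adj (S z) v)"
  have adjA: "adj (A z) (y, - adj (S z) y) = (adj (u z) y, - adj (E0 z) (adj (u z) y))" for z y
  proof (rule adj_unique[OF A_lin])
    fix fg :: "'f \<times> 'u"
    obtain f g where fg: "fg = (f, g)" by (cases fg)
    have "cinner (A z fg) (y, - adj (S z) y)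
        = cinner (A11 z f - S z (A21 z f)) y + cinner (A12 z g - S z (A22 z g)) y"
      by (simp add: A_blocks block_op_apply fg cinner_prod_def cinner_simps blinfun.add_right
          adj_cinner[OF S_lin, symmetric])
    also have "\<dots> = cinner (u z f) y - cinner (u z (E0 z g)) y"
      unfolding uE0 by (simp add: u_def blinfun.diff_left cinner_simps)
    finally show "cinner (A z fg) (y, - adj (S z) y) = cinner fg (adj (u z) y, - adj (E0 z) (adj (u z) y))"
      by (simp add: fg cinner_prod_def cinner_simps adj_cinner[OF u_lin] adj_cinner[OF E0_lin])
  qed
  have "cinner ((c *\<^sub>C (J_op - (A z o\<^sub>L J_op o\<^sub>L adj (A w)))) p) q
      = c * (cinner (J_op p) q - cinner (J_op (adj (A w) p)) (adj (A z) q))"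
    by (simp add: scaleC_blinfun.rep_eq blinfun.diff_left cinner_simps adj_cinner[OF A_lin])
  also have "\<dots> = c * (cinner (y - S z (adj (S w) y)) v
      - cinner (u z (adj (u w) y - E0 z (adj (E0 w) (adj (u w) y)))) v)"
    by (simp add: p_def q_def adjA J_op_apply cinner_prod_def cinner_simps blinfun.diff_right
        adj_cinner[OF u_lin] adj_cinner[OF E0_lin] adj_cinner[OF S_lin])
  also have "\<dots> = cinner (deBranges_Rovnyak_kernel S z w y) v
      - cinner (u z (deBranges_Rovnyak_kernel E0 z w (adj (u w) y))) v"
    by (simp add: deBranges_Rovnyak_kernel_def scaleC_blinfun.rep_eq blinfun.diff_left
        complex_linearD[OF u_lin] cinner_simps right_diff_distrib c_def)
  finally have lhs: "cinner ((c *\<^sub>C (J_op - (A z o\<^sub>L J_op o\<^sub>L adj (A w)))) p) q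
      = cinner (deBranges_Rovnyak_kernel S z w y) v
      - cinner (u z (deBranges_Rovnyak_kernel E0 z w (adj (u w) y))) v" .
  define R where "R z = op_inv (id_blinfun - ZT T z)" for z
  have lin_IZT: "complex_linear (id_blinfun - ZT T w)"
    by (intro complex_linear_diff complex_linear_id complex_linear_ZT)
  have R_lin: "complex_linear (R w)"
    unfolding R_def by (rule complex_linear_op_inv[OF inv lin_IZT])
  have "op_inv (id_blinfun - adj (ZT T w)) = adj (R w)"
    using op_inv_adj[OF inv lin_IZT]
    by (simp add: R_def adj_diff[OF complex_linear_id complex_linear_ZT] adj_id)
  moreover have "adj (R w) (adj E y - adj N (adj (S w) y)) = adj (F_op w) y"
    by (rule sym, rule adj_unique[OF complex_linear_F_op[OF inv]])
       (simp add: F_op_def blinfun.diff_left cinner_simps adj_cinner[OF E_lin] adj_cinner[OF N_lin]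
          adj_cinner[OF S_lin] blinfun.diff_right R_def[symmetric] flip: adj_cinner[OF R_lin])
  ultimately have "(block_col E N o\<^sub>L R z o\<^sub>L Q
            o\<^sub>L op_inv (id_blinfun - adj (ZT T w)) o\<^sub>L block_row (adj E) (adj N)) p
      = (E (R z (Q (adj (F_op w) y))), N (R z (Q (adj (F_op w) y))))"
    by (simp add: p_def block_row_apply block_col_apply blinfun.minus_right)
  then have rhs: "cinner ((block_col E N o\<^sub>L op_inv (id_blinfun - ZT T z) o\<^sub>L Q
            o\<^sub>L op_inv (id_blinfun - adj (ZT T w)) o\<^sub>L block_row (adj E) (adj N)) p) q
      = cinner (F_op z (Q (adj (F_op w) y))) v"
    by (simp add: R_def q_def cinner_prod_def cinner_simps F_op_def blinfun.diff_left adj_cinner[OF S_lin])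
  show "cinner (deBranges_Rovnyak_kernel S z w y) v
      = cinner (u z (deBranges_Rovnyak_kernel E0 z w (adj (u w) y)) + F_op z (Q (adj (F_op w) y))) v"
    using lhs rhs A_kernel[of z w] by (simp add: c_def cinner_simps diff_eq_eq add.commute)
qed

end

section \<open>The interpolation problem\<close>

theorem theorem4p3:
  fixes E :: "'x::complex_hilbert \<Rightarrow>\<^sub>L 'y::complex_hilbert"
    and T :: "'d::finite \<Rightarrow> 'x \<Rightarrow>\<^sub>L 'x"
    and x :: 'x
    and S0 :: "'d unit_ball \<Rightarrow> 'u::complex_hilbert \<Rightarrow>\<^sub>L 'y"
    and S0c :: "('d \<Rightarrow> nat) \<Rightarrow> 'u \<Rightarrow>\<^sub>L 'y"
    and N :: "'x \<Rightarrow>\<^sub>L 'u"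
    and P :: "'x \<Rightarrow>\<^sub>L 'x"
    and A :: "'d unit_ball \<Rightarrow> ('f::complex_hilbert \<times> 'u) \<Rightarrow>\<^sub>L ('y \<times> 'u)"
    and A11 :: "'d unit_ball \<Rightarrow> 'f \<Rightarrow>\<^sub>L 'y"
    and A12 :: "'d unit_ball \<Rightarrow> 'u \<Rightarrow>\<^sub>L 'y"
    and A21 :: "'d unit_ball \<Rightarrow> 'f \<Rightarrow>\<^sub>L 'u"
    and A22 :: "'d unit_ball \<Rightarrow> 'u \<Rightarrow>\<^sub>L 'u"
    and E0 :: "'d unit_ball \<Rightarrow> 'u \<Rightarrow>\<^sub>L 'f"
    and HS :: "('d unit_ball \<Rightarrow> 'y) set"
    and ipS :: "('d unit_ball \<Rightarrow> 'y) \<Rightarrow> ('d unit_ball \<Rightarrow> 'y) \<Rightarrow> complex"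
    and HE :: "('d unit_ball \<Rightarrow> 'f) set"
    and ipE :: "('d unit_ball \<Rightarrow> 'f) \<Rightarrow> ('d unit_ball \<Rightarrow> 'f) \<Rightarrow> complex"
    and u :: "'d unit_ball \<Rightarrow> 'f \<Rightarrow>\<^sub>L 'y"
    and M :: "('d unit_ball \<Rightarrow> 'f) set"
    and f0 :: "'d unit_ball \<Rightarrow> 'y"
  assumes E_lin: "complex_linear E"
    and T_lin: "\<And>j. complex_linear (T j)"
    and T_comm: "commuting_tuple T"
    and stable: "output_stable E T"
    and S0_schur: "S0 \<in> schur_class"
    and S0c_lin: "\<And>n. complex_linear (S0c n)"
    and S0_series: "has_power_series S0c S0"
    and N_lin: "complex_linear N"
    and N_series: "has_weak_sum (\<lambda>n. adj (S0c n) o\<^sub>L E o\<^sub>L tuple_power T n) N"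
    and P_def: "P = obs_gramian E T - obs_gramian N T"
    and P_pos: "strictly_pos_def P"
    and A_lin: "\<And>z. complex_linear (A z)"
    and A_blocks: "\<And>z. A z = block_op (A11 z) (A12 z) (A21 z) (A22 z)"
    and A_kernel: "\<And>z w.
          (1 / (1 - ball_inner z w)) *\<^sub>C (J_op - (A z o\<^sub>L J_op o\<^sub>L adj (A w)))
        = block_col E N o\<^sub>L op_inv (id_blinfun - ZT T z) o\<^sub>L op_inv P
            o\<^sub>L op_inv (id_blinfun - adj (ZT T w)) o\<^sub>L block_row (adj E) (adj N)"
    and E0_schur: "E0 \<in> schur_class"
    and E0_inv: "\<And>z. op_invertible ((A21 z o\<^sub>L E0 z) + A22 z)"
    and S0_lft: "\<And>z. S0 z = ((A11 z o\<^sub>L E0 z) + A12 z) o\<^sub>L op_inv ((A21 z o\<^sub>L E0 z) + A22 z)"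
    and HS_rkhs: "rkhs (deBranges_Rovnyak_kernel S0) HS ipS"
    and HE_rkhs: "rkhs (deBranges_Rovnyak_kernel E0) HE ipE"
    and u_def: "u = (\<lambda>z. A11 z - (S0 z o\<^sub>L A21 z))"
    and M_def: "M = ortho_minus HE ipE (mult_kernel u HE)"
    and f0_def: "f0 = (\<lambda>z. (E - (S0 z o\<^sub>L N)) (op_inv (id_blinfun - ZT T z) (op_inv P x)))"
  shows "(\<forall>f. (f \<in> HS \<and> obs_adj E T f = x) \<longleftrightarrow> (\<exists>h\<in>M. f = (\<lambda>z. f0 z + u z (h z))))
    \<and> (\<forall>f. \<forall>h\<in>M. f = (\<lambda>z. f0 z + u z (h z)) \<longrightarrow>
          (ip_norm ipS f)\<^sup>2 = (ip_norm ipS f0)\<^sup>2 + (ip_norm ipS (\<lambda>z. u z (h z)))\<^sup>2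
        \<and> (ip_norm ipS f0)\<^sup>2 + (ip_norm ipS (\<lambda>z. u z (h z)))\<^sup>2
            = (norm (op_sqrt (op_inv P) x))\<^sup>2 + (ip_norm ipE h)\<^sup>2)"
proof -
  interpret schur_output_pair E T S0 S0c N
    by unfold_locales (fact E_lin T_lin T_comm stable S0_schur S0c_lin S0_series N_lin N_series)+
  have P_inv: "op_invertible P" and P_lin: "complex_linear P"
    using P_pos by (auto simp: strictly_pos_def_def pos_semidef_def)
  have inv: "op_invertible (id_blinfun - ZT T z)" for z
    using exactly_observable[OF P_pos P_def] by (rule op_invertible_resolvent)
  have E0_lin: "complex_linear (E0 z)" for z using E0_schur by (simp add: schur_class_def)
  interpret HS: rkhs "deBranges_Rovnyak_kernel S0" HS ipS by (rule HS_rkhs)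
  interpret HE: rkhs "deBranges_Rovnyak_kernel E0" HE ipE by (rule HE_rkhs)
  define R where "R = op_sqrt (op_inv P)"
  have R_psd: "pos_semidef R" and RR: "R (R v) = op_inv P v" for v
    using op_sqrt[OF strictly_pos_def_inv[OF P_pos]] by (auto simp: R_def)
  note R_self = pos_semidef_selfadjoint[OF R_psd]
  have RPR: "R (P (R v)) = v" for v
  proof -
    have "op_inv P (R (P (R v))) = R (R (R (P (R v))))" by (rule RR[symmetric])
    also have "\<dots> = R (R v)" by (simp add: RR op_inv_apply_left[OF P_inv])
    finally have "op_inv P (R (P (R v))) = op_inv P v" by (simp only: RR)
    then show ?thesis by (metis op_inv_apply_right[OF P_inv])
  qed
  define F where "F v = (\<lambda>z. F_op z v)" for v
  have F_mem: "F v \<in> HS" for v unfolding F_def by (rule F_op_mem[OF HS_rkhs inv])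
  have F_F: "ipS (F v) (F w) = cinner v (P w)" for v w
    unfolding F_def P_def by (rule ip_F_op_F_op[OF HS_rkhs inv])
  have F_adj: "ipS (F v) f = cinner v (obs_adj E T f)" if "f \<in> HS" for f v
    unfolding F_def by (rule ip_F_op_obs_adj[OF HS_rkhs inv that])
  have f0: "f0 = F (op_inv P x)"
    by (simp add: f0_def F_def F_op_def)

  interpret X: function_hilbert_space "const_space :: ('d unit_ball \<Rightarrow> 'x) set" const_ip
    by (rule function_hilbert_space_const)
  let ?G = "dsum HE (const_space :: ('d unit_ball \<Rightarrow> 'x) set)"
  let ?ipG = "dsum_ip ipE const_ip"
  interpret G: function_hilbert_space ?G ?ipG
    by (rule function_hilbert_space_dsum[OF HE.function_hilbert_space_axioms X.function_hilbert_space_axioms])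
  define \<phi> where "\<phi> w y = (\<lambda>z. (deBranges_Rovnyak_kernel E0 z w (adj (u w) y), R (adj (F_op w) y)))" for w y
  define \<Gamma> where "\<Gamma> g = (\<lambda>z. u z (fst (g z)) + F_op z (R (snd (g z))))" for g :: "'d unit_ball \<Rightarrow> 'f \<times> 'x"
  have u_lin: "complex_linear (u z)" for z
    using complex_linear_block_op[OF A_lin[of z, unfolded A_blocks]]
    unfolding u_def by (intro complex_linear_diff complex_linear_compose S_lin) auto
  interpret \<Gamma>: feature_map "deBranges_Rovnyak_kernel S0" HS ipS ?G ?ipG \<phi> \<Gamma>
  proof
    show "\<phi> w y \<in> ?G" for w y
      by (simp add: \<phi>_def dsum_def HE.kernel_mem const_space_def)
    show "\<Gamma> (\<phi> q y) = (\<lambda>w. deBranges_Rovnyak_kernel S0 w q y)" for q y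
      using deBranges_Rovnyak_kernel_decomposition[OF inv A_lin A_blocks A_kernel E0_lin E0_inv S0_lft u_def]
      by (simp add: \<Gamma>_def \<phi>_def RR)
    fix g w y assume g: "g \<in> ?G"
    then obtain v where v: "\<And>z. snd (g z) = v" by (auto simp: dsum_def const_space_def fun_eq_iff)
    have g1: "(\<lambda>z. fst (g z)) \<in> HE" using g by (simp add: dsum_def)
    show "cinner (\<Gamma> g w) y = ?ipG g (\<phi> w y)"
      by (simp add: \<Gamma>_def \<phi>_def dsum_ip_def const_ip_def v HE.reproducing[OF g1] cinner_simps
          adj_cinner[OF u_lin] adj_cinner[OF complex_linear_F_op[OF inv]] R_self)
  qed

  define pair where "pair h v = (\<lambda>z::'d unit_ball. (h z, v))" for h :: "'d unit_ball \<Rightarrow> 'f" and v :: 'x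
  have pair_mem: "pair h v \<in> ?G" if "h \<in> HE" for h v
    using that by (simp add: pair_def dsum_def const_space_def)
  have pair_cases: "\<exists>h\<in>HE. \<exists>v. g = pair h v" if g: "g \<in> ?G" for g
  proof -
    obtain v where v: "\<And>z. snd (g z) = v" using g by (auto simp: dsum_def const_space_def fun_eq_iff)
    have "g = pair (\<lambda>z. fst (g z)) v" by (auto simp: pair_def fun_eq_iff prod_eq_iff v)
    then show ?thesis using g by (auto simp: dsum_def)
  qed
  have ip_pair: "?ipG (pair h v) (pair k w) = ipE h k + cinner v w" for h k v w
    by (simp add: pair_def dsum_ip_def const_ip_def)
  have nrm_pair: "(G.nrm (pair h v))\<^sup>2 = (HE.nrm h)\<^sup>2 + (norm v)\<^sup>2" if "h \<in> HE" for h v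
    using that by (simp add: G.nrm_sq[OF pair_mem] HE.nrm_sq ip_pair cinner_self)
  have \<Gamma>_pair: "\<Gamma> (pair h v) = (\<lambda>z. u z (h z)) + F (R v)" for h v
    by (simp add: \<Gamma>_def pair_def F_def fun_eq_iff)
  have F_zero: "F 0 = 0" by (simp add: F_def fun_eq_iff)
  have zero_HE: "0 \<in> HE" by simp
  have u_zero: "(\<lambda>z. u z ((0 :: 'd unit_ball \<Rightarrow> 'f) z)) = 0" by (simp add: fun_eq_iff)

  \<comment> \<open>\<open>\<Gamma>\<close> is isometric on \<open>0 \<oplus> \<X>\<close>; a coisometry can be so only if its kernel is orthogonal to that.\<close>
  have F_nrm: "(HS.nrm (F (R v)))\<^sup>2 = (norm v)\<^sup>2" for v
    by (simp add: HS.nrm_sq[OF F_mem] F_F R_self RPR cinner_self)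
  have ker: "v = 0 \<and> h \<in> mult_kernel u HE" if h: "h \<in> HE" and zero: "\<Gamma> (pair h v) = 0" for h v
  proof -
    have "HS.nrm (\<Gamma> (pair 0 v)) = G.nrm (pair 0 v)"
    proof (rule power2_eq_imp_eq)
      show "(HS.nrm (\<Gamma> (pair 0 v)))\<^sup>2 = (G.nrm (pair 0 v))\<^sup>2"
        using F_nrm[of v] by (simp only: nrm_pair[OF zero_HE] \<Gamma>_pair u_zero HS.nrm_zero HE.nrm_zero) simp
    qed (simp_all add: pair_mem \<Gamma>.Gamma_mem)
    then have "?ipG (pair 0 v) (pair h v) = 0"
      using \<Gamma>.nrm_Gamma_eq_iff[OF pair_mem[OF zero_HE]] pair_mem[OF h] zero by blast
    then have v: "v = 0" by (simp only: ip_pair HE.ip_zero_l[OF h]) (simp add: cinner_self)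
    have "(\<lambda>z. u z (h z)) = 0"
      using zero by (simp only: \<Gamma>_pair v blinfun.zero_right F_zero add_0_right)
    then show ?thesis using v h by (simp add: mult_kernel_def zero_fun_def)
  qed
  \<comment> \<open>As the kernel of \<open>\<Gamma>\<close> lies in the first summand, the second component of a pair does not affect
    whether the pair is orthogonal to it.\<close>
  have M_mem: "h \<in> M \<longleftrightarrow> h \<in> HE \<and> (\<forall>k\<in>?G. \<Gamma> k = 0 \<longrightarrow> ?ipG (pair h v) k = 0)" for h v
  proof
    assume "h \<in> M"
    then have h: "h \<in> HE" "\<And>k. k \<in> mult_kernel u HE \<Longrightarrow> ipE h k = 0"
      by (auto simp: M_def ortho_minus_def)
    have "?ipG (pair h v) k = 0" if k: "k \<in> ?G" "\<Gamma> k = 0" for k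
    proof -
      obtain l w where l: "l \<in> HE" "k = pair l w" using pair_cases[OF k(1)] by blast
      then have "w = 0" "l \<in> mult_kernel u HE" using ker[of l w] k(2) by simp_all
      then show ?thesis using h(2) by (simp add: l ip_pair)
    qed
    then show "h \<in> HE \<and> (\<forall>k\<in>?G. \<Gamma> k = 0 \<longrightarrow> ?ipG (pair h v) k = 0)" using h(1) by blast
  next
    assume h: "h \<in> HE \<and> (\<forall>k\<in>?G. \<Gamma> k = 0 \<longrightarrow> ?ipG (pair h v) k = 0)"
    have "ipE h k = 0" if k: "k \<in> mult_kernel u HE" for k
    proof -
      have kH: "k \<in> HE" and uk: "(\<lambda>z. u z (k z)) = 0" using k by (auto simp: mult_kernel_def zero_fun_def)
      have "\<Gamma> (pair k 0) = 0" by (simp only: \<Gamma>_pair uk blinfun.zero_right F_zero add_0_right)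
      then have "?ipG (pair h v) (pair k 0) = 0" using h pair_mem[OF kH] by blast
      then show ?thesis by (simp add: ip_pair)
    qed
    then show "h \<in> M" using h by (simp add: M_def ortho_minus_def)
  qed
  have M_HE: "h \<in> HE" if "h \<in> M" for h using that M_mem by blast

  have nrm_sol: "(HS.nrm ((\<lambda>z. u z (h z)) + F (R v)))\<^sup>2 = (HE.nrm h)\<^sup>2 + (norm v)\<^sup>2" if h: "h \<in> M" for h v
  proof -
    have "HS.nrm (\<Gamma> (pair h v)) = G.nrm (pair h v)"
      using \<Gamma>.nrm_Gamma_eq_iff[OF pair_mem[OF M_HE[OF h]]] M_mem h by blast
    then show ?thesis using nrm_pair[OF M_HE[OF h], of v] by (simp add: \<Gamma>_pair)
  qed
  have u_mem: "(\<lambda>z. u z (h z)) \<in> HS" if h: "h \<in> HE" for h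
    using \<Gamma>.Gamma_mem[OF pair_mem[OF h, of 0]] unfolding \<Gamma>_pair blinfun.zero_right F_zero by simp
  have nrm_u: "(HS.nrm (\<lambda>z. u z (h z)))\<^sup>2 = (HE.nrm h)\<^sup>2" if h: "h \<in> M" for h
    using nrm_sol[OF h, of 0] unfolding blinfun.zero_right F_zero add_0_right by simp
  \<comment> \<open>Comparing norms gives only the real part of the inner product of \<open>u h\<close> with \<open>F w\<close>; testing
    with \<open>w = \<O>\<^sup>*(u h)\<close>, where the inner product is \<open>\<parallel>w\<parallel>\<^sup>2\<close>, makes this sufficient.\<close>
  have u_perp: "obs_adj E T (\<lambda>z. u z (h z)) = 0" if h: "h \<in> M" for h
  proof -
    have uH: "(\<lambda>z. u z (h z)) \<in> HS" by (rule u_mem[OF M_HE[OF h]])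
    define v where "v = obs_adj E T (\<lambda>z. u z (h z))"
    have v: "v = R (R (P v))" by (simp add: RR op_inv_apply_left[OF P_inv])
    have "Re (ipS (\<lambda>z. u z (h z)) (F (R (R (P v))))) = 0"
      using HS.nrm_sq_add[OF uH F_mem, of "R (R (P v))"] nrm_sol[OF h, of "R (P v)"] nrm_u[OF h] F_nrm[of "R (P v)"]
      by simp
    then have "Re (ipS (F v) (\<lambda>z. u z (h z))) = 0"
      using arg_cong[OF HS.ip_commute[OF F_mem uH, of v], of Re] v by simp
    then have "(norm v)\<^sup>2 = 0" using F_adj[OF uH, of v] by (simp add: cinner_self flip: v_def)
    then show ?thesis by (simp add: v_def)
  qed

  have solution: "f \<in> HS \<and> obs_adj E T f = x \<longleftrightarrow> (\<exists>h\<in>M. f = (\<lambda>z. f0 z + u z (h z)))" for f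
  proof
    assume f: "f \<in> HS \<and> obs_adj E T f = x"
    then obtain g where g: "g \<in> ?G" "\<Gamma> g = f" "\<And>k. k \<in> ?G \<Longrightarrow> \<Gamma> k = 0 \<Longrightarrow> ?ipG g k = 0"
      using \<Gamma>.Gamma_onto[of f] by blast
    obtain h v where h: "h \<in> HE" "g = pair h v" using pair_cases[OF g(1)] by blast
    have hM: "h \<in> M" using M_mem[of h v] g h by blast
    have uH: "(\<lambda>z. u z (h z)) \<in> HS" by (rule u_mem[OF h(1)])
    have f_eq: "f = (\<lambda>z. u z (h z)) + F (R v)" using g h \<Gamma>_pair by simp
    have "cinner w x = cinner w (P (R v))" for w
    proof -
      have "cinner w x = ipS (F w) f" using f F_adj by simp
      also have "\<dots> = ipS (F w) (\<lambda>z. u z (h z)) + ipS (F w) (F (R v))"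
        unfolding f_eq by (rule HS.ip_add_r[OF uH F_mem F_mem])
      also have "\<dots> = cinner w (P (R v))" using F_adj[OF uH] u_perp[OF hM] F_F by simp
      finally show ?thesis .
    qed
    then have "x = P (R v)" by (rule cinner_eqI_right)
    then have "R v = op_inv P x" by (simp add: op_inv_apply_left[OF P_inv])
    then have "f = (\<lambda>z. f0 z + u z (h z))" by (simp add: f_eq f0 fun_eq_iff add.commute)
    then show "\<exists>h\<in>M. f = (\<lambda>z. f0 z + u z (h z))" using hM by blast
  next
    assume "\<exists>h\<in>M. f = (\<lambda>z. f0 z + u z (h z))"
    then obtain h where h: "h \<in> M" and f: "f = f0 + (\<lambda>z. u z (h z))" by (auto simp: fun_eq_iff)
    have uH: "(\<lambda>z. u z (h z)) \<in> HS" by (rule u_mem[OF M_HE[OF h]])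
    have fH: "f \<in> HS" unfolding f f0 by (rule HS.add_in[OF F_mem uH])
    have "cinner w (obs_adj E T f) = cinner w x" for w
    proof -
      have "cinner w (obs_adj E T f) = ipS (F w) (F (op_inv P x)) + ipS (F w) (\<lambda>z. u z (h z))"
        using F_adj[OF fH, of w] unfolding f f0 by (simp add: HS.ip_add_r[OF F_mem uH F_mem])
      also have "\<dots> = cinner w x"
        using F_adj[OF uH] u_perp[OF h] by (simp add: F_F op_inv_apply_right[OF P_inv])
      finally show ?thesis .
    qed
    then show "f \<in> HS \<and> obs_adj E T f = x" using fH cinner_eqI_right by blast
  qed
  have f0_R: "f0 = F (R (R x))" by (simp add: f0 RR)
  have "(HS.nrm f)\<^sup>2 = (HS.nrm f0)\<^sup>2 + (HS.nrm (\<lambda>z. u z (h z)))\<^sup>2 \<and>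
      (HS.nrm f0)\<^sup>2 + (HS.nrm (\<lambda>z. u z (h z)))\<^sup>2 = (norm (op_sqrt (op_inv P) x))\<^sup>2 + (HE.nrm h)\<^sup>2"
    if h: "h \<in> M" and f: "f = (\<lambda>z. f0 z + u z (h z))" for f h
  proof -
    have f': "f = (\<lambda>z. u z (h z)) + F (R (R x))" by (simp add: f f0_R fun_eq_iff add.commute)
    have "(HS.nrm f)\<^sup>2 = (HE.nrm h)\<^sup>2 + (norm (R x))\<^sup>2" unfolding f' by (rule nrm_sol[OF h])
    moreover have "(HS.nrm f0)\<^sup>2 = (norm (R x))\<^sup>2" unfolding f0_R by (rule F_nrm)
    ultimately show ?thesis using nrm_u[OF h] by (simp add: R_def)
  qed
  then show ?thesis using solution by blast
qed

end
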